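(* Let $k\ge 2$ and let $f$ be a nonnegative, nondegenerate real-valued $k$-regular sequence with minimal nondegenerate linear representation $(\mathbf u,\mathcal A,\mathbf v)$. Then $\rho^*(\widehat{\mathcal A})<\rho(\widehat{\mathbf A})$ if and only if all ghost measures $\mu_h$, $h\in G$, of $f$ are continuous (i.e. have no atoms).
   Context: Regular sequences. Fix an integer $k\ge2$. For $n\ge1$ let $(n)_k=i_s\cdots i_0$ be the base-$k$ expansion ($i_s\ne0$), and for $d\times d$ matrices $\mathbf A_0,\dots,\mathbf A_{k-1}$ put $\mathbf A_{(n)_k}=\mathbf A_{i_s}\cdots\mathbf A_{i_0}$, with $\mathbf A_{(0)_k}$ the identity. A real sequence $f=(f(n))_{n\ge0}$ is $k$-regular if its $k$-kernel $\{(f(k^\ell n+r))_{n\ge 0}:\ell\ge0,\ 0\le r<k^\ell\}$ spans a finite-dimensional real vector space $V_k(f)$. A linear representation of $f$ of degree $d$ is a tuple $(\mathbf u,\mathcal A,\mathbf v)$ with $\mathbf u,\mathbf v\in\mathbb R^{d}$, $\mathcal A=\{\mathbf A_0,\dots,\mathbf A_{k-1}\}\subset\mathbb R^{d\times d}$ and $f(n)=\mathbf u^T\mathbf A_{(n)_k}\mathbf v$ for all $n\ge 0$; it is minimal if $d=\dim V_k(f)$. Put $\mathbf A=\sum_{j=0}^{k-1}\mathbf A_j$. Ghost measures. For nonnegative $f$ put $\Sigma_f(N)=\sum_{m=k^N}^{k^{N+1}-1}f(m)$ and, when $\Sigma_f(N)\neq0$, $\mu_N=\frac1{\Sigma_f(N)}\sum_{m=0}^{k^{N+1}-k^N-1}f(k^N+m)\,\delta_{m/(k^N(k-1))}$,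 a probability measure on $\mathbb T=[0,1)$ with addition mod $1$. Ghost measures of $f$ are the weak accumulation points of $(\mu_N)_N$. Group and nondegeneracy. Let $V\subset\mathbb R^d$ be the subspace with $V^T=\mathrm{span}\{\mathbf u^T\mathbf A_{(n)_k}:n\ge1\}$, $\mathbf P_V$ the orthogonal projection onto $V$, $\widetilde{\mathbf A}_i=\mathbf P_V\mathbf A_i\mathbf P_V$, $\widetilde{\mathbf A}=\mathbf P_V\mathbf A\mathbf P_V$, $\rho=\rho(\widetilde{\mathbf A})$ the spectral radius, $\{g_1\rho,\dots,g_s\rho\}$ ($|g_i|=1$) the eigenvalues of $\widetilde{\mathbf A}$ of modulus $\rho$, $g=(g_1,\dots,g_s)$ and $G=\overline{\{g^n:n\in\mathbb N\}}$ (closure in the $s$-fold product of the complex unit circle). For $h\in G$ let $\mathbf R_h$ be multiplication by $h_m$ on the generalised eigenspace in $V$ (complexified) of $\widetilde{\mathbf A}$ for $g_m\rho$, and the identity on the other generalised eigenspaces in $V$ and on $V^\perp$; $\mathbf R=\mathbf R_{g^{-1}}$. Let $r$ be the maximal size of a Jordan block of $\widetilde{\mathbf A}$ for an eigenvalue of modulus $\rho$, $c_n=\frac{(r-1)!}{n^{r-1}\rho^{n-r+1}}$, $\mathbf P=\lim_{n\to\infty}c_n\mathbf R^n\widetilde{\mathbf A}^n$ (the limit exists). The representation is nondegenerate if $\rho>0$ and $\mathbf u^T(\mathbf A-\mathbf A_0)\mathbf R_h\mathbf P\mathbf v>0$ for all $h\in G$; $f$ is nondegenerate if it has a minimal nondegenerate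 linear representation. In that case, for each $h\in G$ the measures $\mu_{n_j}$ converge weakly to one and the same measure $\mu_h$ along every sequence $n_j\to\infty$ with $g^{n_j}\to h$, and the ghost measures of $f$ are exactly the $\mu_h$, $h\in G$. Reduced subspace. $\widehat V=\mathrm{span}\{\widetilde{\mathbf A}_0^m\widetilde{\mathbf A}_{(n)_k}\mathbf R_h\mathbf P\mathbf v: m,n\ge0,\ h\in G\}\subset V$ (with $\widetilde{\mathbf A}_{(0)_k}$ the identity), $\mathbf P_{\widehat V}$ is the orthogonal projection onto $\widehat V$, $\widehat{\mathbf A}_i=\mathbf P_{\widehat V}\widetilde{\mathbf A}_i\mathbf P_{\widehat V}$, $\widehat{\mathcal A}=\{\widehat{\mathbf A}_0,\dots,\widehat{\mathbf A}_{k-1}\}$, $\widehat{\mathbf A}=\sum_i\widehat{\mathbf A}_i$. The joint spectral radius is $\rho^*(\widehat{\mathcal A})=\lim_{n\to\infty}\max_{i_1,\dots,i_n}\|\widehat{\mathbf A}_{i_1}\cdots\widehat{\mathbf A}_{i_n}\|^{1/n}$, and $\rho(\widehat{\mathbf A})$ is the spectral radius. *)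

theory Defs
  imports
    "HOL-Probability.Probability"
    "HOL-Library.Function_Algebras"
    "Jordan_Normal_Form.Spectral_Radius"
begin

section \<open>Regular sequences and linear representations\<close>

interpretation seq: vector_space "\<lambda>(c::real) (f::nat \<Rightarrow> real) n. c * f n"
  by unfold_locales (auto simp: fun_eq_iff algebra_simps)

definition kernel :: "nat \<Rightarrow> (nat \<Rightarrow> real) \<Rightarrow> (nat \<Rightarrow> real) set" where
  "kernel k f = {\<lambda>n. f (k ^ l * n + r) | l r. r < k ^ l}"

definition kernel_space :: "nat \<Rightarrow> (nat \<Rightarrow> real) \<Rightarrow> (nat \<Rightarrow> real) set" where
  "kernel_space k f = seq.span (kernel k f)"

definition regular :: "nat \<Rightarrow> (nat \<Rightarrow> real) \<Rightarrow> bool" where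
  "regular k f \<longleftrightarrow> (\<exists>B. finite B \<and> kernel_space k f = seq.span B)"

text \<open>The product over the base-\<open>k\<close> digits of \<open>n\<close>, most significant digit leftmost; the identity
  for \<open>n = 0\<close>. The guard \<open>k < 2\<close> only serves termination.\<close>

function digit_prod :: "nat \<Rightarrow> (nat \<Rightarrow> real^'d^'d) \<Rightarrow> nat \<Rightarrow> real^'d^'d" where
  "digit_prod k A n =
     (if n = 0 \<or> k < 2 then Finite_Cartesian_Product.mat 1
      else digit_prod k A (n div k) ** A (n mod k))"
  by auto
termination
  by (relation "Wellfounded.measure (\<lambda>(k, A, n). n)") auto

declare digit_prod.simps [simp del]

definition linear_representation ::
  "nat \<Rightarrow> (nat \<Rightarrow> real) \<Rightarrow> real^'d \<Rightarrow> (nat \<Rightarrow> real^'d^'d) \<Rightarrow> real^'d \<Rightarrow> bool" where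
  "linear_representation k f u A v \<longleftrightarrow> (\<forall>n. f n = u \<bullet> (digit_prod k A n *v v))"

definition minimal_representation ::
  "nat \<Rightarrow> (nat \<Rightarrow> real) \<Rightarrow> real^'d \<Rightarrow> (nat \<Rightarrow> real^'d^'d) \<Rightarrow> real^'d \<Rightarrow> bool" where
  "minimal_representation k f u A v \<longleftrightarrow>
     linear_representation k f u A v \<and> CARD('d) = seq.dim (kernel_space k f)"


section \<open>Spectral data of a real matrix\<close>

definition complex_matrix :: "real^'d^'d \<Rightarrow> complex^'d^'d" where
  "complex_matrix M = (\<chi> i j. complex_of_real (M $ i $ j))"

text \<open>The same complex matrix with respect to some enumeration of the index type. Everything
  taken from it below is invariant under similarity, so the enumeration is irrelevant.\<close>

definition cmat :: "real^'d^'d \<Rightarrow> complex mat" where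
  "cmat M = (let e = from_nat_into (UNIV :: 'd set) in
     Matrix.mat CARD('d) CARD('d) (\<lambda>(i, j). complex_of_real (M $ e i $ e j)))"

abbreviation spec_rad :: "real^'d^'d \<Rightarrow> real" where
  "spec_rad M \<equiv> spectral_radius (cmat M)"

text \<open>The maximum runs over all Jordan normal forms; these agree up to the order of the blocks.\<close>

definition max_block :: "real^'d^'d \<Rightarrow> nat" where
  "max_block M = Max {m. \<exists>n_as z.
     jordan_nf (cmat M) n_as \<and> (m, z) \<in> set n_as \<and> cmod z = spec_rad M}"

definition matrix_power :: "real^'d^'d \<Rightarrow> nat \<Rightarrow> real^'d^'d" where
  "matrix_power M n = (((**) M) ^^ n) (Finite_Cartesian_Product.mat 1)"

definition gen_eigenspace :: "real^'d^'d \<Rightarrow> complex \<Rightarrow> (complex^'d) set" where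
  "gen_eigenspace M z =
     {w. \<exists>n. ((\<lambda>x. complex_matrix M *v x - z *s x) ^^ n) w = 0}"

definition complexified :: "(real^'d) set \<Rightarrow> (complex^'d) set" where
  "complexified S = {w. (\<chi> i. Re (w $ i)) \<in> S \<and> (\<chi> i. Im (w $ i)) \<in> S}"

text \<open>The matrix of the orthogonal projection onto the subspace \<open>S\<close>.\<close>

definition proj :: "(real^'d) set \<Rightarrow> real^'d^'d" where
  "proj S = (THE P. \<forall>x. P *v x \<in> S \<and> x - P *v x \<in> S\<^sup>\<bottom>)"

definition compress :: "(real^'d) set \<Rightarrow> real^'d^'d \<Rightarrow> real^'d^'d" where
  "compress S M = proj S ** M ** proj S"

definition matrix_sum :: "nat \<Rightarrow> (nat \<Rightarrow> real^'d^'d) \<Rightarrow> real^'d^'d" where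
  "matrix_sum k A = (\<Sum>j<k. A j)"

definition joint_spectral_radius :: "nat \<Rightarrow> (nat \<Rightarrow> real^'d^'d) \<Rightarrow> real" where
  "joint_spectral_radius k B = lim (\<lambda>n.
     Max ((\<lambda>w. onorm ((*v) (foldr (**) (map B w) (Finite_Cartesian_Product.mat 1)))
                powr (1 / real n))
          ` {w. set w \<subseteq> {..<k} \<and> length w = n}))"


section \<open>The group of phases\<close>

text \<open>With \<open>g\<^sub>1, \<dots>, g\<^sub>s\<close> the elements of \<open>phases M\<close>, the tuples
  \<open>h = (h\<^sub>1, \<dots>, h\<^sub>s)\<close> are encoded as functions \<open>h\<close> with \<open>h g\<^sub>m = h\<^sub>m\<close> that are \<open>1\<close> off
  \<open>phases M\<close>; on such functions the product topology is that of the \<open>s\<close>-fold product.\<close>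

definition phases :: "real^'d^'d \<Rightarrow> complex set" where
  "phases M = {\<gamma>. cmod \<gamma> = 1 \<and> eigenvalue (cmat M) (\<gamma> * complex_of_real (spec_rad M))}"

definition phase_power :: "real^'d^'d \<Rightarrow> nat \<Rightarrow> complex \<Rightarrow> complex" where
  "phase_power M n = (\<lambda>\<gamma>. if \<gamma> \<in> phases M then \<gamma> ^ n else 1)"

definition phase_group :: "real^'d^'d \<Rightarrow> (complex \<Rightarrow> complex) set" where
  "phase_group M = closure (range (phase_power M))"

text \<open>For \<open>h\<close> in the phase group the complex operator described here commutes with complex
  conjugation, since \<open>h (cnj \<gamma>) = cnj (h \<gamma>)\<close>; it is therefore given by a real matrix.\<close>

definition rotation :: "(real^'d) set \<Rightarrow> real^'d^'d \<Rightarrow> (complex \<Rightarrow> complex) \<Rightarrow> real^'d^'d" where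
  "rotation S M h = (THE R.
     (\<forall>\<gamma>\<in>phases M. \<forall>w \<in> gen_eigenspace M (\<gamma> * complex_of_real (spec_rad M)) \<inter> complexified S.
        complex_matrix R *v w = h \<gamma> *s w) \<and>
     (\<forall>z. cmod z \<noteq> spec_rad M \<longrightarrow>
        (\<forall>w \<in> gen_eigenspace M z \<inter> complexified S. complex_matrix R *v w = w)) \<and>
     (\<forall>x \<in> S\<^sup>\<bottom>. R *v x = x))"


section \<open>Nondegeneracy and the reduced matrices\<close>

definition rep_space :: "nat \<Rightarrow> real^'d \<Rightarrow> (nat \<Rightarrow> real^'d^'d) \<Rightarrow> (real^'d) set" where
  "rep_space k u A = Real_Vector_Spaces.span {u v* digit_prod k A n | n. n \<ge> 1}"

definition tilde :: "nat \<Rightarrow> real^'d \<Rightarrow> (nat \<Rightarrow> real^'d^'d) \<Rightarrow> nat \<Rightarrow> real^'d^'d" where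
  "tilde k u A i = compress (rep_space k u A) (A i)"

definition tilde_sum :: "nat \<Rightarrow> real^'d \<Rightarrow> (nat \<Rightarrow> real^'d^'d) \<Rightarrow> real^'d^'d" where
  "tilde_sum k u A = compress (rep_space k u A) (matrix_sum k A)"

abbreviation rep_group :: "nat \<Rightarrow> real^'d \<Rightarrow> (nat \<Rightarrow> real^'d^'d) \<Rightarrow> (complex \<Rightarrow> complex) set" where
  "rep_group k u A \<equiv> phase_group (tilde_sum k u A)"

definition rep_rotation ::
  "nat \<Rightarrow> real^'d \<Rightarrow> (nat \<Rightarrow> real^'d^'d) \<Rightarrow> (complex \<Rightarrow> complex) \<Rightarrow> real^'d^'d" where
  "rep_rotation k u A h = rotation (rep_space k u A) (tilde_sum k u A) h"

definition limit_matrix :: "nat \<Rightarrow> real^'d \<Rightarrow> (nat \<Rightarrow> real^'d^'d) \<Rightarrow> real^'d^'d" where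
  "limit_matrix k u A =
     (let M = tilde_sum k u A; r = max_block M;
          R = rep_rotation k u A (\<lambda>\<gamma>. inverse (phase_power M 1 \<gamma>))
      in lim (\<lambda>n. (fact (r - 1) / (real n ^ (r - 1) * spec_rad M powi (int n - int r + 1)))
                   *\<^sub>R (matrix_power R n ** matrix_power M n)))"

definition nondegenerate_representation ::
  "nat \<Rightarrow> real^'d \<Rightarrow> (nat \<Rightarrow> real^'d^'d) \<Rightarrow> real^'d \<Rightarrow> bool" where
  "nondegenerate_representation k u A v \<longleftrightarrow>
     spec_rad (tilde_sum k u A) > 0 \<and>
     (\<forall>h \<in> rep_group k u A.
        u \<bullet> (((matrix_sum k A - A 0) ** rep_rotation k u A h ** limit_matrix k u A) *v v) > 0)"

definition hat_space :: "nat \<Rightarrow> real^'d \<Rightarrow> (nat \<Rightarrow> real^'d^'d) \<Rightarrow> real^'d \<Rightarrow> (real^'d) set" where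
  "hat_space k u A v = Real_Vector_Spaces.span
     {(matrix_power (tilde k u A 0) m ** digit_prod k (tilde k u A) n **
       rep_rotation k u A h ** limit_matrix k u A) *v v | m n h. h \<in> rep_group k u A}"

definition hat :: "nat \<Rightarrow> real^'d \<Rightarrow> (nat \<Rightarrow> real^'d^'d) \<Rightarrow> real^'d \<Rightarrow> nat \<Rightarrow> real^'d^'d" where
  "hat k u A v i = compress (hat_space k u A v) (tilde k u A i)"


section \<open>Ghost measures\<close>

text \<open>The circle is \<open>[0,1)\<close> with its Borel sets (which are the same for the circle and the usual
  topology). Continuous functions on the circle are continuous functions of period \<open>1\<close> on the
  line, so weak convergence is with respect to the topology of the circle.\<close>

definition circle :: "real measure" where
  "circle = restrict_space borel {0..<1}"

definition weak_limit_circle :: "(nat \<Rightarrow> real measure) \<Rightarrow> real measure \<Rightarrow> bool" where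
  "weak_limit_circle M \<mu> \<longleftrightarrow>
     (\<forall>\<phi>::real \<Rightarrow> real. continuous_on UNIV \<phi> \<and> (\<forall>x. \<phi> (x + 1) = \<phi> x) \<longrightarrow>
        (\<lambda>j. \<integral>x. \<phi> x \<partial>M j) \<longlonglongrightarrow> (\<integral>x. \<phi> x \<partial>\<mu>))"

definition level_sum :: "nat \<Rightarrow> (nat \<Rightarrow> real) \<Rightarrow> nat \<Rightarrow> real" where
  "level_sum k f N = (\<Sum>m = k ^ N..<k ^ (N + 1). f m)"

text \<open>The sum of point masses \<open>f (k ^ N + m) / level_sum k f N\<close> at \<open>m / (k ^ N * (k - 1))\<close>,
  meaningful for \<open>level_sum k f N \<noteq> 0\<close>; for nondegenerate \<open>f\<close> this excludes only finitely many \<open>N\<close>.\<close>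

definition level_measure :: "nat \<Rightarrow> (nat \<Rightarrow> real) \<Rightarrow> nat \<Rightarrow> real measure" where
  "level_measure k f N =
     distr (point_measure {0..<k ^ (N + 1) - k ^ N} (\<lambda>m. ennreal (f (k ^ N + m) / level_sum k f N)))
       circle (\<lambda>m. real m / (real k ^ N * (real k - 1)))"

text \<open>The common weak limit of the level measures along all sequences \<open>n\<^sub>j \<longrightarrow> \<infinity>\<close> of levels for
  which the powers \<open>g ^ n\<^sub>j\<close> converge to \<open>h\<close>.\<close>

definition ghost_measure ::
  "nat \<Rightarrow> (nat \<Rightarrow> real) \<Rightarrow> real^'d \<Rightarrow> (nat \<Rightarrow> real^'d^'d) \<Rightarrow> (complex \<Rightarrow> complex) \<Rightarrow> real measure" where
  "ghost_measure k f u A h = (THE \<mu>. prob_space \<mu> \<and> sets \<mu> = sets circle \<and>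
     (\<forall>n :: nat \<Rightarrow> nat. filterlim n at_top sequentially \<and>
        (\<lambda>j. phase_power (tilde_sum k u A) (n j)) \<longlonglongrightarrow> h \<longrightarrow>
        weak_limit_circle (\<lambda>j. level_measure k f (n j)) \<mu>))"

definition atomless :: "real measure \<Rightarrow> bool" where
  "atomless \<mu> \<longleftrightarrow> (\<forall>x\<in>space \<mu>. emeasure \<mu> {x} = 0)"

end

theory Submission
  imports Defs
begin

text \<open>Every cluster point of the normalised states \<open>c\<^sub>N A\<^sup>N v\<close> is one of the vectors \<open>R\<^sub>h P v\<close>, and the
  mass that a ghost measure gives to a \<open>k\<close>-adic interval with leading digits \<open>n\<close> is the limit of
  \<open>u\<^sup>T A\<^sub>n R\<^sub>h P v / \<rho>\<^sup>L\<close> up to factors bounded away from \<open>0\<close> and \<open>\<infinity>\<close>, where \<open>L + 1\<close> is the number of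
  digits of \<open>n\<close>. By compactness of the circle and of the group of phases, all ghost measures are free of
  atoms iff these masses tend to \<open>0\<close> uniformly in \<open>n\<close> and \<open>h\<close> as \<open>L \<rightarrow> \<infinity>\<close>. As the rows
  \<open>u\<^sup>T A\<^sub>n\<close> span \<open>V\<close> and the vectors \<open>A\<^sub>w R\<^sub>h P v\<close> span the reduced subspace, the uniform decay says that
  all products of \<open>l\<close> reduced matrices are \<open>o(\<rho>\<^sup>l)\<close>, which by submultiplicativity means that the joint
  spectral radius is less than \<open>\<rho>\<close>; and \<open>\<rho>\<close> is also the spectral radius of the sum of the reduced
  matrices, because its powers map \<open>R\<^sub>h P v\<close> to \<open>\<rho>\<^sup>l\<close> times another such vector.\<close>

text \<open>Rotations, the limit matrix and the ghost measures are definite descriptions or limits,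
  so half of the work is to show that they denote anything: a Jordan basis with its dual basis
  serves for the first two, weak compactness and Riemann sums over \<open>k\<close>-adic intervals
  for the third. Everything can be compressed to the row space because it is invariant under right
  multiplication by the digit matrices: a row cannot distinguish \<open>A i\<close> from its
  compression. Nondegeneracy is positivity for each single \<open>h\<close>; it becomes a uniform
  lower bound of the total mass by passing to convergent subsequences of levels. Intervals are
  compared with points through periodic bump functions, since an atom may sit on a common end point
  of intervals at every level and its mass is then spread over neighbours, whose number is bounded.
  Decay is stated one-sidedly for rows and limit states, which is harmless because these products
  are nonnegative; linear combinations need absolute values, and uniformity is recovered for the
  finitely many matrix entries.\<close>

no_notation vec_index (infixl "$" 100)
no_notation scalar_prod (infix "\<bullet>" 70)
hide_const (open) VectorSpace.subspace Matrix.orthogonal Matrix.mat Matrix.vec Matrix.row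
hide_fact (open) Matrix.orthogonal_def

section \<open>Jordan bases\<close>

text \<open>Position of the index \<open>j\<close> inside its Jordan block, followed by the size and eigenvalue of that block.\<close>

fun block_pos :: "(nat \<times> 'a) list \<Rightarrow> nat \<Rightarrow> nat \<times> nat \<times> 'a" where
  "block_pos [] j = (0, undefined)"
| "block_pos ((n, a) # xs) j = (if j < n then (j, n, a) else block_pos xs (j - n))"

lemma block_pos_mem:
  assumes "j < sum_list (map fst xs)" "block_pos xs j = (p, n, a)"
  shows "(n, a) \<in> set xs" "p < n"
  using assms by (induction xs j rule: block_pos.induct) (auto split: if_splits)

lemma block_pos_0: "fst (block_pos xs 0) = 0"
proof (induction xs)
  case (Cons x xs)
  then show ?case by (cases x) auto
qed auto

text \<open>A nonzero position is not the start of a block, so the preceding index lies in the same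
  block.\<close>

lemma block_pos_Suc:
  assumes "Suc j < sum_list (map fst xs)" "block_pos xs (Suc j) = (Suc p, n, a)"
  shows "block_pos xs j = (p, n, a)"
  using assms
proof (induction xs arbitrary: j)
  case (Cons x xs)
  obtain n' a' where x: "x = (n', a')" by force
  show ?case
  proof (cases "Suc j < n'")
    case True
    then show ?thesis using Cons x by auto
  next
    case False
    show ?thesis
    proof (cases "j < n'")
      case True
      \<comment> \<open>\<open>j\<close> is the last index of the first block, so
        \<open>Suc j\<close> opens the next one and has position 0, against the assumed
        \<open>Suc p\<close>.\<close>
      then have "Suc j - n' = 0" by auto
      then show ?thesis using Cons.prems x False block_pos_0[of xs] by auto
    next
      case F2: False
      then have "Suc j - n' = Suc (j - n')" by auto
      then show ?thesis using Cons.prems Cons.IH[of "j - n'"] x False F2 by auto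
    qed
  qed
qed auto

text \<open>Column \<open>j\<close> carries a superdiagonal 1 exactly when \<open>j\<close> does not
  start a block. This replaces the nested block matrices by a formula for each entry.\<close>

lemma jordan_matrix_entry:
  fixes xs :: "(nat \<times> 'a :: {zero, one}) list"
  assumes "i < sum_list (map fst xs)" "j < sum_list (map fst xs)"
  shows "jordan_matrix xs $$ (i, j) =
    (if i = j then snd (snd (block_pos xs j))
     else if Suc i = j \<and> fst (block_pos xs j) \<noteq> 0 then 1 else 0)"
  using assms
proof (induction xs arbitrary: i j)
  case (Cons x xs)
  obtain n a where x: "x = (n, a)" by force
  let ?N = "sum_list (map fst xs)"
  have J: "jordan_matrix xs \<in> carrier_mat ?N ?N" by simp
  have "jordan_matrix (x # xs) $$ (i, j) =
      (if i < n then if j < n then jordan_block n a $$ (i, j) else 0\<^sub>m n ?N $$ (i, j - n)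
       else if j < n then 0\<^sub>m ?N n $$ (i - n, j) else jordan_matrix xs $$ (i - n, j - n))"
    unfolding x jordan_matrix_Cons using Cons.prems x J
    by (subst index_mat_four_block) auto
  also have "\<dots> = (if i = j then snd (snd (block_pos (x # xs) j))
     else if Suc i = j \<and> fst (block_pos (x # xs) j) \<noteq> 0 then 1 else 0)"
  proof (cases "i < n \<or> j < n")
    case True
    then show ?thesis using Cons.prems x block_pos_0[of xs]
      by (cases "j - n") auto
  next
    case False
    have "jordan_matrix xs $$ (i - n, j - n) =
      (if i - n = j - n then snd (snd (block_pos xs (j - n)))
     else if Suc (i - n) = (j - n) \<and> fst (block_pos xs (j - n)) \<noteq> 0 then 1 else 0)"
      using Cons.prems False x by (intro Cons.IH) auto
    moreover have "i - n = j - n \<longleftrightarrow> i = j" "Suc (i - n) = j - n \<longleftrightarrow> Suc i = j" using False by auto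
    ultimately show ?thesis using False x by simp
  qed
  finally show ?case .
qed auto

text \<open>The bilinear pairing, without conjugation; the dual basis below refers to it.\<close>

definition cdot :: "complex^'d \<Rightarrow> complex^'d \<Rightarrow> complex" where
  "cdot q w = (\<Sum>i\<in>UNIV. q $ i * w $ i)"

lemma cdot_diff: "cdot q (x - y) = cdot q x - cdot q y"
  by (simp add: cdot_def algebra_simps sum_subtractf)

lemma cdot_scale: "cdot q (c *s x) = c * cdot q x"
  by (simp add: cdot_def algebra_simps sum_distrib_left)

lemma cdot_zero: "cdot q 0 = 0"
  by (simp add: cdot_def)

abbreviation enum_index :: "nat \<Rightarrow> 'd::finite" where
  "enum_index \<equiv> from_nat_into (UNIV :: 'd set)"

lemma enum_index_bij: "bij_betw (enum_index :: nat \<Rightarrow> 'd::finite) {..<CARD('d)} UNIV"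
  using bij_betw_from_nat_into_finite[of "UNIV :: 'd set"] by simp

lemma enum_index_inverse:
  obtains e' :: "'d::finite \<Rightarrow> nat" where "\<And>i. i < CARD('d) \<Longrightarrow> e' (enum_index i :: 'd) = i"
    "\<And>i. enum_index (e' i) = i" "\<And>i. e' i < CARD('d)"
proof (rule that[of "inv_into {..<CARD('d)} enum_index"])
  note bij = enum_index_bij[where 'd = 'd, unfolded bij_betw_def]
  show "inv_into {..<CARD('d)} enum_index (enum_index i :: 'd) = i" if "i < CARD('d)" for i
    using that bij by (simp add: inv_into_f_f)
  show "enum_index (inv_into {..<CARD('d)} enum_index i) = (i :: 'd)" for i
    using bij by (simp add: f_inv_into_f)
  have "inv_into {..<CARD('d)} enum_index (i :: 'd) \<in> {..<CARD('d)}" for i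
    using bij by (intro inv_into_into) simp
  then show "inv_into {..<CARD('d)} enum_index (i :: 'd) < CARD('d)" for i by simp
qed

lemma sum_enum_index: "(\<Sum>i\<in>(UNIV::'d::finite set). f i) = (\<Sum>l<CARD('d). f (enum_index l))"
  using sum.reindex_bij_betw[OF enum_index_bij, of f] by simp

lemma cmat_carrier: "cmat (M :: real^'d^'d) \<in> carrier_mat CARD('d) CARD('d)"
  by (simp add: cmat_def Let_def)

abbreviation char_op :: "real^'d^'d \<Rightarrow> complex \<Rightarrow> complex^'d \<Rightarrow> complex^'d" where
  "char_op M z \<equiv> \<lambda>x. complex_matrix M *v x - z *s x"

text \<open>The columns \<open>b\<close> of the transformation to Jordan normal form and the rows \<open>q\<close> of its inverse.\<close>

lemma jordan_chain_basis:
  fixes M :: "real^'d^'d"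
  assumes nf: "jordan_nf (cmat M) xs"
  obtains b q :: "nat \<Rightarrow> complex^'d" where
    "\<And>j. j < CARD('d) \<Longrightarrow> complex_matrix M *v b j =
        snd (snd (block_pos xs j)) *s b j + (if fst (block_pos xs j) = 0 then 0 else b (j - 1))"
    "\<And>j w. j < CARD('d) \<Longrightarrow> cdot (q j) (complex_matrix M *v w) =
        snd (snd (block_pos xs j)) * cdot (q j) w +
        (if Suc j < CARD('d) \<and> fst (block_pos xs (Suc j)) \<noteq> 0 then cdot (q (Suc j)) w else 0)"
    "\<And>j l. j < CARD('d) \<Longrightarrow> l < CARD('d) \<Longrightarrow> cdot (q j) (b l) = (if j = l then 1 else 0)"
    "\<And>w. w = (\<Sum>j<CARD('d). cdot (q j) w *s b j)"
    "sum_list (map fst xs) = CARD('d)"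
proof -
  let ?n = "CARD('d)" let ?M = "cmat M"
  from nf obtain P Q where sim: "similar_mat_wit ?M (jordan_matrix xs) P Q"
    unfolding jordan_nf_def similar_mat_def by blast
  note D = similar_mat_witD2[OF cmat_carrier sim]
  from D(5) have N: "sum_list (map fst xs) = ?n"
    by (metis carrier_matD(1) jordan_matrix_dim(1))
  let ?J = "jordan_matrix xs"
  have PJ: "P * ?J \<in> carrier_mat ?n ?n" and JQ: "?J * Q \<in> carrier_mat ?n ?n"
    using D by auto
  \<comment> \<open>Column \<open>j\<close> of this identity becomes the chain relation for
    \<open>b j\<close>, and row \<open>j\<close> of \<open>QM\<close> below the one for
    \<open>q j\<close>.\<close>
  have MP: "?M * P = P * ?J"
  proof -
    have "?M * P = P * ?J * Q * P" by (simp only: D(3))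
    also have "\<dots> = P * ?J * (Q * P)" by (rule assoc_mult_mat[OF PJ D(7) D(6)])
    also have "\<dots> = P * ?J" unfolding D(2) using PJ by (rule right_mult_one_mat)
    finally show ?thesis .
  qed
  have QM: "Q * ?M = ?J * Q"
  proof -
    have "Q * ?M = Q * (P * (?J * Q))"
      using assoc_mult_mat[OF D(6) D(5) D(7)] by (simp only: D(3))
    also have "\<dots> = (Q * P) * (?J * Q)" by (rule assoc_mult_mat[OF D(7) D(6) JQ, symmetric])
    also have "\<dots> = ?J * Q" unfolding D(2) using JQ by (rule left_mult_one_mat)
    finally show ?thesis .
  qed
  define e :: "nat \<Rightarrow> 'd" where "e = enum_index"
  obtain e' :: "'d \<Rightarrow> nat" where e'e: "\<And>i. i < ?n \<Longrightarrow> e' (e i) = i"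
    and ee': "\<And>i. e (e' i) = i" "\<And>i. e' i < ?n"
    by (rule enum_index_inverse[where 'd = 'd, folded e_def]) (rule that)
  have S: "(\<Sum>i\<in>(UNIV::'d set). g i) = (\<Sum>l<?n. g (e l))" for g :: "'d \<Rightarrow> complex"
    unfolding e_def by (rule sum_enum_index)
  define b :: "nat \<Rightarrow> complex^'d" where "b j = (\<chi> i. P $$ (e' i, j))" for j
  define q :: "nat \<Rightarrow> complex^'d" where "q j = (\<chi> i. Q $$ (j, e' i))" for j
  have Mij: "?M $$ (i, j) = complex_of_real (M $ e i $ e j)" if "i < ?n" "j < ?n" for i j
    using that by (simp add: cmat_def Let_def e_def)
  have cM: "complex_matrix M $ e i $ e j = ?M $$ (i, j)" if "i < ?n" "j < ?n" for i j
    using that by (simp add: Mij complex_matrix_def)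
  have cMi: "complex_matrix M $ i $ e j = ?M $$ (e' i, j)" if "j < ?n" for i j
    using cM[OF ee'(2) that, of i] by (simp add: ee'(1))
  have mult: "(A * B) $$ (i, j) = (\<Sum>l<?n. A $$ (i, l) * B $$ (l, j))"
    if "A \<in> carrier_mat ?n ?n" "B \<in> carrier_mat ?n ?n" "i < ?n" "j < ?n" for A B :: "complex mat" and i j
    using that by (auto simp: scalar_prod_def atLeast0LessThan intro!: sum.cong)
  let ?z = "\<lambda>j. snd (snd (block_pos xs j))"
  let ?p = "\<lambda>j. fst (block_pos xs j)"
  have J: "?J $$ (i, j) = (if i = j then ?z j else if Suc i = j \<and> ?p j \<noteq> 0 then 1 else 0)"
    if "i < ?n" "j < ?n" for i j using jordan_matrix_entry[of i xs j] that N by simp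
  have 1: "complex_matrix M *v b j = ?z j *s b j + (if ?p j = 0 then 0 else b (j - 1))"
    if j: "j < ?n" for j
  proof -
    \<comment> \<open>A nonzero position excludes \<open>j = 0\<close>, so \<open>j - 1\<close>
      below is a genuine predecessor.\<close>
    have pj: "?p j \<noteq> 0 \<Longrightarrow> j > 0" using block_pos_0[of xs] by (cases j) auto
    have "(complex_matrix M *v b j) $ i = (?z j *s b j + (if ?p j = 0 then 0 else b (j - 1))) $ i" for i
    proof -
      have "(complex_matrix M *v b j) $ i = (\<Sum>l<?n. ?M $$ (e' i, l) * P $$ (l, j))"
        by (simp add: matrix_vector_mult_def S b_def e'e cMi)
      also have "\<dots> = (P * ?J) $$ (e' i, j)" 
        unfolding MP[symmetric] using D ee'(2) j by (subst mult) auto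
      also have "\<dots> = (\<Sum>l<?n. P $$ (e' i, l) * ?J $$ (l, j))"
        using D ee'(2) j by (subst mult) auto
      also have "\<dots> = (\<Sum>l<?n. (if l = j then P $$ (e' i, j) * ?z j else 0) +
          (if l = j - 1 then (if ?p j = 0 then 0 else P $$ (e' i, j - 1)) else 0))"
        using j pj by (intro sum.cong refl) (auto simp: J)
      also have "\<dots> = ?z j * P $$ (e' i, j) + (if ?p j = 0 then 0 else P $$ (e' i, j - 1))"
        using j by (simp add: sum.distrib)
      finally show ?thesis by (simp add: b_def)
    qed
    then show ?thesis by (simp add: Finite_Cartesian_Product.vec_eq_iff)
  qed
  \<comment> \<open>The rows of \<open>Q\<close> form chains in the opposite direction:
    \<open>b j\<close> is sent towards \<open>b (j - 1)\<close>, but \<open>q j\<close> towards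
    \<open>q (Suc j)\<close>. The guard stops at the last index of the block and of the
    matrix.\<close>
  have 2: "cdot (q j) (complex_matrix M *v w) = ?z j * cdot (q j) w +
        (if Suc j < ?n \<and> ?p (Suc j) \<noteq> 0 then cdot (q (Suc j)) w else 0)"
    if j: "j < ?n" for j w
  proof -
    have "cdot (q j) (complex_matrix M *v w) = (\<Sum>l<?n. \<Sum>m<?n. Q $$ (j, l) * (?M $$ (l, m) * w $ e m))"
      by (simp add: cdot_def S q_def e'e matrix_vector_mult_def cM sum_distrib_left)
    also have "\<dots> = (\<Sum>m<?n. (\<Sum>l<?n. Q $$ (j, l) * ?M $$ (l, m)) * w $ e m)"
      by (subst sum.swap) (simp add: sum_distrib_right mult.assoc)
    also have "\<dots> = (\<Sum>m<?n. (?J * Q) $$ (j, m) * w $ e m)"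
      unfolding QM[symmetric] using D j by (intro sum.cong refl, subst mult) auto
    also have "\<dots> = (\<Sum>m<?n. (?z j * Q $$ (j, m) + 
        (if Suc j < ?n \<and> ?p (Suc j) \<noteq> 0 then Q $$ (Suc j, m) else 0)) * w $ e m)"
    proof (intro sum.cong refl arg_cong2[where f = "(*)"])
      fix m assume "m \<in> {..<?n}"
      then have "(?J * Q) $$ (j, m) = (\<Sum>l<?n. ?J $$ (j, l) * Q $$ (l, m))"
        using D j by (subst mult) auto
      also have "\<dots> = (\<Sum>l<?n. (if l = j then ?z j * Q $$ (j, m) else 0) +
          (if l = Suc j then (if ?p (Suc j) = 0 then 0 else Q $$ (Suc j, m)) else 0))"
        using j by (intro sum.cong refl) (auto simp: J)
      also have "\<dots> = ?z j * Q $$ (j, m) + 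
        (if Suc j < ?n \<and> ?p (Suc j) \<noteq> 0 then Q $$ (Suc j, m) else 0)"
        using j by (simp add: sum.distrib)
      finally show "(?J * Q) $$ (j, m) = \<dots>" .
    qed
    also have "\<dots> = ?z j * cdot (q j) w + (if Suc j < ?n \<and> ?p (Suc j) \<noteq> 0 then cdot (q (Suc j)) w else 0)"
      by (auto simp: cdot_def S q_def e'e sum_distrib_left algebra_simps sum.distrib)
    finally show ?thesis .
  qed
  have 3: "cdot (q j) (b l) = (if j = l then 1 else 0)" if "j < ?n" "l < ?n" for j l
  proof -
    have "cdot (q j) (b l) = (Q * P) $$ (j, l)"
      using D that by (subst mult) (auto simp: cdot_def S q_def b_def e'e)
    then show ?thesis using D that by simp
  qed
  have 4: "w = (\<Sum>j<?n. cdot (q j) w *s b j)" for w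
  proof -
    have "(\<Sum>j<?n. cdot (q j) w *s b j) $ i = w $ i" for i
    proof -
      have "(\<Sum>j<?n. cdot (q j) w *s b j) $ i = (\<Sum>j<?n. \<Sum>l<?n. Q $$ (j, l) * w $ e l * P $$ (e' i, j))"
        by (simp add: cdot_def S q_def b_def e'e sum_distrib_right)
      also have "\<dots> = (\<Sum>l<?n. (\<Sum>j<?n. P $$ (e' i, j) * Q $$ (j, l)) * w $ e l)"
        by (subst sum.swap) (simp add: sum_distrib_right sum_distrib_left algebra_simps)
      also have "\<dots> = (\<Sum>l<?n. (P * Q) $$ (e' i, l) * w $ e l)"
        using D ee'(2) by (intro sum.cong refl, subst mult) auto
      also have "\<dots> = (\<Sum>l<?n. if l = e' i then w $ e l else 0)"
        using D ee'(2) by (intro sum.cong refl) auto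
      also have "\<dots> = w $ i" using ee' by simp
      finally show ?thesis .
    qed
    then show ?thesis by (simp add: Finite_Cartesian_Product.vec_eq_iff)
  qed
  show thesis using that[OF 1 2 3 4 N] .
qed

section \<open>Orthogonal projections and compressions\<close>

text \<open>Unfolds the definite description \<open>proj\<close>. Existence comes from Fourier
  coefficients in an orthonormal basis; two candidates differ by a vector in both \<open>S\<close>
  and its complement, hence by 0.\<close>

lemma proj_ex1:
  fixes S :: "(real^'d) set"
  assumes "subspace S"
  shows "\<exists>!P :: real^'d^'d. \<forall>x. P *v x \<in> S \<and> x - P *v x \<in> S\<^sup>\<bottom>"
proof -
  obtain B where B: "B \<subseteq> S" "pairwise orthogonal B" "\<And>x. x \<in> B \<Longrightarrow> norm x = 1"
    "independent B" "card B = dim S" "span B = S"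
    using orthonormal_basis_subspace[OF assms] by metis
  have fin: "finite B" using B(4) by (rule independent_imp_finite)
  define p where "p x = (\<Sum>b\<in>B. (x \<bullet> b) *\<^sub>R b)" for x :: "real^'d"
  have lin: "linear p"
    by (rule linearI) (auto simp: p_def inner_add_left scaleR_add_left sum.distrib scaleR_sum_right)
  have p_in: "p x \<in> S" for x
    unfolding p_def B(6)[symmetric] by (intro span_sum span_scale span_base)
  have p_orth: "x - p x \<in> S\<^sup>\<bottom>" for x
  proof -
    have "orthogonal (x - p x) y" if "y \<in> span B" for y
    proof (rule orthogonal_to_span[OF that])
      fix c assume c: "c \<in> B"
      have "p x \<bullet> c = (\<Sum>b\<in>B. (x \<bullet> b) * (b \<bullet> c))" by (simp add: p_def inner_sum_left)
      also have "\<dots> = (\<Sum>b\<in>B. if b = c then x \<bullet> c else 0)"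
      proof (intro sum.cong refl)
        fix b assume b: "b \<in> B"
        show "(x \<bullet> b) * (b \<bullet> c) = (if b = c then x \<bullet> c else 0)"
          using B(2) b c B(3)[OF c] by (auto simp: pairwise_def orthogonal_def norm_eq_1)
      qed
      also have "\<dots> = x \<bullet> c" using fin c by simp
      finally show "orthogonal (x - p x) c" by (simp add: orthogonal_def inner_diff_left)
    qed
    then show ?thesis using B(6) by (auto simp: orthogonal_comp_def orthogonal_commute)
  qed
  have 1: "\<forall>x. matrix p *v x \<in> S \<and> x - matrix p *v x \<in> S\<^sup>\<bottom>"
    using p_in p_orth lin by (simp add: matrix_works)
  have 2: "P = matrix p" if P: "\<forall>x. P *v x \<in> S \<and> x - P *v x \<in> S\<^sup>\<bottom>" for P :: "real^'d^'d"
  proof -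
    have "P *v x = matrix p *v x" for x
    proof -
      have "P *v x - p x \<in> S" using P p_in assms by (simp add: subspace_diff)
      moreover have "(x - p x) - (x - P *v x) \<in> S\<^sup>\<bottom>"
        using P p_orth subspace_orthogonal_comp subspace_diff by blast
      then have "P *v x - p x \<in> S\<^sup>\<bottom>" by (simp add: algebra_simps)
      ultimately have "orthogonal (P *v x - p x) (P *v x - p x)" by (auto simp: orthogonal_comp_def)
      then show ?thesis using lin by (simp add: orthogonal_self matrix_works)
    qed
    then show "P = matrix p" by (simp add: matrix_eq)
  qed
  show ?thesis using 1 2 by (rule ex1I)
qed

lemma
  assumes "subspace S"
  shows proj_mem: "proj S *v x \<in> S" and proj_orth: "x - proj S *v x \<in> S\<^sup>\<bottom>"
  using theI'[OF proj_ex1[OF assms]] unfolding proj_def by auto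

lemma proj_id:
  assumes "subspace S" "x \<in> S"
  shows "proj S *v x = x"
proof -
  have "x - proj S *v x \<in> S" using assms proj_mem subspace_diff by blast
  then have "orthogonal (x - proj S *v x) (x - proj S *v x)"
    using proj_orth[OF assms(1)] by (auto simp: orthogonal_comp_def)
  then show ?thesis by (simp add: orthogonal_self)
qed

lemma proj_null:
  assumes "subspace S" "x \<in> S\<^sup>\<bottom>"
  shows "proj S *v x = 0"
proof -
  have "x - (x - proj S *v x) \<in> S\<^sup>\<bottom>"
    using assms proj_orth subspace_orthogonal_comp subspace_diff by blast
  then have "orthogonal (proj S *v x) (proj S *v x)"
    using proj_mem[OF assms(1)] by (auto simp: orthogonal_comp_def)
  then show ?thesis by (simp add: orthogonal_self)
qed

lemma inner_proj_right:
  assumes "subspace S" "y \<in> S"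
  shows "y \<bullet> (proj S *v x) = y \<bullet> x"
proof -
  have "y \<bullet> (x - proj S *v x) = 0"
    using proj_orth[OF assms(1)] assms(2) by (auto simp: orthogonal_comp_def orthogonal_def)
  then show ?thesis by (simp add: inner_diff_right)
qed

lemma inner_proj_swap:
  assumes "subspace S"
  shows "x \<bullet> (proj S *v y) = (proj S *v x) \<bullet> y"
  using inner_proj_right[OF assms proj_mem[OF assms], of x y]
    inner_proj_right[OF assms proj_mem[OF assms], of y x] by (simp add: inner_commute)

lemma compress_apply: "compress S M *v x = proj S *v (M *v (proj S *v x))"
  by (simp add: compress_def matrix_vector_mul_assoc matrix_mul_assoc)

lemma compress_mem: "subspace S \<Longrightarrow> compress S M *v x \<in> S"
  by (simp add: compress_apply proj_mem)

lemma compress_null: "subspace S \<Longrightarrow> x \<in> S\<^sup>\<bottom> \<Longrightarrow> compress S M *v x = 0"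
  by (simp add: compress_apply proj_null)

lemma matrix_sum_apply: "matrix_sum k A *v x = (\<Sum>j<k. A j *v x)"
  unfolding matrix_sum_def
  by (induction k) (simp_all add: matrix_vector_mult_add_rdistrib)

lemma matrix_power_0: "matrix_power M 0 = Finite_Cartesian_Product.mat 1"
  and matrix_power_Suc: "matrix_power M (Suc n) = M ** matrix_power M n"
  by (simp_all add: matrix_power_def)

lemma matrix_power_apply: "matrix_power M n *v x = (((*v) M) ^^ n) x"
  by (induction n) (simp_all add: matrix_power_0 matrix_power_Suc flip: matrix_vector_mul_assoc)

lemma matrix_power_add: "matrix_power M (m + n) *v x = matrix_power M m *v (matrix_power M n *v x)"
  by (simp add: matrix_power_apply funpow_add)

section \<open>Complexification\<close>

definition vec_Re :: "complex^'d \<Rightarrow> real^'d" where "vec_Re w = (\<chi> i. Re (w $ i))"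
definition vec_Im :: "complex^'d \<Rightarrow> real^'d" where "vec_Im w = (\<chi> i. Im (w $ i))"
definition vec_cnj :: "complex^'d \<Rightarrow> complex^'d" where "vec_cnj w = (\<chi> i. cnj (w $ i))"
definition vec_of_real :: "real^'d \<Rightarrow> complex^'d" where "vec_of_real x = (\<chi> i. complex_of_real (x $ i))"

lemma vec_Re_mult: "vec_Re (complex_matrix M *v w) = M *v vec_Re w"
  and vec_Im_mult: "vec_Im (complex_matrix M *v w) = M *v vec_Im w"
  by (simp_all add: vec_Re_def vec_Im_def complex_matrix_def matrix_vector_mult_def
      Finite_Cartesian_Product.vec_eq_iff)

lemma vec_cnj_mult: "complex_matrix M *v vec_cnj w = vec_cnj (complex_matrix M *v w)"
  by (simp add: vec_cnj_def complex_matrix_def matrix_vector_mult_def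
      Finite_Cartesian_Product.vec_eq_iff)

lemma vec_of_real_mult: "complex_matrix M *v vec_of_real x = vec_of_real (M *v x)"
  by (simp add: vec_of_real_def complex_matrix_def matrix_vector_mult_def
      Finite_Cartesian_Product.vec_eq_iff)

lemma vec_of_real_eq_iff: "vec_of_real x = vec_of_real y \<longleftrightarrow> x = y"
  by (simp add: vec_of_real_def Finite_Cartesian_Product.vec_eq_iff)

lemma vec_Re_Im: "w = vec_of_real (vec_Re w) + \<i> *s vec_of_real (vec_Im w)"
  by (simp add: vec_of_real_def vec_Re_def vec_Im_def Finite_Cartesian_Product.vec_eq_iff
      flip: complex_eq)

lemma vec_of_real_0: "vec_of_real 0 = 0"
  by (simp add: vec_of_real_def Finite_Cartesian_Product.vec_eq_iff)

lemma mem_complexified: "w \<in> complexified S \<longleftrightarrow> vec_Re w \<in> S \<and> vec_Im w \<in> S"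
  by (simp add: complexified_def vec_Re_def vec_Im_def)

lemma complexified_add:
  assumes "subspace S" "x \<in> complexified S" "y \<in> complexified S"
  shows "x + y \<in> complexified S"
proof -
  have "vec_Re (x + y) = vec_Re x + vec_Re y" "vec_Im (x + y) = vec_Im x + vec_Im y"
    by (simp_all add: vec_Re_def vec_Im_def Finite_Cartesian_Product.vec_eq_iff)
  then show ?thesis using assms by (simp add: mem_complexified subspace_add)
qed

lemma complexified_scale:
  assumes "subspace S" "x \<in> complexified S"
  shows "c *s x \<in> complexified S"
proof -
  have "vec_Re (c *s x) = Re c *\<^sub>R vec_Re x - Im c *\<^sub>R vec_Im x"
       "vec_Im (c *s x) = Re c *\<^sub>R vec_Im x + Im c *\<^sub>R vec_Re x"
    by (simp_all add: vec_Re_def vec_Im_def Finite_Cartesian_Product.vec_eq_iff)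
  then show ?thesis using assms
    by (simp add: mem_complexified subspace_add subspace_diff subspace_scale)
qed

lemma complex_matrix_mult: "complex_matrix (M ** N) = complex_matrix M ** complex_matrix N"
  by (simp add: complex_matrix_def matrix_matrix_mult_def Finite_Cartesian_Product.vec_eq_iff)

lemma complex_matrix_power_apply:
  "complex_matrix (matrix_power M n) *v w = (((*v) (complex_matrix M)) ^^ n) w"
proof (induction n)
  case 0
  have "complex_matrix (Finite_Cartesian_Product.mat 1 :: real^'d^'d) = Finite_Cartesian_Product.mat 1"
    by (simp add: complex_matrix_def Finite_Cartesian_Product.mat_def Finite_Cartesian_Product.vec_eq_iff)
  then show ?case by (metis matrix_power_0 matrix_vector_mul_lid funpow_0)
next
  case (Suc n)
  then show ?case by (simp add: matrix_power_Suc complex_matrix_mult flip: matrix_vector_mul_assoc)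
qed

lemma char_op_add: "char_op M z (x + y) = char_op M z x + char_op M z y"
  by (simp add: matrix_vector_right_distrib vector_add_ldistrib)

lemma char_op_scale: "char_op M z (c *s x) = c *s char_op M z x"
  by (simp add: vec.scale_right_diff_distrib vector_scalar_commute vector_smult_assoc mult.commute)

lemma char_op_cnj: "char_op M (cnj z) (vec_cnj w) = vec_cnj (char_op M z w)"
  unfolding vec_cnj_mult
  by (simp add: vec_cnj_def Finite_Cartesian_Product.vec_eq_iff)

lemma char_op_0: "(char_op M z ^^ n) 0 = 0"
  by (induction n) auto

lemma gen_eigenspace_cnj:
  fixes w :: "complex^'d"
  assumes "w \<in> gen_eigenspace M z"
  shows "vec_cnj w \<in> gen_eigenspace M (cnj z)"
proof -
  have "(char_op M (cnj z) ^^ n) (vec_cnj w) = vec_cnj ((char_op M z ^^ n) w)" for n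
    by (induction n) (simp_all add: char_op_cnj)
  moreover have "vec_cnj (0 :: complex^'d) = 0" by (simp add: vec_cnj_def Finite_Cartesian_Product.vec_eq_iff)
  moreover obtain n where "(char_op M z ^^ n) w = 0" using assms by (auto simp: gen_eigenspace_def)
  ultimately have "(char_op M (cnj z) ^^ n) (vec_cnj w) = 0" by simp
  then show ?thesis unfolding gen_eigenspace_def by blast
qed

text \<open>Solve \<open>char_op M z w = M w - z w\<close> for \<open>w\<close>: the image of
  \<open>M\<close> lies in the complexified \<open>S\<close>, and so does
  \<open>char_op M z w\<close>, by induction on the order of nilpotency. The division by
  \<open>z\<close> is the reason why the eigenvalue 0 needs a separate treatment later.\<close>

lemma gen_eigenspace_nonzero_complexified:
  fixes w :: "complex^'d"
  assumes "subspace S" "\<And>x. M *v x \<in> S" "z \<noteq> 0" "w \<in> gen_eigenspace M z"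
  shows "w \<in> complexified S"
proof -
  obtain n where "(char_op M z ^^ n) w = 0" using assms by (auto simp: gen_eigenspace_def)
  then show ?thesis
  proof (induction n arbitrary: w)
    case 0
    have "vec_Re (0::complex^'d) = 0" "vec_Im (0::complex^'d) = 0" 
      by (simp_all add: vec_Re_def vec_Im_def Finite_Cartesian_Product.vec_eq_iff)
    then show ?case using 0 subspace_0[OF assms(1)] by (simp add: mem_complexified)
  next
    case (Suc n)
    have "char_op M z w \<in> complexified S"
      using Suc.prems by (intro Suc.IH) (simp add: funpow_Suc_right del: funpow.simps)
    moreover have "complex_matrix M *v w \<in> complexified S"
      using assms(2) by (simp add: mem_complexified vec_Re_mult vec_Im_mult)
    ultimately have "(1/z) *s (complex_matrix M *v w + (-1) *s char_op M z w) \<in> complexified S"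
      using complexified_scale[OF assms(1)] complexified_add[OF assms(1)] by blast
    moreover have "(1/z) *s (complex_matrix M *v w + (-1) *s char_op M z w) = w"
      using assms(3) by (simp add: Finite_Cartesian_Product.vec_eq_iff)
    ultimately show ?case by simp
  qed
qed

section \<open>Spectral decomposition\<close>

lemma spec_rad_eigenvalue_le:
  assumes "eigenvalue (cmat M) z"
  shows "cmod z \<le> spec_rad M"
  using spectral_radius_mem_max(2)[OF cmat_carrier, of "cmod z" M] assms by (simp add: spectrum_def)

text \<open>A block of size \<open>m\<close> for \<open>z\<close> makes \<open>z\<close> a root of
  the characteristic polynomial of order at least \<open>m\<close>; blocks of a normal form are
  nonempty, and the order is at most the degree.\<close>

lemma jordan_nf_eigenvalue:
  assumes "jordan_nf (cmat (M :: real^'d^'d)) xs" "(m, z) \<in> set xs"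
  shows "eigenvalue (cmat M) z" "m \<le> CARD('d)"
proof -
  note d = degree_monic_char_poly[OF cmat_carrier, of M]
  have o: "m \<le> order z (char_poly (cmat M))" by (rule jordan_nf_block_size_order_bound[OF assms])
  have nz: "char_poly (cmat M) \<noteq> 0" using d by auto
  have "m \<noteq> 0" using assms by (force simp: jordan_nf_def)
  then have "poly (char_poly (cmat M)) z = 0" using o nz by (simp add: order_root)
  then show "eigenvalue (cmat M) z" using eigenvalue_root_char_poly[OF cmat_carrier] by blast
  show "m \<le> CARD('d)" using o order_degree[OF nz, of z] d by simp
qed

text \<open>The point is finiteness of the set under \<open>Max\<close>, which ranges over all
  normal forms: block sizes are bounded by the dimension.\<close>

lemma max_block_ge:
  assumes "jordan_nf (cmat (M :: real^'d^'d)) xs" "(m, z) \<in> set xs" "cmod z = spec_rad M"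
  shows "m \<le> max_block M"
  unfolding max_block_def
proof (rule Max_ge)
  show "finite {m. \<exists>n_as z. jordan_nf (cmat M) n_as \<and> (m, z) \<in> set n_as \<and> cmod z = spec_rad M}"
    by (rule finite_subset[of _ "{..CARD('d)}"]) (auto dest: jordan_nf_eigenvalue(2))
qed (use assms in blast)

text \<open>All that later arguments use of the normal form, with the block structure hidden.
  \<open>m j\<close> bounds the nilpotency order at \<open>b j\<close>; \<open>block\<close> keeps
  it within the power of \<open>n\<close> by which matrix powers are normalised. \<open>gen\<close>
  is the spectral decomposition seen through the dual basis: a generalised eigenvector has no
  coordinates at other eigenvalues.\<close>

locale jordan_basis =
  fixes M :: "real^'d^'d" and b q :: "nat \<Rightarrow> complex^'d" and z :: "nat \<Rightarrow> complex" and m :: "nat \<Rightarrow> nat"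
  assumes expand: "\<And>w. w = (\<Sum>j<CARD('d). cdot (q j) w *s b j)"
    and dual: "\<And>j l. j < CARD('d) \<Longrightarrow> l < CARD('d) \<Longrightarrow> cdot (q j) (b l) = (if j = l then 1 else 0)"
    and chain: "\<And>j. j < CARD('d) \<Longrightarrow> (char_op M (z j) ^^ m j) (b j) = 0"
    and eigen: "\<And>j. j < CARD('d) \<Longrightarrow> eigenvalue (cmat M) (z j)"
    and block: "\<And>j. j < CARD('d) \<Longrightarrow> cmod (z j) = spec_rad M \<Longrightarrow> m j \<le> max_block M"
    and gen: "\<And>j w \<zeta>. j < CARD('d) \<Longrightarrow> w \<in> gen_eigenspace M \<zeta> \<Longrightarrow> z j \<noteq> \<zeta> \<Longrightarrow> cdot (q j) w = 0"

lemma jordan_basis_exists: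
  fixes M :: "real^'d^'d"
  shows "\<exists>b q z m. jordan_basis M b q z m"
proof -
  obtain as where "char_poly (cmat M) = (\<Prod>a\<leftarrow>as. [:- a, 1:])"
    using char_poly_factorized[OF cmat_carrier, of M] by blast
  then obtain xs where nf: "jordan_nf (cmat M) xs" using jordan_nf_exists[OF cmat_carrier] by blast
  obtain b q :: "nat \<Rightarrow> complex^'d" where
    1: "\<And>j. j < CARD('d) \<Longrightarrow> complex_matrix M *v b j =
        snd (snd (block_pos xs j)) *s b j + (if fst (block_pos xs j) = 0 then 0 else b (j - 1))" and
    2: "\<And>j w. j < CARD('d) \<Longrightarrow> cdot (q j) (complex_matrix M *v w) =
        snd (snd (block_pos xs j)) * cdot (q j) w +
        (if Suc j < CARD('d) \<and> fst (block_pos xs (Suc j)) \<noteq> 0 then cdot (q (Suc j)) w else 0)" and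
    3: "\<And>j l. j < CARD('d) \<Longrightarrow> l < CARD('d) \<Longrightarrow> cdot (q j) (b l) = (if j = l then 1 else 0)" and
    4: "\<And>w. w = (\<Sum>j<CARD('d). cdot (q j) w *s b j)" and
    5: "sum_list (map fst xs) = CARD('d)"
    by (rule jordan_chain_basis[OF nf]) (rule that)
  define z where "z j = snd (snd (block_pos xs j))" for j
  define p where "p j = fst (block_pos xs j)" for j
  have step: "\<exists>i. j = Suc i \<and> p i = p' \<and> z i = z j" if a: "p j = Suc p'" "j < CARD('d)" for j p'
  proof -
    have "j \<noteq> 0" using a block_pos_0[of xs] by (metis nat.distinct(1) p_def)
    then obtain i where j: "j = Suc i" using not0_implies_Suc by blast
    have "block_pos xs (Suc i) = (Suc p', fst (snd (block_pos xs j)), z j)"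
      using a(1) j by (intro prod_eqI) (simp_all add: p_def z_def)
    then have "block_pos xs i = (p', fst (snd (block_pos xs j)), z j)"
      using a(2) j 5 block_pos_Suc by metis
    then have "p i = p'" "z i = z j" unfolding p_def[of i] z_def[of i] by simp_all
    with j show ?thesis by blast
  qed
  have chain: "(char_op M (z j) ^^ Suc k) (b j) = 0" if "j < CARD('d)" "p j = k" for j k
    using that
  proof (induction k arbitrary: j)
    case 0
    then show ?case using 1[of j] by (simp add: p_def z_def)
  next
    case (Suc k)
    then obtain i where i: "j = Suc i" "p i = k" "z i = z j" using step by blast
    have "char_op M (z j) (b j) = b i" using 1[of j] Suc.prems i(1) by (simp add: p_def z_def)
    then have "(char_op M (z j) ^^ Suc (Suc k)) (b j) = (char_op M (z i) ^^ Suc k) (b i)"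
      unfolding i(3) funpow_Suc_right[of "Suc k"] by simp
    also have "\<dots> = 0" using Suc.prems i by (intro Suc.IH) auto
    finally show ?case .
  qed
  have mem: "(fst (snd (block_pos xs j)), z j) \<in> set xs" "Suc (p j) \<le> fst (snd (block_pos xs j))"
    if "j < CARD('d)" for j
    using block_pos_mem[of j xs "p j" "fst (snd (block_pos xs j))" "z j"] that 5
    by (simp_all add: z_def p_def Suc_le_eq)
  \<comment> \<open>Downward in \<open>j\<close>: pairing \<open>q j\<close> with
    \<open>char_op M \<zeta> w\<close> gives \<open>(z j - \<zeta>) * cdot (q j) w\<close> plus the
    term for \<open>Suc j\<close> if that is in the same block. The latter vanishes by induction,
    and the nonzero factor \<open>z j - \<zeta>\<close> is cancelled.\<close>
  have gen1: "cdot (q j) w = 0"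
    if "j < CARD('d)" "z j \<noteq> \<zeta>" and w: "\<And>j. j < CARD('d) \<Longrightarrow> z j \<noteq> \<zeta> \<Longrightarrow> cdot (q j) (char_op M \<zeta> w) = 0"
    for j w \<zeta>
    using that(1,2)
  proof (induction "CARD('d) - j" arbitrary: j)
    case (Suc n)
    have "(if Suc j < CARD('d) \<and> p (Suc j) \<noteq> 0 then cdot (q (Suc j)) w else 0) = 0"
    proof (cases "Suc j < CARD('d) \<and> p (Suc j) \<noteq> 0")
      case True
      then have "z (Suc j) = z j" using step[of "Suc j" "p (Suc j) - 1"] by auto
      then show ?thesis using Suc.hyps Suc.prems True by simp
    qed auto
    then have "(z j - \<zeta>) * cdot (q j) w = cdot (q j) (char_op M \<zeta> w)"
      using 2[of j w] Suc.prems by (simp add: cdot_diff cdot_scale z_def p_def algebra_simps)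
    then show ?case using w[OF Suc.prems] Suc.prems by simp
  qed simp
  have gen: "cdot (q j) w = 0"
    if "j < CARD('d)" "w \<in> gen_eigenspace M \<zeta>" "z j \<noteq> \<zeta>" for j w \<zeta>
  proof -
    from that(2) have "\<exists>n. (char_op M \<zeta> ^^ n) w = 0" by (simp add: gen_eigenspace_def)
    then obtain n where "(char_op M \<zeta> ^^ n) w = 0" ..
    then have "\<forall>j<CARD('d). z j \<noteq> \<zeta> \<longrightarrow> cdot (q j) w = 0"
    proof (induction n arbitrary: w)
      case 0
      then show ?case by (simp add: cdot_zero)
    next
      case (Suc n)
      have "(char_op M \<zeta> ^^ n) (char_op M \<zeta> w) = 0"
        using Suc.prems by (simp add: funpow_Suc_right del: funpow.simps)
      from Suc.IH[OF this] show ?case using gen1[of _ \<zeta> w] by blast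
    qed
    then show ?thesis using that by blast
  qed
  \<comment> \<open>Positions count from 0, so the vector at position \<open>p j\<close> is killed
    after \<open>p j + 1\<close> steps, which is at most the size of its block.\<close>
  have "jordan_basis M b q z (\<lambda>j. Suc (p j))"
  proof
    show "\<And>w. w = (\<Sum>j<CARD('d). cdot (q j) w *s b j)" by (rule 4)
    show "j < CARD('d) \<Longrightarrow> l < CARD('d) \<Longrightarrow> cdot (q j) (b l) = (if j = l then 1 else 0)" for j l by (rule 3)
    show "j < CARD('d) \<Longrightarrow> (char_op M (z j) ^^ Suc (p j)) (b j) = 0" for j using chain by blast
    show "j < CARD('d) \<Longrightarrow> eigenvalue (cmat M) (z j)" for j
      using jordan_nf_eigenvalue(1)[OF nf] mem(1) by blast
    show "Suc (p j) \<le> max_block M" if "j < CARD('d)" "cmod (z j) = spec_rad M" for j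
      using order_trans[OF mem(2)[OF that(1)] max_block_ge[OF nf mem(1)[OF that(1)] that(2)]] .
  qed (use gen in blast)
  then show ?thesis by blast
qed

lemma tendsto_vector_scale:
  fixes w :: "'a \<Rightarrow> complex^'d"
  assumes "(a \<longlongrightarrow> \<alpha>) F" "(w \<longlongrightarrow> \<omega>) F"
  shows "((\<lambda>x. a x *s w x) \<longlongrightarrow> \<alpha> *s \<omega>) F"
proof (rule vec_tendstoI)
  fix i
  show "((\<lambda>x. (a x *s w x) $ i) \<longlongrightarrow> (\<alpha> *s \<omega>) $ i) F"
    using tendsto_mult[OF assms(1) tendsto_vec_nth[OF assms(2), of i]] by simp
qed

context jordan_basis
begin

lemma b_gen: "j < CARD('d) \<Longrightarrow> b j \<in> gen_eigenspace M (z j)"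
  using chain by (auto simp: gen_eigenspace_def)

lemma complex_matrix_expand:
  fixes X :: "complex^'d^'d"
  shows "X *v w = (\<Sum>j<CARD('d). cdot (q j) w *s (X *v b j))"
proof -
  have "X *v w = X *v (\<Sum>j<CARD('d). cdot (q j) w *s b j)" using expand[of w] by simp
  also have "\<dots> = (\<Sum>j<CARD('d). X *v (cdot (q j) w *s b j))"
    by (rule vec.linear_sum[unfolded o_def, OF matrix_vector_mul_linear_gen])
  finally show ?thesis by (simp add: vector_scalar_commute)
qed

lemma complex_matrix_axis: "complex_of_real (X $ i $ l) = (complex_matrix X *v axis l 1) $ i"
  by (simp add: matrix_vector_mult_def axis_def complex_matrix_def if_distrib[of "(*) _"] cong: if_cong)

lemma matrix_eqI:
  fixes X Y :: "real^'d^'d"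
  assumes "\<And>j. j < CARD('d) \<Longrightarrow> complex_matrix X *v b j = complex_matrix Y *v b j"
  shows "X = Y"
proof -
  have "complex_matrix X *v w = complex_matrix Y *v w" for w
    using complex_matrix_expand[of "complex_matrix X" w] complex_matrix_expand[of "complex_matrix Y" w]
    by (simp add: assms)
  then have "complex_of_real (X $ i $ l) = complex_of_real (Y $ i $ l)" for i l
    by (simp only: complex_matrix_axis)
  then show ?thesis by (simp add: Finite_Cartesian_Product.vec_eq_iff)
qed

text \<open>Convergence on the complex basis \<open>b\<close> is convergence on all vectors, hence
  of all entries. Entries of \<open>X n\<close> are real, so taking \<open>Re\<close> in the witness
  \<open>L\<close> loses nothing.\<close>

lemma matrix_tendsto:
  fixes X :: "nat \<Rightarrow> real^'d^'d"
  assumes "\<And>j. j < CARD('d) \<Longrightarrow> (\<lambda>n. complex_matrix (X n) *v b j) \<longlonglongrightarrow> Y j"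
  shows "\<exists>L. X \<longlonglongrightarrow> L \<and> (\<forall>j<CARD('d). complex_matrix L *v b j = Y j)"
proof -
  have lim: "(\<lambda>n. complex_matrix (X n) *v w) \<longlonglongrightarrow> (\<Sum>j<CARD('d). cdot (q j) w *s Y j)" for w
    by (subst complex_matrix_expand, rule tendsto_sum, rule tendsto_vector_scale, rule tendsto_const, rule assms, simp)
  define L where "L = (\<chi> i l. Re ((\<Sum>j<CARD('d). cdot (q j) (axis l 1) *s Y j) $ i))"
  have "(\<lambda>n. Re ((complex_matrix (X n) *v axis l 1) $ i)) \<longlonglongrightarrow> L $ i $ l" for i l
    unfolding L_def using tendsto_Re[OF tendsto_vec_nth[OF lim]] by simp
  then have XL: "X \<longlonglongrightarrow> L"
    by (intro vec_tendstoI) (simp only: complex_matrix_axis[symmetric] Re_complex_of_real)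
  have "complex_matrix L *v b j = Y j" if j: "j < CARD('d)" for j
  proof (rule LIMSEQ_unique)
    show "(\<lambda>n. complex_matrix (X n) *v b j) \<longlonglongrightarrow> complex_matrix L *v b j"
    proof (rule vec_tendstoI)
      fix i
      have "(\<lambda>n. \<Sum>l\<in>UNIV. complex_of_real (X n $ i $ l) * b j $ l)
          \<longlonglongrightarrow> (\<Sum>l\<in>UNIV. complex_of_real (L $ i $ l) * b j $ l)"
        by (intro tendsto_sum tendsto_mult tendsto_const tendsto_of_real tendsto_vec_nth XL)
      then show "(\<lambda>n. (complex_matrix (X n) *v b j) $ i) \<longlonglongrightarrow> (complex_matrix L *v b j) $ i"
        by (simp add: matrix_vector_mult_def complex_matrix_def)
    qed
  qed (rule assms[OF j])
  then show ?thesis using XL by blast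
qed

end

section \<open>Eigenvalues and the group of phases\<close>

text \<open>Eigenvectors are carried along the enumeration of the index type, between the matrices
  on which spectra are defined and the vectors \<open>complex^'d\<close> used everywhere
  else.\<close>

lemma eigenvalue_cmat_iff:
  fixes M :: "real^'d^'d"
  shows "eigenvalue (cmat M) \<zeta> \<longleftrightarrow> (\<exists>w. w \<noteq> 0 \<and> complex_matrix M *v w = \<zeta> *s w)"
proof -
  let ?n = "CARD('d)"
  define e :: "nat \<Rightarrow> 'd" where "e = enum_index"
  obtain e' :: "'d \<Rightarrow> nat" where e'e: "\<And>i. i < ?n \<Longrightarrow> e' (e i) = i"
    and ee': "\<And>i. e (e' i) = i" "\<And>i. e' i < ?n"
    by (rule enum_index_inverse[where 'd = 'd, folded e_def]) (rule that)
  have S: "(\<Sum>i\<in>(UNIV::'d set). g i) = (\<Sum>l<?n. g (e l))" for g :: "'d \<Rightarrow> complex"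
    unfolding e_def by (rule sum_enum_index)
  have apply_vec: "vec_index (cmat M *\<^sub>v x) i = (complex_matrix M *v (\<chi> j. vec_index x (e' j))) $ e i"
    if "x \<in> carrier_vec ?n" "i < ?n" for x i
    using that by (simp add: cmat_def Let_def scalar_prod_def matrix_vector_mult_def S e'e
        complex_matrix_def atLeast0LessThan flip: e_def)
  show ?thesis
  proof
    assume "eigenvalue (cmat M) \<zeta>"
    then obtain x where x: "x \<in> carrier_vec ?n" "x \<noteq> 0\<^sub>v ?n" "cmat M *\<^sub>v x = \<zeta> \<cdot>\<^sub>v x"
      using cmat_carrier[of M] by (auto simp: eigenvalue_def eigenvector_def)
    define w :: "complex^'d" where "w = (\<chi> j. vec_index x (e' j))"
    have "w \<noteq> 0"
    proof
      assume w0: "w = 0"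
      have "vec_index x i = 0" if "i < ?n" for i
      proof -
        have "w $ e i = 0" using w0 by simp
        then show ?thesis using that by (simp add: w_def e'e)
      qed
      then have "x = 0\<^sub>v ?n" using x(1) by (intro eq_vecI) auto
      then show False using x(2) by simp
    qed
    moreover have "(complex_matrix M *v w) $ i = (\<zeta> *s w) $ i" for i
    proof -
      have "(complex_matrix M *v w) $ i = vec_index (\<zeta> \<cdot>\<^sub>v x) (e' i)"
        using apply_vec[OF x(1) ee'(2)[of i]] unfolding x(3) w_def ee'(1) by simp
      then show ?thesis using x(1) ee'(2)[of i] by (simp add: w_def)
    qed
    ultimately show "\<exists>w. w \<noteq> 0 \<and> complex_matrix M *v w = \<zeta> *s w"
      unfolding Finite_Cartesian_Product.vec_eq_iff[of "complex_matrix M *v _"] by blast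
  next
    assume "\<exists>w. w \<noteq> 0 \<and> complex_matrix M *v w = \<zeta> *s w"
    then obtain w where w: "w \<noteq> 0" "complex_matrix M *v w = \<zeta> *s w" by blast
    define x where "x = Matrix.vec ?n (\<lambda>i. w $ e i)"
    have x: "x \<in> carrier_vec ?n" by (simp add: x_def)
    have xw: "(\<chi> j. vec_index x (e' j)) = w"
      by (simp add: x_def ee' Finite_Cartesian_Product.vec_eq_iff)
    have "x \<noteq> 0\<^sub>v ?n"
    proof
      assume "x = 0\<^sub>v ?n"
      then have "w $ i = 0" for i unfolding xw[symmetric] using ee'(2)[of i] by simp
      then show False using w(1) by (simp add: Finite_Cartesian_Product.vec_eq_iff)
    qed
    moreover have "cmat M *\<^sub>v x = \<zeta> \<cdot>\<^sub>v x"
    proof (rule eq_vecI)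
      show "dim_vec (cmat M *\<^sub>v x) = dim_vec (\<zeta> \<cdot>\<^sub>v x)" using x cmat_carrier[of M] by simp
      fix i assume "i < dim_vec (\<zeta> \<cdot>\<^sub>v x)"
      then have i: "i < ?n" using x by simp
      show "vec_index (cmat M *\<^sub>v x) i = vec_index (\<zeta> \<cdot>\<^sub>v x) i"
        using i unfolding apply_vec[OF x i] xw w(2) by (simp add: x_def)
    qed
    ultimately show "eigenvalue (cmat M) \<zeta>"
      using x cmat_carrier[of M] unfolding eigenvalue_def eigenvector_def by auto
  qed
qed

lemma eigenvalue_cmat_cnj: "eigenvalue (cmat M) \<zeta> \<Longrightarrow> eigenvalue (cmat M) (cnj \<zeta>)"
proof -
  assume "eigenvalue (cmat M) \<zeta>"
  then obtain w where w: "w \<noteq> 0" "complex_matrix M *v w = \<zeta> *s w" by (auto simp: eigenvalue_cmat_iff)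
  have "vec_cnj w \<noteq> 0" using w(1) by (simp add: vec_cnj_def Finite_Cartesian_Product.vec_eq_iff)
  moreover have "complex_matrix M *v vec_cnj w = cnj \<zeta> *s vec_cnj w"
    unfolding vec_cnj_mult w(2) by (simp add: vec_cnj_def Finite_Cartesian_Product.vec_eq_iff)
  ultimately show ?thesis by (auto simp: eigenvalue_cmat_iff)
qed

lemma phases_cnj: "\<gamma> \<in> phases M \<Longrightarrow> cnj \<gamma> \<in> phases M"
  using eigenvalue_cmat_cnj[of M "\<gamma> * complex_of_real (spec_rad M)"] by (simp add: phases_def)

lemma finite_phases:
  assumes "spec_rad M > 0"
  shows "finite (phases M)"
proof -
  have "(\<lambda>\<gamma>. \<gamma> * complex_of_real (spec_rad M)) ` phases M \<subseteq> spectrum (cmat M)"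
    by (auto simp: phases_def spectrum_def)
  then have "finite ((\<lambda>\<gamma>. \<gamma> * complex_of_real (spec_rad M)) ` phases M)"
    using card_finite_spectrum(1)[OF cmat_carrier] finite_subset by blast
  moreover have "inj_on (\<lambda>\<gamma>. \<gamma> * complex_of_real (spec_rad M)) (phases M)"
    using assms by (auto simp: inj_on_def)
  ultimately show ?thesis by (rule finite_imageD)
qed

lemma tendsto_fun_iff:
  fixes F :: "nat \<Rightarrow> complex \<Rightarrow> complex"
  shows "F \<longlonglongrightarrow> h \<longleftrightarrow> (\<forall>\<gamma>. (\<lambda>n. F n \<gamma>) \<longlonglongrightarrow> h \<gamma>)"
  using limitin_componentwise[of "\<lambda>_. euclidean" UNIV F h sequentially]
  by (simp add: euclidean_product_topology)

lemma phase_power_tendsto_iff: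
  "(\<lambda>j. phase_power M (n j)) \<longlonglongrightarrow> h \<longleftrightarrow>
    (\<forall>\<gamma>\<in>phases M. (\<lambda>j. \<gamma> ^ n j) \<longlonglongrightarrow> h \<gamma>) \<and> (\<forall>\<gamma>. \<gamma> \<notin> phases M \<longrightarrow> h \<gamma> = 1)"
proof -
  have "(\<lambda>j. phase_power M (n j) \<gamma>) \<longlonglongrightarrow> h \<gamma> \<longleftrightarrow>
    (if \<gamma> \<in> phases M then (\<lambda>j. \<gamma> ^ n j) \<longlonglongrightarrow> h \<gamma> else h \<gamma> = 1)" for \<gamma>
    by (auto simp: phase_power_def LIMSEQ_const_iff)
  then show ?thesis unfolding tendsto_fun_iff by auto
qed

lemma phase_power_limit_mem:
  assumes "(\<lambda>j. phase_power M (n j)) \<longlonglongrightarrow> h"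
  shows "h \<in> phase_group M"
  unfolding phase_group_def
  by (rule Lim_in_closed_set[OF closed_closure _ _ assms])
     (auto intro!: always_eventually closure_subset[THEN subsetD])

text \<open>Bolzano-Weierstrass in one coordinate after the other, refining the subsequence each
  time.\<close>

lemma finite_convergent_subsequence:
  fixes f :: "nat \<Rightarrow> 'a \<Rightarrow> complex"
  assumes "finite F" "\<And>n \<gamma>. \<gamma> \<in> F \<Longrightarrow> cmod (f n \<gamma>) \<le> 1"
  shows "\<exists>s. strict_mono s \<and> (\<forall>\<gamma>\<in>F. convergent (\<lambda>j::nat. f (s j) \<gamma>))"
  using assms
proof (induction F rule: finite_induct)
  case empty
  then show ?case using strict_mono_id[where 'a = nat] by blast
next
  case (insert x F)
  then obtain s where s: "strict_mono s" "\<forall>\<gamma>\<in>F. convergent (\<lambda>j. f (s j) \<gamma>)" by blast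
  have "bounded (range (\<lambda>j. f (s j) x))" using insert.prems by (auto simp: bounded_iff)
  then obtain l t where t: "strict_mono t" "((\<lambda>j. f (s j) x) \<circ> t) \<longlonglongrightarrow> l"
    using bounded_imp_convergent_subsequence by blast
  have "convergent (\<lambda>j. f ((s \<circ> t) j) \<gamma>)" if "\<gamma> \<in> F" for \<gamma>
    using convergent_subseq_convergent[OF s(2)[rule_format, OF that] t(1)] by (simp add: o_def)
  moreover have "convergent (\<lambda>j. f ((s \<circ> t) j) x)" using t(2) by (auto simp: convergent_def o_def)
  ultimately show ?case using strict_mono_o[OF s(1) t(1)] by blast
qed

text \<open>Sequential compactness of the group of phases: the functions are constantly 1 outside
  the finite set of phases, so only finitely many bounded coordinates matter.\<close>

lemma phase_power_subsequence:
  fixes n :: "nat \<Rightarrow> nat"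
  assumes "spec_rad M > 0"
  obtains s h where "strict_mono s" "(\<lambda>j. phase_power M (n (s j))) \<longlonglongrightarrow> h" "h \<in> phase_group M"
proof -
  have "\<exists>s. strict_mono s \<and> (\<forall>\<gamma>\<in>phases M. convergent (\<lambda>j::nat. \<gamma> ^ n (s j)))"
    by (rule finite_convergent_subsequence[OF finite_phases[OF assms], of "\<lambda>j \<gamma>. \<gamma> ^ n j"])
       (simp add: phases_def norm_power)
  then obtain s where s: "strict_mono s" "\<forall>\<gamma>\<in>phases M. convergent (\<lambda>j::nat. \<gamma> ^ n (s j))" by blast
  define h where "h \<gamma> = (if \<gamma> \<in> phases M then lim (\<lambda>j. \<gamma> ^ n (s j)) else 1)" for \<gamma>
  have "(\<lambda>j. phase_power M (n (s j))) \<longlonglongrightarrow> h"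
    using s(2) by (auto simp: phase_power_tendsto_iff h_def convergent_LIMSEQ_iff)
  then show thesis by (intro that[OF s(1) _ phase_power_limit_mem])
qed

text \<open>Powers along a convergent subsequence come close to each other; as phases have modulus
  1, two close powers mean that the power to the difference of the exponents is close to 1.\<close>

lemma phase_recurrence:
  assumes "spec_rad M > 0" "\<epsilon> > 0"
  shows "\<exists>t\<ge>N. \<forall>\<gamma>\<in>phases M. cmod (\<gamma> ^ t - 1) < \<epsilon>"
proof -
  obtain s :: "nat \<Rightarrow> nat" and h where s: "strict_mono s" "(\<lambda>j. phase_power M (s j)) \<longlonglongrightarrow> h"
    using phase_power_subsequence[OF assms(1), of "\<lambda>n. n"] by blast
  have "\<forall>\<gamma>\<in>phases M. eventually (\<lambda>j. dist (\<gamma> ^ s j) (h \<gamma>) < \<epsilon> / 2) sequentially"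
    using s(2) half_gt_zero[OF assms(2)] tendstoD unfolding phase_power_tendsto_iff by metis
  then have "eventually (\<lambda>j. \<forall>\<gamma>\<in>phases M. dist (\<gamma> ^ s j) (h \<gamma>) < \<epsilon> / 2) sequentially"
    using finite_phases[OF assms(1)] by (simp add: eventually_ball_finite_distrib)
  then obtain i where i: "\<And>j. j \<ge> i \<Longrightarrow> \<forall>\<gamma>\<in>phases M. dist (\<gamma> ^ s j) (h \<gamma>) < \<epsilon> / 2"
    by (auto simp: eventually_sequentially)
  \<comment> \<open>Large enough for \<open>j \<ge> i\<close> and, because
    \<open>s j \<ge> j\<close>, for a gap \<open>s j - s i\<close> of at least
    \<open>N\<close>.\<close>
  define j where "j = i + s i + N"
  have sj: "s i + N \<le> s j" "i \<le> j" using strict_mono_imp_increasing[OF s(1), of j] by (auto simp: j_def)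
  show ?thesis
  proof (intro exI[of _ "s j - s i"] conjI ballI)
    show "N \<le> s j - s i" using sj by simp
    fix \<gamma> assume g: "\<gamma> \<in> phases M"
    then have 1: "cmod \<gamma> = 1" by (simp add: phases_def)
    have "\<gamma> ^ s j = \<gamma> ^ s i * \<gamma> ^ (s j - s i)" using sj by (simp flip: power_add)
    then have "\<gamma> ^ s j - \<gamma> ^ s i = \<gamma> ^ s i * (\<gamma> ^ (s j - s i) - 1)" by (simp add: algebra_simps)
    then have "cmod (\<gamma> ^ (s j - s i) - 1) = cmod (\<gamma> ^ s j - \<gamma> ^ s i)"
      using 1 by (simp add: norm_mult norm_power)
    also have "\<dots> < \<epsilon>"
      using i[OF sj(2)] i[OF order_refl] g dist_triangle_half_l[of "\<gamma> ^ s j" "h \<gamma>" \<epsilon> "\<gamma> ^ s i"]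
      by (auto simp: dist_norm dist_commute)
    finally show "cmod (\<gamma> ^ (s j - s i) - 1) < \<epsilon>" .
  qed
qed

text \<open>Membership in the closure says nothing about the size of the exponents, for instance if
  \<open>h\<close> is itself a power. Adding a large exponent \<open>t\<close> of near return to 1
  drives them to infinity while moving the powers only a little.\<close>

lemma phase_group_approach:
  assumes "spec_rad M > 0" "h \<in> phase_group M"
  obtains n :: "nat \<Rightarrow> nat" where
    "filterlim n at_top sequentially" "(\<lambda>j. phase_power M (n j)) \<longlonglongrightarrow> h"
proof -
  have one: "h \<gamma> = 1" if "\<gamma> \<notin> phases M" for \<gamma>
  proof -
    have "closed {h :: complex \<Rightarrow> complex. h \<gamma> = 1}"
      by (intro closed_Collect_eq continuous_on_product_coordinates continuous_on_const)
    moreover have "range (phase_power M) \<subseteq> {h. h \<gamma> = 1}" using that by (auto simp: phase_power_def)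
    ultimately have "closure (range (phase_power M)) \<subseteq> {h. h \<gamma> = 1}" by (rule closure_minimal[rotated])
    then show ?thesis using assms(2) by (auto simp: phase_group_def)
  qed
  have ex: "\<exists>m\<ge>N. \<forall>\<gamma>\<in>phases M. dist (\<gamma> ^ m) (h \<gamma>) < \<epsilon>" if e: "\<epsilon> > 0" for \<epsilon> N
  proof -
    define U where "U = (\<Inter>\<gamma>\<in>phases M. {h' :: complex \<Rightarrow> complex. dist (h' \<gamma>) (h \<gamma>) < \<epsilon> / 2})"
    have "open U" unfolding U_def
      by (intro open_INT finite_phases[OF assms(1)] ballI open_Collect_less continuous_on_dist
            continuous_on_product_coordinates continuous_on_const)
    moreover have "h \<in> U" using e by (simp add: U_def)
    ultimately have "U \<inter> range (phase_power M) \<noteq> {}"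
      using assms(2) open_Int_closure_eq_empty[of U "range (phase_power M)"]
      unfolding phase_group_def by blast
    then obtain m where m: "phase_power M m \<in> U" by blast
    obtain t where t: "t \<ge> N" "\<forall>\<gamma>\<in>phases M. cmod (\<gamma> ^ t - 1) < \<epsilon> / 2"
      using phase_recurrence[OF assms(1), of "\<epsilon> / 2" N] e by auto
    show ?thesis
    proof (intro exI[of _ "m + t"] conjI ballI)
      fix \<gamma> assume g: "\<gamma> \<in> phases M"
      then have 1: "cmod \<gamma> = 1" by (simp add: phases_def)
      have "dist (\<gamma> ^ (m + t)) (\<gamma> ^ m) = cmod (\<gamma> ^ m * (\<gamma> ^ t - 1))"
        by (simp add: dist_norm power_add algebra_simps)
      also have "\<dots> < \<epsilon> / 2" using t(2) g 1 by (simp add: norm_mult norm_power)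
      finally have "dist (\<gamma> ^ (m + t)) (\<gamma> ^ m) < \<epsilon> / 2" .
      moreover have "dist (\<gamma> ^ m) (h \<gamma>) < \<epsilon> / 2" using m g by (auto simp: U_def phase_power_def)
      ultimately show "dist (\<gamma> ^ (m + t)) (h \<gamma>) < \<epsilon>" by (metis dist_commute dist_triangle_half_l)
    qed (use t in simp)
  qed
  have "\<forall>j. \<exists>m\<ge>j. \<forall>\<gamma>\<in>phases M. dist (\<gamma> ^ m) (h \<gamma>) < 1 / real (Suc j)"
    using ex by simp
  then obtain n where n: "\<And>j. n j \<ge> j" "\<And>j \<gamma>. \<gamma> \<in> phases M \<Longrightarrow> dist (\<gamma> ^ n j) (h \<gamma>) < 1 / real (Suc j)"
    by metis
  have "filterlim n at_top sequentially"
    using n(1) by (intro filterlim_at_top_mono[OF filterlim_ident]) auto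
  moreover have "(\<lambda>j. phase_power M (n j)) \<longlonglongrightarrow> h"
    unfolding phase_power_tendsto_iff
  proof (intro conjI ballI allI impI)
    fix \<gamma> assume "\<gamma> \<in> phases M"
    then have le: "dist (\<gamma> ^ n j) (h \<gamma>) \<le> inverse (real (Suc j))" for j
      using n(2)[of \<gamma> j] by (simp add: inverse_eq_divide less_imp_le)
    have "(\<lambda>j. dist (\<gamma> ^ n j) (h \<gamma>)) \<longlonglongrightarrow> 0"
      by (rule tendsto_sandwich[OF always_eventually[OF allI[OF zero_le_dist]]
            always_eventually[OF allI[OF le]] tendsto_const LIMSEQ_inverse_real_of_nat])
    then show "(\<lambda>j. \<gamma> ^ n j) \<longlonglongrightarrow> h \<gamma>" by (rule tendsto_dist_iff[THEN iffD2])
  qed (rule one)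
  ultimately show thesis by (rule that)
qed

text \<open>Nonreal eigenvalues of a real matrix come in conjugate pairs; this is the condition on
  \<open>h\<close> under which multiplication by \<open>h\<close> on the generalised eigenspaces is
  a real operator.\<close>

definition phase_symmetric :: "real^'d^'d \<Rightarrow> (complex \<Rightarrow> complex) \<Rightarrow> bool" where
  "phase_symmetric M h \<longleftrightarrow> (\<forall>\<gamma>\<in>phases M. h (cnj \<gamma>) = cnj (h \<gamma>))"

lemma phase_symmetric_power: "phase_symmetric M (phase_power M n)"
  by (simp add: phase_symmetric_def phase_power_def phases_cnj)

lemma phase_symmetric_group:
  assumes "spec_rad M > 0" "h \<in> phase_group M"
  shows "phase_symmetric M h"
proof -
  obtain n where n: "(\<lambda>j. phase_power M (n j)) \<longlonglongrightarrow> h"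
    using phase_group_approach[OF assms] by blast
  show ?thesis unfolding phase_symmetric_def
  proof
    fix \<gamma> assume g: "\<gamma> \<in> phases M"
    have "(\<lambda>j. cnj (\<gamma> ^ n j)) \<longlonglongrightarrow> cnj (h \<gamma>)"
      using n g by (intro tendsto_cnj) (simp add: phase_power_tendsto_iff)
    moreover have "(\<lambda>j. cnj \<gamma> ^ n j) \<longlonglongrightarrow> h (cnj \<gamma>)"
      using n phases_cnj[OF g] by (simp add: phase_power_tendsto_iff)
    ultimately show "h (cnj \<gamma>) = cnj (h \<gamma>)" using LIMSEQ_unique by fastforce
  qed
qed

section \<open>Rotations and the limit matrix\<close>

lemma gen_eigenspace_mult:
  assumes "w \<in> gen_eigenspace M \<zeta>"
  shows "complex_matrix M *v w \<in> gen_eigenspace M \<zeta>"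
proof -
  have add: "(char_op M \<zeta> ^^ n) (x + y) = (char_op M \<zeta> ^^ n) x + (char_op M \<zeta> ^^ n) y" for n x y
    by (induction n) (simp_all only: funpow.simps comp_apply id_apply char_op_add)
  have scale: "(char_op M \<zeta> ^^ n) (c *s x) = c *s (char_op M \<zeta> ^^ n) x" for n c x
    by (induction n) (simp_all only: funpow.simps comp_apply id_apply char_op_scale)
  obtain n where n: "(char_op M \<zeta> ^^ n) w = 0" using assms by (auto simp: gen_eigenspace_def)
  have "(char_op M \<zeta> ^^ n) (char_op M \<zeta> w) = char_op M \<zeta> ((char_op M \<zeta> ^^ n) w)"
    by (rule funpow_swap1[symmetric])
  then have 1: "(char_op M \<zeta> ^^ n) (char_op M \<zeta> w) = 0" using char_op_0[of 1 M \<zeta>] by (simp add: n)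
  have "(char_op M \<zeta> ^^ n) (complex_matrix M *v w) = (char_op M \<zeta> ^^ n) (char_op M \<zeta> w + \<zeta> *s w)"
    by simp
  also have "\<dots> = 0" unfolding add scale 1 n by simp
  finally show ?thesis unfolding gen_eigenspace_def by blast
qed

lemma gen_eigenspace_power:
  assumes "w \<in> gen_eigenspace M \<zeta>"
  shows "complex_matrix (matrix_power M n) *v w \<in> gen_eigenspace M \<zeta>"
  unfolding complex_matrix_power_apply
  by (induction n) (simp_all only: funpow.simps comp_apply id_apply assms gen_eigenspace_mult)

text \<open>Binomial theorem for \<open>M\<close> as the sum of \<open>\<zeta>\<close> and the
  nilpotent \<open>char_op M \<zeta>\<close>, cut off at the nilpotency order. For
  \<open>i > n\<close> the binomial coefficient is 0, so the truncated exponent \<open>n - i\<close>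
  does no harm.\<close>

lemma power_on_chain:
  assumes "(char_op M \<zeta> ^^ K) w = 0"
  shows "complex_matrix (matrix_power M n) *v w =
    (\<Sum>i<K. (of_nat (n choose i) * \<zeta> ^ (n - i)) *s (char_op M \<zeta> ^^ i) w)"
proof (induction n)
  case 0
  show ?case
  proof (cases K)
    case 0
    then have "w = 0" using assms by simp
    then show ?thesis using 0 by (simp add: matrix_vector_mult_0_right)
  next
    case (Suc K')
    have "(\<Sum>i<K. (of_nat (0 choose i) * \<zeta> ^ (0 - i)) *s (char_op M \<zeta> ^^ i) w) = 
      w + (\<Sum>i<K'. (of_nat (0 choose Suc i) * \<zeta> ^ (0 - Suc i)) *s (char_op M \<zeta> ^^ Suc i) w)"
      unfolding Suc sum.lessThan_Suc_shift by simp
    also have "\<dots> = w" by simp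
    finally show ?thesis by (simp add: complex_matrix_power_apply)
  qed
next
  case (Suc n)
  let ?T = "\<lambda>n i. (of_nat (n choose i) * \<zeta> ^ (n - i) :: complex)"
  let ?N = "\<lambda>i. (char_op M \<zeta> ^^ i) w"
  have MN: "complex_matrix M *v ?N i = ?N (Suc i) + \<zeta> *s ?N i" for i by simp
  have T: "?T (Suc n) (Suc i) = ?T n i + \<zeta> * ?T n (Suc i)" for i
  proof (cases "i < n")
    case True
    then have "n - i = Suc (n - Suc i)" by simp
    then show ?thesis by (simp add: algebra_simps)
  next
    case False
    then show ?thesis by (cases "i = n") simp_all
  qed
  have "complex_matrix (matrix_power M (Suc n)) *v w = complex_matrix M *v (\<Sum>i<K. ?T n i *s ?N i)"
    unfolding Suc.IH[symmetric] by (simp add: complex_matrix_power_apply)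
  also have "\<dots> = (\<Sum>i<K. complex_matrix M *v (?T n i *s ?N i))"
    by (rule vec.linear_sum[unfolded o_def, OF matrix_vector_mul_linear_gen])
  also have "\<dots> = (\<Sum>i<K. ?T n i *s ?N (Suc i)) + (\<Sum>i<K. (\<zeta> * ?T n i) *s ?N i)"
    unfolding vector_scalar_commute MN vector_add_ldistrib sum.distrib vector_smult_assoc
    by (simp only: mult.commute[of \<zeta>])
  also have "\<dots> = (\<Sum>i<K. ?T (Suc n) i *s ?N i)"
  proof (cases K)
    case 0
    then show ?thesis by simp
  next
    case (Suc K')
    \<comment> \<open>The shift by \<open>char_op\<close> pushes the last term out of the range of
      summation; nilpotency makes it vanish.\<close>
    have NK: "?N (Suc K') = 0" using assms Suc by simp
    have "(\<Sum>i<K. ?T n i *s ?N (Suc i)) = (\<Sum>i<K'. ?T n i *s ?N (Suc i))"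
      unfolding Suc sum.lessThan_Suc NK by simp
    moreover have "(\<Sum>i<K. (\<zeta> * ?T n i) *s ?N i) =
        (\<zeta> * ?T n 0) *s ?N 0 + (\<Sum>i<K'. (\<zeta> * ?T n (Suc i)) *s ?N (Suc i))"
      unfolding Suc sum.lessThan_Suc_shift ..
    moreover have "(\<Sum>i<K. ?T (Suc n) i *s ?N i) =
        (\<zeta> * ?T n 0) *s ?N 0 + (\<Sum>i<K'. (?T n i + \<zeta> * ?T n (Suc i)) *s ?N (Suc i))"
      unfolding Suc sum.lessThan_Suc_shift T by simp
    ultimately show ?thesis
      unfolding vector_sadd_rdistrib sum.distrib by (simp only: add_ac)
  qed
  finally show ?case .
qed

text \<open>Passing from \<open>i\<close> to \<open>Suc i\<close> multiplies the ratio by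
  \<open>(n - i) / n / Suc i\<close>, which converges.\<close>

lemma convergent_choose_ratio: "convergent (\<lambda>n. real (n choose i) / real n ^ i)"
proof (induction i)
  case 0
  then show ?case by (simp add: convergent_const)
next
  case (Suc i)
  \<comment> \<open>Not simplified to 1: the quotient is 0 at \<open>n = 0\<close>, which makes the
    identity below true for every \<open>n\<close>.\<close>
  have "(\<lambda>n. real n / real n) \<longlonglongrightarrow> 1"
    by (rule tendsto_eventually) (auto intro: eventually_mono[OF eventually_gt_at_top[of 0]])
  from tendsto_diff[OF this tendsto_mult_right_zero[OF lim_inverse_n, of "real i"]]
  have "convergent (\<lambda>n. real n / real n - real i * inverse (real n))" by (auto simp: convergent_def)
  then have "convergent (\<lambda>n. (real (n choose i) / real n ^ i) *
      (real n / real n - real i * inverse (real n)) * (1 / real (Suc i)))"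
    by (intro convergent_mult Suc convergent_const)
  moreover have "(real (n choose i) / real n ^ i) * (real n / real n - real i * inverse (real n))
      * (1 / real (Suc i)) = real (n choose Suc i) / real n ^ Suc i" for n
  proof (cases "i \<le> n \<and> n > 0")
    case True
    have "Suc i * (n choose Suc i) = (n - i) * (n choose i)"
      using Suc_times_binomial_add[of i "n - Suc i"] binomial_absorb_comp[of n i] True
        Suc_times_binomial_eq
      by (cases n) (auto simp: binomial_absorption algebra_simps Suc_times_binomial)
    then have "real (Suc i) * real (n choose Suc i) = (real n - real i) * real (n choose i)"
      using True by (metis of_nat_diff of_nat_mult)
    then have e: "real (n choose Suc i) = (real n - real i) * real (n choose i) / real (Suc i)"
      by (simp add: field_simps)
    have "real n / real n - real i * inverse (real n) = (real n - real i) / real n"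
      using True by (simp add: field_simps)
    then show ?thesis unfolding e by (simp add: ac_simps)
  next
    case False
    then show ?thesis by (auto simp: binomial_eq_0)
  qed
  ultimately show ?case by simp
qed

lemma convergent_choose_ratio_le:
  assumes "i \<le> p"
  shows "convergent (\<lambda>n. real (n choose i) / real n ^ p)"
proof -
  have c: "convergent (\<lambda>n. inverse (real n) ^ (p - i))"
  proof (cases "p = i")
    case False
    then have "(\<lambda>n. inverse (real n) ^ (p - i)) \<longlonglongrightarrow> 0 ^ (p - i)"
      by (intro tendsto_power lim_inverse_n)
    then show ?thesis by (auto simp: convergent_def)
  qed (simp add: convergent_const)
  have "real (n choose i) / real n ^ i * inverse (real n) ^ (p - i) = real (n choose i) / real n ^ p" for n
  proof -
    have "real n ^ p = real n ^ i * real n ^ (p - i)" using assms by (simp flip: power_add)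
    then show ?thesis by (simp add: divide_inverse power_inverse)
  qed
  then show ?thesis using convergent_mult[OF convergent_choose_ratio[of i] c] by (simp only:)
qed

text \<open>Since \<open>n choose i\<close> is at most \<open>n ^ i\<close>, this is polynomial
  growth against geometric decay. Writing \<open>x = exp (- c)\<close> reduces it to
  \<open>t ^ i / exp t\<close> at \<open>t = c * n\<close>; the value \<open>x = 0\<close> has no
  logarithm and is separated.\<close>

lemma choose_geometric_tendsto_0:
  fixes x :: real
  assumes "0 \<le> x" "x < 1"
  shows "(\<lambda>n. real (n choose i) * x ^ (n - i)) \<longlonglongrightarrow> 0"
proof (cases "x = 0")
    case True
    have "\<forall>\<^sub>F n in sequentially. real (n choose i) * x ^ (n - i) = 0"
      using eventually_gt_at_top[of i] by eventually_elim (simp add: True power_0_left)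
    then show ?thesis by (rule tendsto_eventually)
  next
    case False
    define c where "c = - ln x"
    have c: "c > 0" "exp (- c) = x" using assms False by (simp_all add: c_def)
    have "filterlim (\<lambda>n. c * real n) at_top sequentially"
      by (rule filterlim_tendsto_pos_mult_at_top[OF tendsto_const c(1) filterlim_real_sequentially])
    from filterlim_compose[OF tendsto_power_div_exp_0 this, of i]
    have "(\<lambda>n. (c * real n) ^ i / exp (c * real n) * (1 / (c ^ i * x ^ i))) \<longlonglongrightarrow> 0"
      by (rule tendsto_mult_left_zero)
    moreover have "(c * real n) ^ i / exp (c * real n) * (1 / (c ^ i * x ^ i)) = real n ^ i * (x ^ n / x ^ i)" for n
    proof -
      have "exp (c * real n) = 1 / x ^ n"
        unfolding c(2)[symmetric] using exp_of_nat_mult[of n c]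
        by (simp add: exp_minus mult.commute inverse_eq_divide power_divide)
      then show ?thesis using c(1) False by (simp add: power_mult_distrib field_simps)
    qed
    ultimately have lim: "(\<lambda>n. real n ^ i * (x ^ n / x ^ i)) \<longlonglongrightarrow> 0" by simp
    show ?thesis
    proof (rule tendsto_sandwich[OF always_eventually _ tendsto_const lim])
      show "\<forall>n. 0 \<le> real (n choose i) * x ^ (n - i)" using assms by simp
      have "real (n choose i) * x ^ (n - i) \<le> real n ^ i * (x ^ n / x ^ i)" if "n \<ge> i" for n
      proof (rule mult_mono)
        show "real (n choose i) \<le> real n ^ i"
          using binomial_le_pow[OF that] by (metis of_nat_le_iff of_nat_power)
        show "x ^ (n - i) \<le> x ^ n / x ^ i" using False that by (simp add: power_diff)
      qed (use assms in auto)
      then show "\<forall>\<^sub>F n in sequentially. real (n choose i) * x ^ (n - i) \<le> real n ^ i * (x ^ n / x ^ i)"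
        by (rule eventually_sequentiallyI)
    qed
  qed

section \<open>Limits and scalars in matrix products\<close>

lemma complex_matrix_scaleR: "complex_matrix (c *\<^sub>R X) *v w = complex_of_real c *s (complex_matrix X *v w)"
  by (simp add: complex_matrix_def matrix_vector_mult_def Finite_Cartesian_Product.vec_eq_iff
      sum_distrib_left mult.assoc)

lemma tendsto_matrix_vector_mult:
  fixes A :: "'b \<Rightarrow> real^'n^'k"
  assumes "(A \<longlongrightarrow> B) F"
  shows "((\<lambda>x. A x *v v) \<longlongrightarrow> B *v v) F"
proof (rule vec_tendstoI)
  fix i
  have "((\<lambda>x. \<Sum>l\<in>UNIV. A x $ i $ l * v $ l) \<longlongrightarrow> (\<Sum>l\<in>UNIV. B $ i $ l * v $ l)) F"
    by (intro tendsto_sum tendsto_mult tendsto_const tendsto_vec_nth assms)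
  then show "((\<lambda>x. (A x *v v) $ i) \<longlongrightarrow> (B *v v) $ i) F" by (simp add: matrix_vector_mult_def)
qed

lemma tendsto_matrix_mult:
  fixes A :: "'b \<Rightarrow> real^'n^'k" and C :: "'b \<Rightarrow> real^'l^'n"
  assumes "(A \<longlongrightarrow> B) F" "(C \<longlongrightarrow> D) F"
  shows "((\<lambda>x. A x ** C x) \<longlongrightarrow> B ** D) F"
proof (intro vec_tendstoI)
  fix i j
  have "((\<lambda>x. \<Sum>l\<in>UNIV. A x $ i $ l * C x $ l $ j) \<longlongrightarrow> (\<Sum>l\<in>UNIV. B $ i $ l * D $ l $ j)) F"
    by (intro tendsto_sum tendsto_mult tendsto_vec_nth assms)
  then show "((\<lambda>x. (A x ** C x) $ i $ j) \<longlongrightarrow> (B ** D) $ i $ j) F" by (simp add: matrix_matrix_mult_def)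
qed

lemma matrix_mult_scaleR: "X ** (c *\<^sub>R Y) = c *\<^sub>R (X ** Y)" for X Y :: "real^'n^'n"
proof -
  have "(X ** (c *\<^sub>R Y)) $ i $ j = (c *\<^sub>R (X ** Y)) $ i $ j" for i j
    by (simp add: matrix_matrix_mult_def sum_distrib_left mult.left_commute)
  then show ?thesis by (simp add: Finite_Cartesian_Product.vec_eq_iff)
qed

text \<open>The conditions on \<open>M\<close> hold for every compression to \<open>S\<close>. They
  put all generalised eigenspaces of nonzero eigenvalues inside the complexified \<open>S\<close>,
  and the orthogonal complement inside the kernel.\<close>

locale jordan_compression = jordan_basis M b q z m
  for M :: "real^'d^'d" and b q z m +
  fixes S :: "(real^'d) set"
  assumes subspace_S: "subspace S"
    and M_mem: "\<And>x. M *v x \<in> S"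
    and M_null: "\<And>x. x \<in> S\<^sup>\<bottom> \<Longrightarrow> M *v x = 0"
    and spec_rad_pos: "spec_rad M > 0"
begin

text \<open>The scalar by which the rotation for \<open>h\<close> acts on the generalised eigenspace
  of \<open>\<zeta>\<close>; dividing by the spectral radius turns a peripheral eigenvalue into its
  phase.\<close>

definition multiplier :: "(complex \<Rightarrow> complex) \<Rightarrow> complex \<Rightarrow> complex" where
  "multiplier h \<zeta> = (if cmod \<zeta> = spec_rad M then h (\<zeta> / complex_of_real (spec_rad M)) else 1)"

lemma phase_of_z:
  assumes "j < CARD('d)" "cmod (z j) = spec_rad M"
  shows "z j / complex_of_real (spec_rad M) \<in> phases M"
  using assms eigen[of j] spec_rad_pos by (simp add: phases_def norm_divide)

lemma gen_expand:
  assumes "w \<in> gen_eigenspace M \<zeta>"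
  shows "(\<Sum>j<CARD('d). (multiplier h (z j) * cdot (q j) w) *s b j) = multiplier h \<zeta> *s w"
proof -
  have "(\<Sum>j<CARD('d). (multiplier h (z j) * cdot (q j) w) *s b j) =
    (\<Sum>j<CARD('d). multiplier h \<zeta> *s (cdot (q j) w *s b j))"
  proof (intro sum.cong refl)
    fix j assume "j \<in> {..<CARD('d)}"
    then have "z j = \<zeta> \<or> cdot (q j) w = 0" using gen[OF _ assms] by blast
    then show "(multiplier h (z j) * cdot (q j) w) *s b j = multiplier h \<zeta> *s (cdot (q j) w *s b j)"
      by (auto simp: vector_smult_assoc)
  qed
  also have "\<dots> = multiplier h \<zeta> *s (\<Sum>j<CARD('d). cdot (q j) w *s b j)"
    by (rule vec.scale_sum_right[symmetric])
  finally show ?thesis using expand[of w] by simp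
qed

text \<open>The operator \<open>C\<close> is diagonal in the Jordan basis. It is real because
  conjugation exchanges the generalised eigenspaces of \<open>\<zeta>\<close> and
  \<open>cnj \<zeta>\<close> while \<open>h\<close> respects conjugation, so \<open>C\<close> and
  its entrywise conjugate \<open>C'\<close> agree on the basis.\<close>

lemma rotation_exists:
  assumes h: "phase_symmetric M h"
  obtains R :: "real^'d^'d" where
    "\<And>\<zeta> w. w \<in> gen_eigenspace M \<zeta> \<Longrightarrow> complex_matrix R *v w = multiplier h \<zeta> *s w"
proof -
  define C :: "complex^'d^'d" where
    "C = (\<chi> i l. \<Sum>j<CARD('d). multiplier h (z j) * b j $ i * q j $ l)"
  have C_apply: "C *v w = (\<Sum>j<CARD('d). (multiplier h (z j) * cdot (q j) w) *s b j)" for w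
  proof -
    have "(C *v w) $ i = (\<Sum>j<CARD('d). (multiplier h (z j) * cdot (q j) w) *s b j) $ i" for i
    proof -
      have "(C *v w) $ i = (\<Sum>l\<in>UNIV. \<Sum>j<CARD('d). multiplier h (z j) * b j $ i * q j $ l * w $ l)"
        by (simp add: C_def matrix_vector_mult_def sum_distrib_right)
      also have "\<dots> = (\<Sum>j<CARD('d). multiplier h (z j) * b j $ i * (\<Sum>l\<in>UNIV. q j $ l * w $ l))"
        by (subst sum.swap) (simp add: sum_distrib_left mult.assoc)
      finally show ?thesis by (simp add: cdot_def mult_ac)
    qed
    then show ?thesis by (simp add: Finite_Cartesian_Product.vec_eq_iff)
  qed
  have C_gen: "C *v w = multiplier h \<zeta> *s w" if "w \<in> gen_eigenspace M \<zeta>" for w \<zeta>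
    unfolding C_apply by (rule gen_expand[OF that])
  have mult_cnj: "multiplier h (cnj (z j)) = cnj (multiplier h (z j))" if "j < CARD('d)" for j
  proof (cases "cmod (z j) = spec_rad M")
    case True
    from phase_of_z[OF that True] h
    have "h (cnj (z j / complex_of_real (spec_rad M))) = cnj (h (z j / complex_of_real (spec_rad M)))"
      by (simp only: phase_symmetric_def)
    then show ?thesis using True by (simp add: multiplier_def)
  qed (simp add: multiplier_def)
  define C' :: "complex^'d^'d" where "C' = (\<chi> i l. cnj (C $ i $ l))"
  have cnj_cnj: "vec_cnj (vec_cnj w) = w" for w :: "complex^'d"
    by (simp add: vec_cnj_def Finite_Cartesian_Product.vec_eq_iff)
  have C'_apply: "C' *v w = vec_cnj (C *v vec_cnj w)" for w
    by (simp add: C'_def vec_cnj_def matrix_vector_mult_def Finite_Cartesian_Product.vec_eq_iff)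
  have "C' *v b j = C *v b j" if j: "j < CARD('d)" for j
  proof -
    have "C' *v b j = vec_cnj (multiplier h (cnj (z j)) *s vec_cnj (b j))"
      unfolding C'_apply C_gen[OF gen_eigenspace_cnj[OF b_gen[OF j]]] ..
    also have "\<dots> = multiplier h (z j) *s b j"
      unfolding mult_cnj[OF j] by (simp add: vec_cnj_def Finite_Cartesian_Product.vec_eq_iff)
    finally show ?thesis by (simp add: C_gen[OF b_gen[OF j]])
  qed
  then have "C' *v w = C *v w" for w
    using complex_matrix_expand[of C' w] complex_matrix_expand[of C w] by simp
  then have "C' = C" by (simp add: matrix_eq)
  then have real: "cnj (C $ i $ l) = C $ i $ l" for i l
    by (metis C'_def vec_lambda_beta)
  define R where "R = (\<chi> i l. Re (C $ i $ l))"
  have "complex_matrix R $ i $ l = C $ i $ l" for i l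
    using real[of i l] by (simp add: complex_matrix_def R_def complex_eq_iff)
  then have "complex_matrix R = C" by (simp add: Finite_Cartesian_Product.vec_eq_iff)
  then show thesis by (intro that[of R]) (simp only: C_gen)
qed

text \<open>A basis vector for the eigenvalue 0 may mix the complexified \<open>S\<close> with the
  complement, while \<open>rotation\<close> prescribes values on the two parts only. Projecting
  splits it; the part in the complement is killed by \<open>M\<close>, so the other part is still a
  generalised eigenvector.\<close>

lemma zero_gen_split:
  assumes "j < CARD('d)" "z j = 0"
  obtains w1 w2 where "b j = w1 + w2" "w1 \<in> gen_eigenspace M 0 \<inter> complexified S"
    "vec_Re w2 \<in> S\<^sup>\<bottom>" "vec_Im w2 \<in> S\<^sup>\<bottom>"
proof -
  let ?P = "complex_matrix (proj S)"
  define w1 where "w1 = ?P *v b j"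
  define w2 where "w2 = b j - w1"
  have w2: "vec_Re w2 = vec_Re (b j) - proj S *v vec_Re (b j)" "vec_Im w2 = vec_Im (b j) - proj S *v vec_Im (b j)"
    unfolding w2_def w1_def vec_Re_mult[symmetric] vec_Im_mult[symmetric]
    by (simp_all add: vec_Re_def vec_Im_def Finite_Cartesian_Product.vec_eq_iff)
  then have w2S: "vec_Re w2 \<in> S\<^sup>\<bottom>" "vec_Im w2 \<in> S\<^sup>\<bottom>" using proj_orth[OF subspace_S] by simp_all
  have "complex_matrix M *v w2 = 0"
    using vec_Re_Im[of "complex_matrix M *v w2"] M_null[OF w2S(1)] M_null[OF w2S(2)]
    by (simp add: vec_Re_mult vec_Im_mult vec_of_real_0)
  then have Mw1: "complex_matrix M *v w1 = complex_matrix M *v b j"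
    by (simp add: w2_def matrix_vector_mult_diff_distrib)
  have "w1 \<in> gen_eigenspace M 0"
  proof -
    obtain n where "(char_op M 0 ^^ n) (b j) = 0" using b_gen[OF assms(1)] assms(2) by (auto simp: gen_eigenspace_def)
    then have "(char_op M 0 ^^ Suc n) (b j) = 0" using char_op_0[of 1 M 0] by simp
    moreover have "(char_op M 0 ^^ Suc n) w1 = (char_op M 0 ^^ Suc n) (b j)"
      unfolding funpow_Suc_right comp_apply using Mw1 by simp
    ultimately have "(char_op M 0 ^^ Suc n) w1 = 0" by simp
    then show ?thesis unfolding gen_eigenspace_def by blast
  qed
  moreover have "w1 \<in> complexified S"
    unfolding mem_complexified w1_def vec_Re_mult vec_Im_mult using proj_mem[OF subspace_S] by simp
  moreover have "b j = w1 + w2" by (simp add: w2_def)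
  ultimately show thesis using w2S by (intro that) auto
qed

text \<open>Unfolds the definite description. For existence, the complement of \<open>S\<close> lies
  in the generalised eigenspace of 0, where the multiplier is 1 as the spectral radius is positive.
  For uniqueness, a basis vector lies in the complexified \<open>S\<close> if its eigenvalue is
  nonzero, and otherwise splits into two vectors with prescribed images.\<close>

lemma rotation_gen:
  assumes h: "phase_symmetric M h" and w: "w \<in> gen_eigenspace M \<zeta>"
  shows "complex_matrix (rotation S M h) *v w = multiplier h \<zeta> *s w"
proof -
  obtain R :: "real^'d^'d" where R:
    "\<And>\<zeta> w. w \<in> gen_eigenspace M \<zeta> \<Longrightarrow> complex_matrix R *v w = multiplier h \<zeta> *s w"
    by (rule rotation_exists[OF h]) (rule that)
  let ?Q = "\<lambda>R. (\<forall>\<gamma>\<in>phases M. \<forall>w \<in> gen_eigenspace M (\<gamma> * complex_of_real (spec_rad M)) \<inter> complexified S.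
        complex_matrix R *v w = h \<gamma> *s w) \<and>
     (\<forall>z. cmod z \<noteq> spec_rad M \<longrightarrow>
        (\<forall>w \<in> gen_eigenspace M z \<inter> complexified S. complex_matrix R *v w = w)) \<and>
     (\<forall>x \<in> S\<^sup>\<bottom>. R *v x = x)"
  have mult_phase: "multiplier h (\<gamma> * complex_of_real (spec_rad M)) = h \<gamma>" if "\<gamma> \<in> phases M" for \<gamma>
    using that spec_rad_pos by (simp add: multiplier_def phases_def norm_mult)
  have "?Q R"
  proof (intro conjI ballI allI impI)
    fix \<gamma> w assume "\<gamma> \<in> phases M"
      "w \<in> gen_eigenspace M (\<gamma> * complex_of_real (spec_rad M)) \<inter> complexified S"
    then show "complex_matrix R *v w = h \<gamma> *s w" using R mult_phase by (metis IntD1)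
  next
    fix z w assume "cmod z \<noteq> spec_rad M" "w \<in> gen_eigenspace M z \<inter> complexified S"
    then show "complex_matrix R *v w = w" using R[of w z] by (simp add: multiplier_def)
  next
    fix x assume x: "x \<in> S\<^sup>\<bottom>"
    have "(char_op M 0 ^^ 1) (vec_of_real x) = 0"
      using M_null[OF x] by (simp add: vec_of_real_mult vec_of_real_0)
    then have "vec_of_real x \<in> gen_eigenspace M 0" unfolding gen_eigenspace_def by blast
    from R[OF this] show "R *v x = x" using spec_rad_pos
      by (simp add: multiplier_def vec_of_real_mult vec_of_real_eq_iff)
  qed
  moreover have "R' = R" if Q: "?Q R'" for R'
  proof (rule matrix_eqI)
    fix j assume j: "j < CARD('d)"
    show "complex_matrix R' *v b j = complex_matrix R *v b j"
    proof (cases "z j = 0")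
      case False
      have S: "b j \<in> complexified S"
        by (rule gen_eigenspace_nonzero_complexified[OF subspace_S M_mem False b_gen[OF j]])
      show ?thesis
      proof (cases "cmod (z j) = spec_rad M")
        case True
        have e: "z j / complex_of_real (spec_rad M) * complex_of_real (spec_rad M) = z j"
          using spec_rad_pos by simp
        have "b j \<in> gen_eigenspace M (z j / complex_of_real (spec_rad M) * complex_of_real (spec_rad M)) \<inter> complexified S"
          unfolding e using b_gen[OF j] S by blast
        then have "complex_matrix R' *v b j = h (z j / complex_of_real (spec_rad M)) *s b j"
          using Q phase_of_z[OF j True] by blast
        then show ?thesis using True by (simp add: R[OF b_gen[OF j]] multiplier_def)
      next
        case F: False
        then have "complex_matrix R' *v b j = b j" using Q b_gen[OF j] S by blast
        then show ?thesis using F by (simp add: R[OF b_gen[OF j]] multiplier_def)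
      qed
    next
      case True
      then obtain w1 w2 where w: "b j = w1 + w2" "w1 \<in> gen_eigenspace M 0 \<inter> complexified S"
        "vec_Re w2 \<in> S\<^sup>\<bottom>" "vec_Im w2 \<in> S\<^sup>\<bottom>" using zero_gen_split[OF j] by metis
      have "cmod 0 \<noteq> spec_rad M" using spec_rad_pos by simp
      then have 1: "complex_matrix R' *v w1 = w1" using Q w(2) by blast
      have 2: "complex_matrix R' *v w2 = w2"
      proof -
        have "R' *v vec_Re w2 = vec_Re w2" "R' *v vec_Im w2 = vec_Im w2" using Q w(3,4) by blast+
        then show ?thesis
          using vec_Re_Im[of "complex_matrix R' *v w2"] vec_Re_Im[of w2] by (simp add: vec_Re_mult vec_Im_mult)
      qed
      have "complex_matrix R' *v b j = b j" unfolding w(1) matrix_vector_right_distrib 1 2 ..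
      then show ?thesis using True spec_rad_pos by (simp add: R[OF b_gen[OF j]] multiplier_def)
    qed
  qed
  ultimately have "(THE R. ?Q R) = R" by (rule the_equality)
  then show ?thesis unfolding rotation_def using R[OF w] by simp
qed

section \<open>Normalised powers and their limit\<close>

definition norm_coeff :: "nat \<Rightarrow> real" where
  "norm_coeff n = fact (max_block M - 1) /
    (real n ^ (max_block M - 1) * spec_rad M powi (int n - int (max_block M) + 1))"

definition coeff_const :: real where
  "coeff_const = fact (max_block M - 1) / spec_rad M powi (1 - int (max_block M))"

lemma coeff_const_pos: "coeff_const > 0"
  using spec_rad_pos by (simp add: coeff_const_def zero_less_power_int)

lemma norm_coeff_eq: "norm_coeff n = coeff_const / (real n ^ (max_block M - 1) * spec_rad M ^ n)"
proof -
  have "int n - int (max_block M) + 1 = int n + (1 - int (max_block M))" by simp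
  then have "spec_rad M powi (int n - int (max_block M) + 1) =
      spec_rad M ^ n * spec_rad M powi (1 - int (max_block M))"
    using power_int_add[of "spec_rad M" "int n" "1 - int (max_block M)"] spec_rad_pos
    by (simp only: power_int_of_nat) simp
  then show ?thesis by (simp add: norm_coeff_def coeff_const_def)
qed

lemma norm_coeff_pos: "n > 0 \<Longrightarrow> norm_coeff n > 0"
  using spec_rad_pos coeff_const_pos by (simp add: norm_coeff_eq)

text \<open>The polynomial factor disappears from the ratio: going \<open>L\<close> levels further
  costs exactly \<open>\<rho> ^ L\<close> in the limit, with \<open>\<rho>\<close> the spectral
  radius. All powers of \<open>\<rho>\<close> in the estimates of masses come from here.\<close>

lemma norm_coeff_ratio: "(\<lambda>n. norm_coeff (n + L) / norm_coeff n) \<longlonglongrightarrow> 1 / spec_rad M ^ L"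
proof -
  have "(\<lambda>n. real n / (real n + real L)) \<longlonglongrightarrow> 1"
  proof -
    have "(\<lambda>n. 1 - real L * inverse (real (n + L))) \<longlonglongrightarrow> 1 - real L * 0"
      by (intro tendsto_diff tendsto_mult tendsto_const LIMSEQ_ignore_initial_segment[OF lim_inverse_n])
    moreover have "\<forall>\<^sub>F n in sequentially. 1 - real L * inverse (real (n + L)) = real n / (real n + real L)"
      using eventually_gt_at_top[of 0] by eventually_elim (simp add: field_simps)
    ultimately show ?thesis by (simp add: tendsto_cong)
  qed
  then have "(\<lambda>n. (real n / (real n + real L)) ^ (max_block M - 1) * (1 / spec_rad M ^ L)) \<longlonglongrightarrow>
      1 ^ (max_block M - 1) * (1 / spec_rad M ^ L)"
    by (intro tendsto_mult tendsto_power tendsto_const)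
  moreover have "\<forall>\<^sub>F n in sequentially. (real n / (real n + real L)) ^ (max_block M - 1) * (1 / spec_rad M ^ L)
      = norm_coeff (n + L) / norm_coeff n"
    using eventually_gt_at_top[of 0]
  proof eventually_elim
    case (elim n)
    then show ?case using spec_rad_pos coeff_const_pos
      by (simp add: norm_coeff_eq power_add power_divide)
  qed
  ultimately show ?thesis by (simp add: tendsto_cong)
qed

abbreviation inverse_phase :: "complex \<Rightarrow> complex" where
  "inverse_phase \<equiv> \<lambda>\<gamma>. inverse (phase_power M 1 \<gamma>)"

lemma phase_symmetric_inverse: "phase_symmetric M inverse_phase"
  using phase_symmetric_power[of M 1] by (simp add: phase_symmetric_def)

lemma rotation_power_gen:
  assumes h: "phase_symmetric M h" and w: "w \<in> gen_eigenspace M \<zeta>"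
  shows "complex_matrix (matrix_power (rotation S M h) n) *v w = multiplier h \<zeta> ^ n *s w"
  unfolding complex_matrix_power_apply
proof (induction n)
  case (Suc n)
  then show ?case
    by (simp add: vector_scalar_commute rotation_gen[OF h w] vector_smult_assoc mult.commute)
qed simp

lemma z_le: "j < CARD('d) \<Longrightarrow> cmod (z j) \<le> spec_rad M"
  using eigen spec_rad_eigenvalue_le by blast

text \<open>On the spectral circle the multiplier \<open>\<rho> / z j\<close> cancels the phase and
  leaves a binomial coefficient over \<open>n ^ (max_block M - 1)\<close>; the bound on blocks gives
  \<open>i \<le> max_block M - 1\<close>. Inside the circle geometric decay wins.\<close>

lemma term_convergent:
  assumes j: "j < CARD('d)" and i: "i < m j"
  shows "convergent (\<lambda>n. complex_of_real (norm_coeff n) * multiplier inverse_phase (z j) ^ n *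
    (of_nat (n choose i) * z j ^ (n - i)))"
proof (cases "cmod (z j) = spec_rad M")
  case True
  let ?\<rho> = "complex_of_real (spec_rad M)"
  have nz: "z j \<noteq> 0" "?\<rho> \<noteq> 0" using True spec_rad_pos by auto
  have t: "multiplier inverse_phase (z j) = ?\<rho> / z j"
    using True phase_of_z[OF j True] by (simp add: multiplier_def phase_power_def)
  have "i \<le> max_block M - 1" using i block[OF j True] by simp
  then have "convergent (\<lambda>n. real (n choose i) / real n ^ (max_block M - 1))"
    by (rule convergent_choose_ratio_le)
  then obtain l where "(\<lambda>n. real (n choose i) / real n ^ (max_block M - 1)) \<longlonglongrightarrow> l"
    by (auto simp: convergent_def)
  then have "(\<lambda>n. complex_of_real (coeff_const * (real (n choose i) / real n ^ (max_block M - 1))) * (1 / z j ^ i))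
      \<longlonglongrightarrow> complex_of_real (coeff_const * l) * (1 / z j ^ i)"
    by (intro tendsto_mult tendsto_of_real tendsto_const)
  moreover have "\<forall>\<^sub>F n in sequentially.
    complex_of_real (coeff_const * (real (n choose i) / real n ^ (max_block M - 1))) * (1 / z j ^ i) =
    complex_of_real (norm_coeff n) * multiplier inverse_phase (z j) ^ n * (of_nat (n choose i) * z j ^ (n - i))"
    using eventually_ge_at_top[of i]
  proof eventually_elim
    case (elim n)
    have "z j ^ (n - i) = z j ^ n / z j ^ i" using elim nz by (simp add: power_diff)
    then show ?case unfolding t norm_coeff_eq using nz by (simp add: power_divide)
  qed
  ultimately show ?thesis by (intro convergentI) (rule Lim_transform_eventually)
next
  case False
  then have lt: "cmod (z j) < spec_rad M" using z_le[OF j] by simp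
  have t: "multiplier inverse_phase (z j) = 1" using False by (simp add: multiplier_def)
  let ?x = "cmod (z j) / spec_rad M"
  have "(\<lambda>n. real (n choose i) * ?x ^ (n - i)) \<longlonglongrightarrow> 0"
    using lt spec_rad_pos by (intro choose_geometric_tendsto_0) auto
  then have lim: "(\<lambda>n. real (n choose i) * ?x ^ (n - i) * (coeff_const / spec_rad M ^ i)) \<longlonglongrightarrow> 0"
    by (rule tendsto_mult_left_zero)
  have "(\<lambda>n. complex_of_real (norm_coeff n) * multiplier inverse_phase (z j) ^ n *
    (of_nat (n choose i) * z j ^ (n - i))) \<longlonglongrightarrow> 0"
  proof (rule Lim_null_comparison[OF _ lim])
    show "\<forall>\<^sub>F n in sequentially. cmod (complex_of_real (norm_coeff n) * multiplier inverse_phase (z j) ^ n *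
      (of_nat (n choose i) * z j ^ (n - i))) \<le> real (n choose i) * ?x ^ (n - i) * (coeff_const / spec_rad M ^ i)"
      using eventually_ge_at_top[of "Suc i"]
    proof eventually_elim
      case (elim n)
      have c: "norm_coeff n \<le> coeff_const / spec_rad M ^ n"
      proof -
        have "1 \<le> real n ^ (max_block M - 1)" using elim by (intro one_le_power) simp
        then have "spec_rad M ^ n * 1 \<le> real n ^ (max_block M - 1) * spec_rad M ^ n"
          using spec_rad_pos by simp
        then show ?thesis unfolding norm_coeff_eq using coeff_const_pos spec_rad_pos
          using elim by (intro divide_left_mono mult_pos_pos zero_less_power) simp_all
      qed
      have c0: "norm_coeff n \<ge> 0" using norm_coeff_pos[of n] elim by simp
      have "cmod (complex_of_real (norm_coeff n) * multiplier inverse_phase (z j) ^ n *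
        (of_nat (n choose i) * z j ^ (n - i))) = norm_coeff n * (real (n choose i) * cmod (z j) ^ (n - i))"
        unfolding t using c0 by (simp add: norm_mult norm_power)
      also have "\<dots> \<le> coeff_const / spec_rad M ^ n * (real (n choose i) * cmod (z j) ^ (n - i))"
        using c by (intro mult_right_mono) auto
      also have "\<dots> = real (n choose i) * ?x ^ (n - i) * (coeff_const / spec_rad M ^ i)"
      proof -
        have "spec_rad M ^ n = spec_rad M ^ (n - i) * spec_rad M ^ i" using elim by (simp flip: power_add)
        then show ?thesis by (simp add: power_divide)
      qed
      finally show ?case .
    qed
  qed
  then show ?thesis by (rule convergentI)
qed

lemma limit_exists:
  "\<exists>P. (\<lambda>n. norm_coeff n *\<^sub>R (matrix_power (rotation S M inverse_phase) n ** matrix_power M n)) \<longlonglongrightarrow> P"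
proof -
  let ?X = "\<lambda>n. norm_coeff n *\<^sub>R (matrix_power (rotation S M inverse_phase) n ** matrix_power M n)"
  let ?\<alpha> = "\<lambda>j i n. complex_of_real (norm_coeff n) * multiplier inverse_phase (z j) ^ n *
    (of_nat (n choose i) * z j ^ (n - i))"
  have eq: "complex_matrix (?X n) *v b j = (\<Sum>i<m j. ?\<alpha> j i n *s (char_op M (z j) ^^ i) (b j))"
    if j: "j < CARD('d)" for n j
  proof -
    have "complex_matrix (?X n) *v b j = complex_of_real (norm_coeff n) *s
      (complex_matrix (matrix_power (rotation S M inverse_phase) n) *v (complex_matrix (matrix_power M n) *v b j))"
      by (simp only: complex_matrix_scaleR complex_matrix_mult matrix_vector_mul_assoc)
    also have "\<dots> = (complex_of_real (norm_coeff n) * multiplier inverse_phase (z j) ^ n) *s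
      (complex_matrix (matrix_power M n) *v b j)"
      by (simp only: rotation_power_gen[OF phase_symmetric_inverse gen_eigenspace_power[OF b_gen[OF j]]]
          vector_smult_assoc)
    also have "\<dots> = (\<Sum>i<m j. ?\<alpha> j i n *s (char_op M (z j) ^^ i) (b j))"
      unfolding power_on_chain[OF chain[OF j]] vec.scale_sum_right vector_smult_assoc ..
    finally show ?thesis .
  qed
  have "(\<lambda>n. complex_matrix (?X n) *v b j) \<longlonglongrightarrow> (\<Sum>i<m j. lim (?\<alpha> j i) *s (char_op M (z j) ^^ i) (b j))"
    if j: "j < CARD('d)" for j
    unfolding eq[OF j]
  proof (intro tendsto_sum tendsto_vector_scale tendsto_const)
    fix i assume "i \<in> {..<m j}"
    then have "i < m j" by simp
    from term_convergent[OF j this] show "?\<alpha> j i \<longlonglongrightarrow> lim (?\<alpha> j i)"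
      by (simp only: convergent_LIMSEQ_iff)
  qed
  from matrix_tendsto[of ?X, OF this] show ?thesis by blast
qed

definition peripheral_limit :: "real^'d^'d" where
  "peripheral_limit = lim (\<lambda>n. norm_coeff n *\<^sub>R (matrix_power (rotation S M inverse_phase) n ** matrix_power M n))"

lemma peripheral_limit:
  "(\<lambda>n. norm_coeff n *\<^sub>R (matrix_power (rotation S M inverse_phase) n ** matrix_power M n)) \<longlonglongrightarrow> peripheral_limit"
  unfolding peripheral_limit_def using limit_exists convergent_LIMSEQ_iff convergent_def by blast

text \<open>Rotating by the \<open>n\<close>-th power of the phases undoes \<open>n\<close>
  rotations by their inverses. Thus bare powers are recovered from the product whose normalised form
  converges.\<close>

lemma matrix_power_rotate:
  "matrix_power M n = rotation S M (phase_power M n) **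
    (matrix_power (rotation S M inverse_phase) n ** matrix_power M n)"
proof (rule matrix_eqI)
  fix j assume j: "j < CARD('d)"
  note g = gen_eigenspace_power[OF b_gen[OF j], of n]
  have 1: "multiplier (phase_power M n) (z j) * multiplier inverse_phase (z j) ^ n = 1"
  proof (cases "cmod (z j) = spec_rad M")
    case True
    have "z j \<noteq> 0" using True spec_rad_pos by auto
    then show ?thesis using True phase_of_z[OF j True] spec_rad_pos
      by (simp add: multiplier_def phase_power_def power_divide)
  qed (simp add: multiplier_def)
  have "complex_matrix (rotation S M (phase_power M n) **
      (matrix_power (rotation S M inverse_phase) n ** matrix_power M n)) *v b j
    = complex_matrix (rotation S M (phase_power M n)) *v
      (complex_matrix (matrix_power (rotation S M inverse_phase) n) *v (complex_matrix (matrix_power M n) *v b j))"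
    by (simp only: complex_matrix_mult matrix_vector_mul_assoc)
  also have "\<dots> = (multiplier inverse_phase (z j) ^ n * multiplier (phase_power M n) (z j)) *s
      (complex_matrix (matrix_power M n) *v b j)"
    by (simp only: rotation_power_gen[OF phase_symmetric_inverse g] vector_scalar_commute
        rotation_gen[OF phase_symmetric_power g] vector_smult_assoc)
  also have "\<dots> = complex_matrix (matrix_power M n) *v b j"
    using 1 by (simp add: mult.commute)
  finally show "complex_matrix (matrix_power M n) *v b j = complex_matrix (rotation S M (phase_power M n) **
      (matrix_power (rotation S M inverse_phase) n ** matrix_power M n)) *v b j" ..
qed

lemma rotation_tendsto:
  assumes "(\<lambda>j. phase_power M (n j)) \<longlonglongrightarrow> h"
  shows "(\<lambda>j. rotation S M (phase_power M (n j))) \<longlonglongrightarrow> rotation S M h"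
proof -
  have h: "phase_symmetric M h"
    using phase_symmetric_group[OF spec_rad_pos phase_power_limit_mem[OF assms]] .
  have "(\<lambda>i. complex_matrix (rotation S M (phase_power M (n i))) *v b j) \<longlonglongrightarrow> multiplier h (z j) *s b j"
    if j: "j < CARD('d)" for j
    unfolding rotation_gen[OF phase_symmetric_power b_gen[OF j]]
  proof (intro tendsto_vector_scale tendsto_const)
    show "(\<lambda>i. multiplier (phase_power M (n i)) (z j)) \<longlonglongrightarrow> multiplier h (z j)"
      using assms unfolding tendsto_fun_iff by (simp add: multiplier_def)
  qed
  from matrix_tendsto[OF this] obtain L where L: "(\<lambda>j. rotation S M (phase_power M (n j))) \<longlonglongrightarrow> L"
    "\<And>j. j < CARD('d) \<Longrightarrow> complex_matrix L *v b j = multiplier h (z j) *s b j" by blast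
  have "L = rotation S M h"
    by (rule matrix_eqI) (simp add: L(2) rotation_gen[OF h b_gen])
  then show ?thesis using L(1) by simp
qed

text \<open>Of the two factors in \<open>matrix_power_rotate\<close>, the rotation converges because
  it depends continuously on the phases, and the rest, once normalised, because the limit matrix
  exists. All oscillation of the powers sits in the first factor.\<close>

lemma normalized_power_tendsto:
  assumes "filterlim n at_top sequentially" "(\<lambda>j. phase_power M (n j)) \<longlonglongrightarrow> h"
  shows "(\<lambda>j. norm_coeff (n j) *\<^sub>R matrix_power M (n j)) \<longlonglongrightarrow> rotation S M h ** peripheral_limit"
proof -
  have "(\<lambda>j. rotation S M (phase_power M (n j)) **
      (norm_coeff (n j) *\<^sub>R (matrix_power (rotation S M inverse_phase) (n j) ** matrix_power M (n j))))
      \<longlonglongrightarrow> rotation S M h ** peripheral_limit"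
    by (intro tendsto_matrix_mult rotation_tendsto[OF assms(2)]
        filterlim_compose[OF peripheral_limit assms(1)])
  moreover have "rotation S M (phase_power M n) **
      (norm_coeff n *\<^sub>R (matrix_power (rotation S M inverse_phase) n ** matrix_power M n)) =
      norm_coeff n *\<^sub>R matrix_power M n" for n
    unfolding matrix_mult_scaleR matrix_power_rotate[of n, symmetric] ..
  ultimately show ?thesis by simp
qed

end

section \<open>Spectral radii\<close>

text \<open>Every term of the binomial expansion on a Jordan chain decays geometrically. It serves
  to exclude that the sum of the reduced matrices has a smaller spectral radius.\<close>

lemma normalized_power_tendsto_0:
  fixes M :: "real^'d^'d"
  assumes "spec_rad M < c" "c > 0"
  shows "(\<lambda>n. (1 / c ^ n) *\<^sub>R (matrix_power M n *v x)) \<longlonglongrightarrow> 0"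
proof -
  obtain b q z m where "jordan_basis M b q z m" using jordan_basis_exists[of M] by blast
  then interpret jordan_basis M b q z m .
  let ?X = "\<lambda>n. (1 / c ^ n) *\<^sub>R matrix_power M n"
  have "(\<lambda>n. complex_matrix (?X n) *v b j) \<longlonglongrightarrow> (\<Sum>i<m j. 0 *s (char_op M (z j) ^^ i) (b j))"
    if j: "j < CARD('d)" for j
  proof -
    have lt: "cmod (z j) < c" using spec_rad_eigenvalue_le[OF eigen[OF j]] assms by simp
    have eq: "complex_matrix (?X n) *v b j = (\<Sum>i<m j. (complex_of_real (1 / c ^ n) *
        (of_nat (n choose i) * z j ^ (n - i))) *s (char_op M (z j) ^^ i) (b j))" for n
      unfolding complex_matrix_scaleR power_on_chain[OF chain[OF j]] vec.scale_sum_right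
        vector_smult_assoc ..
    show ?thesis unfolding eq
    proof (intro tendsto_sum tendsto_vector_scale tendsto_const)
      fix i
      have "(\<lambda>n. real (n choose i) * (cmod (z j) / c) ^ (n - i)) \<longlonglongrightarrow> 0"
        using lt assms(2) by (intro choose_geometric_tendsto_0) auto
      then have lim: "(\<lambda>n. real (n choose i) * (cmod (z j) / c) ^ (n - i) * (1 / c ^ i)) \<longlonglongrightarrow> 0"
        by (rule tendsto_mult_left_zero)
      show "(\<lambda>n. complex_of_real (1 / c ^ n) * (of_nat (n choose i) * z j ^ (n - i))) \<longlonglongrightarrow> 0"
      proof (rule Lim_null_comparison[OF _ lim])
        show "\<forall>\<^sub>F n in sequentially. cmod (complex_of_real (1 / c ^ n) * (of_nat (n choose i) * z j ^ (n - i)))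
            \<le> real (n choose i) * (cmod (z j) / c) ^ (n - i) * (1 / c ^ i)"
          using eventually_ge_at_top[of i]
        proof eventually_elim
          case (elim n)
          have "c ^ n = c ^ (n - i) * c ^ i" using elim by (simp flip: power_add)
          then show ?case using assms(2) by (simp add: norm_mult norm_power norm_divide power_divide)
        qed
      qed
    qed
  qed
  from matrix_tendsto[of ?X, OF this] obtain L where L: "?X \<longlonglongrightarrow> L"
    "\<And>j. j < CARD('d) \<Longrightarrow> complex_matrix L *v b j = (\<Sum>i<m j. 0 *s (char_op M (z j) ^^ i) (b j))"
    by blast
  have "complex_matrix 0 *v w = 0" for w :: "complex^'d"
    by (simp add: complex_matrix_def matrix_vector_mult_def Finite_Cartesian_Product.vec_eq_iff)
  then have "L = 0" by (intro matrix_eqI) (simp add: L(2))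
  then have "(\<lambda>n. ?X n *v x) \<longlonglongrightarrow> 0 *v x" using tendsto_matrix_vector_mult[OF L(1)] by simp
  then show ?thesis by (simp add: scaleR_matrix_vector_assoc)
qed

section \<open>The joint spectral radius\<close>

text \<open>Fekete's lemma in multiplicative form, with the limit \<open>l\<close> as the infimum
  over \<open>n \<ge> 1\<close>. No logarithms are taken, as \<open>a\<close> may have
  zeros.\<close>

lemma submultiplicative_root_limit:
  fixes a :: "nat \<Rightarrow> real"
  assumes nonneg: "\<And>n. a n \<ge> 0" and submult: "\<And>m n. a (m + n) \<le> a m * a n"
  obtains l where "(\<lambda>n. a n powr (1 / real n)) \<longlonglongrightarrow> l"
    "\<And>n. n \<ge> 1 \<Longrightarrow> l \<le> a n powr (1 / real n)"
proof -
  let ?r = "\<lambda>n. a n powr (1 / real n)"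
  define l where "l = (INF n\<in>{1..}. ?r n)"
  have bdd: "bdd_below (?r ` {1..})" by (rule bdd_belowI[of _ 0]) auto
  have lower: "l \<le> ?r n" if "n \<ge> 1" for n unfolding l_def using that by (intro cINF_lower bdd) auto
  have l0: "l \<ge> 0" unfolding l_def by (intro cINF_greatest) auto
  have "?r \<longlonglongrightarrow> l"
  proof (rule LIMSEQ_I)
    fix \<epsilon> :: real assume e: "\<epsilon> > 0"
    define c where "c = l + \<epsilon> / 2"
    have c: "c > 0" using l0 e by (simp add: c_def)
    have "l < c" using e by (simp add: c_def)
    then obtain m where m: "m \<ge> 1" "?r m < c"
      unfolding l_def using cINF_less_iff[OF _ bdd] by auto
    have am: "a m \<le> c ^ m"
    proof (cases "a m = 0")
      case False
      then have "a m = ?r m powr real m" using nonneg[of m] m by (simp add: powr_powr)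
      also have "\<dots> \<le> c powr real m" using m by (intro powr_mono2) auto
      finally show ?thesis using c by (simp add: powr_realpow)
    qed (use c in simp)
    have mult: "a (i * m + r) \<le> c ^ (i * m) * a r" for i r
    proof (induction i)
      case (Suc i)
      have "a (Suc i * m + r) \<le> a m * a (i * m + r)" using submult[of m "i * m + r"] by (simp add: ac_simps)
      also have "\<dots> \<le> c ^ m * (c ^ (i * m) * a r)" using Suc am nonneg c by (intro mult_mono) auto
      finally show ?case by (simp add: power_add ac_simps)
    qed simp
    \<comment> \<open>Absorbs the contribution of every remainder \<open>n mod m\<close>; the
      summand 1 makes it positive, so that \<open>K powr (1 / n)\<close> tends to 1.\<close>
    define K where "K = (\<Sum>r<m. a r / c ^ r) + 1"
    have K: "K > 0" unfolding K_def using nonneg c by (intro add_nonneg_pos sum_nonneg) auto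
    have bound: "a n \<le> K * c ^ n" for n
    proof -
      have r: "n mod m < m" using m by simp
      have "a n \<le> c ^ (n div m * m) * a (n mod m)" using mult[of "n div m" "n mod m"] by simp
      also have "\<dots> = c ^ n * (a (n mod m) / c ^ (n mod m))"
      proof -
        have "c ^ n = c ^ (n div m * m) * c ^ (n mod m)" by (simp flip: power_add)
        then show ?thesis using c by simp
      qed
      also have "\<dots> \<le> c ^ n * K"
      proof (intro mult_left_mono)
        have "a (n mod m) / c ^ (n mod m) \<le> (\<Sum>r<m. a r / c ^ r)"
          using r nonneg c by (intro member_le_sum) auto
        then show "a (n mod m) / c ^ (n mod m) \<le> K" by (simp add: K_def)
      qed (use c in simp)
      finally show ?thesis by (simp add: mult.commute)
    qed
    have "(\<lambda>n. K powr (1 / real n) * c) \<longlonglongrightarrow> K powr 0 * c"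
      using K by (intro tendsto_mult tendsto_powr tendsto_const lim_1_over_n) auto
    then have "(\<lambda>n. K powr (1 / real n) * c) \<longlonglongrightarrow> c" using K by simp
    moreover have "c < l + \<epsilon>" using e by (simp add: c_def)
    ultimately have "\<forall>\<^sub>F n in sequentially. K powr (1 / real n) * c < l + \<epsilon>" by (rule order_tendstoD(2))
    then obtain N where N: "\<And>n. n \<ge> N \<Longrightarrow> K powr (1 / real n) * c < l + \<epsilon>"
      by (auto simp: eventually_sequentially)
    have "norm (?r n - l) < \<epsilon>" if n: "n \<ge> N + 1" for n
    proof -
      have "?r n \<le> (K * c ^ n) powr (1 / real n)" using bound nonneg by (intro powr_mono2) auto
      also have "\<dots> = K powr (1 / real n) * c"
        using K c n by (simp add: powr_mult powr_realpow[symmetric] powr_powr)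
      also have "\<dots> < l + \<epsilon>" using N n by simp
      finally show ?thesis using lower[of n] n by simp
    qed
    then show "\<exists>no. \<forall>n\<ge>no. norm (?r n - l) < \<epsilon>" by blast
  qed
  then show thesis using lower by (rule that)
qed

abbreviation words :: "nat \<Rightarrow> nat \<Rightarrow> nat list set" where
  "words k n \<equiv> {w. set w \<subseteq> {..<k} \<and> length w = n}"

definition word_prod :: "(nat \<Rightarrow> real^'d^'d) \<Rightarrow> nat list \<Rightarrow> real^'d^'d" where
  "word_prod B w = foldr (**) (map B w) (Finite_Cartesian_Product.mat 1)"

lemma word_prod_Nil: "word_prod B [] = Finite_Cartesian_Product.mat 1"
  and word_prod_Cons: "word_prod B (i # w) = B i ** word_prod B w"
  by (simp_all add: word_prod_def)

lemma word_prod_append: "word_prod B (v @ w) = word_prod B v ** word_prod B w"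
  by (induction v) (simp_all add: word_prod_Nil word_prod_Cons matrix_mul_assoc)

definition word_norm :: "nat \<Rightarrow> (nat \<Rightarrow> real^'d^'d) \<Rightarrow> nat \<Rightarrow> real" where
  "word_norm k B n = Max ((\<lambda>w. onorm ((*v) (word_prod B w))) ` words k n)"

lemma finite_words: "finite (words k n)"
  using finite_lists_length_eq[of "{..<k}" n] by simp

lemma words_nonempty: "k > 0 \<Longrightarrow> words k n \<noteq> {}"
  by (rule ex_in_conv[THEN iffD1], rule exI[of _ "replicate n 0"]) auto

lemma word_norm_ge: "w \<in> words k n \<Longrightarrow> onorm ((*v) (word_prod B w)) \<le> word_norm k B n"
  unfolding word_norm_def by (intro Max_ge finite_imageI finite_words imageI)

lemma word_norm_attained:
  assumes "k > 0"
  obtains w where "w \<in> words k n" "word_norm k B n = onorm ((*v) (word_prod B w))"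
proof -
  have "word_norm k B n \<in> (\<lambda>w. onorm ((*v) (word_prod B w))) ` words k n"
    unfolding word_norm_def using words_nonempty[OF assms] finite_words by (intro Max_in) auto
  then show thesis using that by blast
qed

lemma onorm_matrix_nonneg: "0 \<le> onorm ((*v) (X :: real^'d^'d))"
  by (intro onorm_pos_le matrix_vector_mul_bounded_linear)

lemma word_norm_submult:
  assumes "k > 0"
  shows "word_norm k B (m + n) \<le> word_norm k B m * word_norm k B n"
proof -
  obtain w where w: "w \<in> words k (m + n)" "word_norm k B (m + n) = onorm ((*v) (word_prod B w))"
    using word_norm_attained[OF assms] .
  let ?u = "take m w" and ?v = "drop m w"
  have uv: "?u \<in> words k m" "?v \<in> words k n"
    using w(1) set_take_subset[of m w] set_drop_subset[of m w] by auto
  have "word_norm k B (m + n) = onorm ((*v) (word_prod B (?u @ ?v)))" using w(2) by simp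
  also have "\<dots> = onorm ((*v) (word_prod B ?u) \<circ> (*v) (word_prod B ?v))"
    unfolding word_prod_append by (simp add: o_def matrix_vector_mul_assoc)
  also have "\<dots> \<le> onorm ((*v) (word_prod B ?u)) * onorm ((*v) (word_prod B ?v))"
    by (intro onorm_compose matrix_vector_mul_bounded_linear)
  also have "\<dots> \<le> word_norm k B m * word_norm k B n"
    by (intro mult_mono word_norm_ge uv onorm_matrix_nonneg order_trans[OF onorm_matrix_nonneg word_norm_ge[OF uv(1)]])
  finally show ?thesis .
qed

lemma word_norm_nonneg: "k > 0 \<Longrightarrow> 0 \<le> word_norm k B n"
  using word_norm_attained[of k n B] onorm_matrix_nonneg by metis

lemma joint_spectral_radius_limit:
  assumes "k > 0"
  shows "(\<lambda>n. word_norm k B n powr (1 / real n)) \<longlonglongrightarrow> joint_spectral_radius k B"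
    and "n \<ge> 1 \<Longrightarrow> joint_spectral_radius k B \<le> word_norm k B n powr (1 / real n)"
proof -
  obtain l where l: "(\<lambda>n. word_norm k B n powr (1 / real n)) \<longlonglongrightarrow> l"
    "\<And>n. n \<ge> 1 \<Longrightarrow> l \<le> word_norm k B n powr (1 / real n)"
    using submultiplicative_root_limit[of "word_norm k B", OF word_norm_nonneg[OF assms] word_norm_submult[OF assms]]
    by metis
  \<comment> \<open>By monotonicity the root may be taken after the maximum, which brings the
    definition into the form of Fekete's lemma.\<close>
  have "Max ((\<lambda>w. onorm ((*v) (word_prod B w)) powr (1 / real n)) ` words k n) = word_norm k B n powr (1 / real n)" for n
  proof (rule Max_eqI)
    fix y assume "y \<in> (\<lambda>w. onorm ((*v) (word_prod B w)) powr (1 / real n)) ` words k n"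
    then obtain w where w: "w \<in> words k n" "y = onorm ((*v) (word_prod B w)) powr (1 / real n)" by blast
    show "y \<le> word_norm k B n powr (1 / real n)"
      unfolding w(2) by (intro powr_mono2 word_norm_ge w(1) onorm_matrix_nonneg) auto
  next
    obtain w where w: "w \<in> words k n" "word_norm k B n = onorm ((*v) (word_prod B w))"
      using word_norm_attained[OF assms] .
    then show "word_norm k B n powr (1 / real n) \<in> (\<lambda>w. onorm ((*v) (word_prod B w)) powr (1 / real n)) ` words k n"
      by (metis (no_types, lifting) imageI)
  qed (intro finite_imageI finite_words)
  then have "joint_spectral_radius k B = lim (\<lambda>n. word_norm k B n powr (1 / real n))"
    unfolding joint_spectral_radius_def word_prod_def[symmetric] by simp
  also have "\<dots> = l" using l(1) by (rule limI)
  finally show "(\<lambda>n. word_norm k B n powr (1 / real n)) \<longlonglongrightarrow> joint_spectral_radius k B"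
    "n \<ge> 1 \<Longrightarrow> joint_spectral_radius k B \<le> word_norm k B n powr (1 / real n)"
    using l by simp_all
qed

lemma joint_spectral_radius_lessD:
  assumes "k > 0" "joint_spectral_radius k B < c" "c > 0"
  shows "\<forall>\<^sub>F n in sequentially. word_norm k B n \<le> c ^ n"
  using order_tendstoD(2)[OF joint_spectral_radius_limit(1)[OF assms(1)] assms(2)] eventually_gt_at_top[of 0]
proof eventually_elim
  case (elim n)
  show ?case
  proof (cases "word_norm k B n = 0")
    case False
    then have "word_norm k B n = (word_norm k B n powr (1 / real n)) powr real n"
      using word_norm_nonneg[OF assms(1), of B n] elim by (simp add: powr_powr)
    also have "\<dots> \<le> c powr real n" using elim by (intro powr_mono2) auto
    finally show ?thesis using assms by (simp add: powr_realpow)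
  qed (use assms in simp)
qed

text \<open>A single length suffices because the limit of the roots is also their infimum.\<close>

lemma joint_spectral_radius_lessI:
  assumes "k > 0" "c > 0" "n \<ge> 1" "word_norm k B n < c ^ n"
  shows "joint_spectral_radius k B < c"
proof -
  have "joint_spectral_radius k B \<le> word_norm k B n powr (1 / real n)"
    using joint_spectral_radius_limit(2)[OF assms(1,3)] .
  also have "\<dots> < (c ^ n) powr (1 / real n)"
    using assms word_norm_nonneg[OF assms(1)] by (intro powr_less_mono2) auto
  also have "\<dots> = c" using assms by (simp add: powr_realpow[symmetric] powr_powr)
  finally show ?thesis .
qed

section \<open>Probability measures on the circle\<close>

definition periodic_continuous :: "(real \<Rightarrow> real) \<Rightarrow> bool" where
  "periodic_continuous \<phi> \<longleftrightarrow> continuous_on UNIV \<phi> \<and> (\<forall>x. \<phi> (x + 1) = \<phi> x)"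

lemma weak_limit_circle_iff:
  "weak_limit_circle M \<mu> \<longleftrightarrow>
    (\<forall>\<phi>. periodic_continuous \<phi> \<longrightarrow> (\<lambda>j. \<integral>x. \<phi> x \<partial>M j) \<longlonglongrightarrow> (\<integral>x. \<phi> x \<partial>\<mu>))"
  by (simp add: weak_limit_circle_def periodic_continuous_def)

definition circle_prob :: "real measure \<Rightarrow> bool" where
  "circle_prob \<mu> \<longleftrightarrow> prob_space \<mu> \<and> sets \<mu> = sets circle"

lemma space_circle: "space circle = {0..<1}"
  by (simp add: circle_def space_restrict_space)

lemma sets_circle_iff: "A \<in> sets circle \<longleftrightarrow> A \<in> sets borel \<and> A \<subseteq> {0..<1}"
  by (auto simp: circle_def sets_restrict_space_iff)

lemma circle_prob_space: "circle_prob \<mu> \<Longrightarrow> space \<mu> = {0..<1}"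
  using sets_eq_imp_space_eq[of \<mu> circle] by (simp add: circle_prob_def space_circle)

lemma borel_measurable_circle:
  fixes \<phi> :: "real \<Rightarrow> real"
  assumes "circle_prob \<mu>" "\<phi> \<in> borel_measurable borel"
  shows "\<phi> \<in> borel_measurable \<mu>"
proof -
  have m: "\<phi> \<in> borel_measurable circle"
    using assms(2) unfolding circle_def by (rule measurable_restrict_space1)
  have eq: "sets \<mu> = sets circle" using assms(1) by (simp add: circle_prob_def)
  show ?thesis unfolding measurable_cong_sets[OF eq refl] by (rule m)
qed

section \<open>Periodic test functions\<close>

lemma periodic_add_int:
  assumes "\<And>x. \<phi> (x + 1) = \<phi> (x :: real)"
  shows "\<phi> (x + of_int n) = \<phi> x"
proof -
  have nat: "\<phi> (y + real m) = \<phi> y" for y m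
  proof (induction m)
    case (Suc m)
    have "\<phi> (y + real (Suc m)) = \<phi> (y + real m + 1)" by (simp add: ac_simps)
    then show ?case using assms[of "y + real m"] Suc by simp
  qed simp
  show ?thesis
  proof (cases "n \<ge> 0")
    case True
    then show ?thesis using nat[of x "nat n"] by simp
  next
    case False
    then show ?thesis using nat[of "x + of_int n" "nat (- n)"] by simp
  qed
qed

lemma periodic_continuous_frac:
  assumes "periodic_continuous \<phi>"
  shows "\<phi> (frac x) = \<phi> x"
proof -
  have "\<phi> (frac x + of_int \<lfloor>x\<rfloor>) = \<phi> (frac x)"
    using assms by (intro periodic_add_int) (simp add: periodic_continuous_def)
  then show ?thesis by (simp add: frac_def)
qed

lemma periodic_continuous_bounded:
  assumes "periodic_continuous \<phi>"
  obtains B where "B > 0" "\<And>x. \<bar>\<phi> x\<bar> \<le> B"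
proof -
  have "continuous_on {0..1} \<phi>"
    using assms continuous_on_subset[of UNIV \<phi> "{0..1}"] by (simp add: periodic_continuous_def)
  then have "bounded (\<phi> ` {0..1})"
    by (intro compact_imp_bounded compact_continuous_image compact_Icc)
  then have "\<exists>B>0. \<forall>y\<in>\<phi> ` {0..1}. norm y \<le> B" by (simp only: bounded_pos)
  then obtain B where B: "B > 0" "\<forall>y\<in>\<phi> ` {0..1}. norm y \<le> B" by blast
  have "\<bar>\<phi> x\<bar> \<le> B" for x
  proof -
    have "frac x \<in> {0..1}" using frac_ge_0[of x] frac_lt_1[of x] by simp
    from B(2)[rule_format, OF imageI[OF this]] show ?thesis using periodic_continuous_frac[OF assms, of x] by simp
  qed
  with B(1) show thesis by (rule that)
qed

lemma periodic_continuous_measurable: "periodic_continuous \<phi> \<Longrightarrow> \<phi> \<in> borel_measurable borel"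
  by (simp add: periodic_continuous_def borel_measurable_continuous_onI)

lemma periodic_continuous_integrable:
  assumes "circle_prob \<mu>" "periodic_continuous \<phi>"
  shows "integrable \<mu> \<phi>"
proof -
  interpret prob_space \<mu> using assms by (simp add: circle_prob_def)
  obtain B where B: "B > 0" "\<And>x. \<bar>\<phi> x\<bar> \<le> B" by (rule periodic_continuous_bounded[OF assms(2)]) (rule that)
  have "AE x in \<mu>. norm (\<phi> x) \<le> B" by (rule AE_I2) (simp add: B(2))
  then show ?thesis
    using borel_measurable_circle[OF assms(1) periodic_continuous_measurable[OF assms(2)]]
    by (rule integrable_const_bound)
qed

text \<open>Equal to 1 where \<open>q \<ge> 0\<close> and, for positive \<open>n\<close>, to 0 where
  \<open>q \<le> - 1 / n\<close>: as \<open>n\<close> grows, these functions decrease to the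
  indicator of the set where \<open>q\<close> is nonnegative.\<close>

definition cutoff :: "(real \<Rightarrow> real) \<Rightarrow> nat \<Rightarrow> real \<Rightarrow> real" where
  "cutoff q n x = max 0 (1 - real n * max 0 (- q x))"

lemma cutoff_bounds: "0 \<le> cutoff q n x" "cutoff q n x \<le> 1"
  by (simp_all add: cutoff_def)

lemma periodic_continuous_cutoff: "periodic_continuous q \<Longrightarrow> periodic_continuous (cutoff q n)"
  unfolding periodic_continuous_def cutoff_def
  by (simp add: continuous_on_max continuous_on_diff continuous_on_mult continuous_on_minus)

lemma cutoff_integral_tendsto:
  assumes "circle_prob \<mu>" "periodic_continuous q"
  shows "(\<lambda>n. \<integral>x. cutoff q n x \<partial>\<mu>) \<longlonglongrightarrow> measure \<mu> {x \<in> {0..<1}. q x \<ge> 0}"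
proof -
  interpret prob_space \<mu> using assms by (simp add: circle_prob_def)
  let ?A = "{x \<in> {0..<1}. q x \<ge> 0}"
  have sp: "space \<mu> = {0..<1}" by (rule circle_prob_space[OF assms(1)])
  have [measurable]: "q \<in> borel_measurable \<mu>"
    by (rule borel_measurable_circle[OF assms(1) periodic_continuous_measurable[OF assms(2)]])
  have A: "?A \<in> sets \<mu>" unfolding sp[symmetric] by measurable
  have "(\<lambda>n. \<integral>x. cutoff q n x \<partial>\<mu>) \<longlonglongrightarrow> (\<integral>x. indicator ?A x \<partial>\<mu>)"
  proof (rule integral_dominated_convergence[where w = "\<lambda>_. 1"])
    show "(\<lambda>x. indicator ?A x :: real) \<in> borel_measurable \<mu>" using A by simp
    show "cutoff q n \<in> borel_measurable \<mu>" for n unfolding cutoff_def by measurable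
    show "integrable \<mu> (\<lambda>_. 1 :: real)" by simp
    show "AE x in \<mu>. norm (cutoff q n x) \<le> 1" for n using cutoff_bounds[of q n] by simp
    show "AE x in \<mu>. (\<lambda>n. cutoff q n x) \<longlonglongrightarrow> indicator ?A x"
    proof (rule AE_I2)
      fix x assume x: "x \<in> space \<mu>"
      show "(\<lambda>n. cutoff q n x) \<longlonglongrightarrow> indicator ?A x"
      proof (cases "q x \<ge> 0")
        case True
        then show ?thesis using x sp by (simp add: cutoff_def)
      next
        case False
        obtain N where N: "1 / (- q x) < real N" using reals_Archimedean2 by blast
        have "cutoff q n x = 0" if "n \<ge> N" for n
        proof -
          have "1 / (- q x) < real n" using N that by (meson le_less_trans of_nat_le_iff order_less_le_trans)
          then have "1 < real n * (- q x)" using False by (simp add: field_simps)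
          then show ?thesis using False by (simp add: cutoff_def)
        qed
        then have "\<forall>\<^sub>F n in sequentially. cutoff q n x = 0" by (rule eventually_sequentiallyI)
        then show ?thesis using False by (simp add: tendsto_eventually)
      qed
    qed
  qed
  then show ?thesis using A by simp
qed

text \<open>The image on the whole line has the same integrals, and distribution functions and
  tightness are available for it.\<close>

lemma circle_prob_distr:
  fixes \<phi> :: "real \<Rightarrow> real"
  assumes "circle_prob \<mu>"
  shows "real_distribution (distr \<mu> borel (\<lambda>x. x))"
    "A \<in> sets borel \<Longrightarrow> emeasure (distr \<mu> borel (\<lambda>x. x)) A = emeasure \<mu> (A \<inter> {0..<1})"
    "\<phi> \<in> borel_measurable borel \<Longrightarrow> (\<integral>x. \<phi> x \<partial>distr \<mu> borel (\<lambda>x. x)) = (\<integral>x. \<phi> x \<partial>\<mu>)"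
proof -
  interpret prob_space \<mu> using assms by (simp add: circle_prob_def)
  have m: "(\<lambda>x. x) \<in> borel_measurable \<mu>" by (rule borel_measurable_circle[OF assms]) simp
  show "real_distribution (distr \<mu> borel (\<lambda>x. x))" by (rule real_distribution_distr[OF m])
  show "A \<in> sets borel \<Longrightarrow> emeasure (distr \<mu> borel (\<lambda>x. x)) A = emeasure \<mu> (A \<inter> {0..<1})"
    using m by (simp add: emeasure_distr circle_prob_space[OF assms])
  show "\<phi> \<in> borel_measurable borel \<Longrightarrow> (\<integral>x. \<phi> x \<partial>distr \<mu> borel (\<lambda>x. x)) = (\<integral>x. \<phi> x \<partial>\<mu>)"
    by (rule integral_distr[OF m])
qed

text \<open>For \<open>0 \<le> a < 1\<close> the arc \<open>[0, a]\<close> is the set where \<open>cos (2 \<pi> (x - a / 2))\<close> is at least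
  \<open>cos (\<pi> a)\<close>.\<close>

lemma arc_cos:
  assumes "0 \<le> a" "a < 1" "0 \<le> x" "x < 1"
  shows "cos (2 * pi * (x - a / 2)) - cos (pi * a) \<ge> 0 \<longleftrightarrow> x \<le> a"
proof -
  have mono: "cos (2 * pi * s) \<le> cos (2 * pi * t) \<longleftrightarrow> t \<le> s" if "0 \<le> t" "t \<le> 1/2" "0 \<le> s" "s \<le> 1/2" for s t
    using cos_mono_le_eq[of "2 * pi * s" "2 * pi * t"] that by (auto simp: field_simps)
  define t where "t = x - a / 2"
  have 0: "cos (pi * a) = cos (2 * pi * (a / 2))" by simp
  \<comment> \<open>Each case folds \<open>t\<close> by symmetry or periodicity into
    \<open>[0, 1/2]\<close>, where \<open>cos (2 * pi * t)\<close> decreases.\<close>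
  consider "t < 0" | "0 \<le> t" "t \<le> 1/2" | "t > 1/2" by linarith
  then show ?thesis
  proof cases
    case 1
    have "cos (2 * pi * t) = cos (2 * pi * (- t))" by (metis cos_minus mult_minus_right)
    then show ?thesis using mono[of "- t" "a/2"] assms 1 unfolding t_def[symmetric] 0 by (auto simp: t_def)
  next
    case 2
    then show ?thesis using mono[of t "a/2"] assms unfolding t_def[symmetric] 0 by (auto simp: t_def)
  next
    case 3
    have "cos (2 * pi * t) = cos (2 * pi * (1 - t))"
    proof -
      have "cos (2 * pi * (1 - t)) = cos (2 * pi - 2 * pi * t)" by (simp add: algebra_simps)
      then show ?thesis by simp
    qed
    then show ?thesis using mono[of "1 - t" "a/2"] assms 3 unfolding t_def[symmetric] 0 by (auto simp: t_def)
  qed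
qed

lemma periodic_continuous_cos: "periodic_continuous (\<lambda>x. cos (2 * pi * (x - c)) - d)"
proof -
  have "cos (2 * pi * (x + 1 - c)) = cos (2 * pi * (x - c))" for x
    using cos_periodic[of "2 * pi * (x - c)"] by (simp add: algebra_simps)
  then show ?thesis unfolding periodic_continuous_def by (intro conjI continuous_intros) auto
qed

text \<open>Test functions are periodic, so half-lines are replaced by arcs \<open>[0, a]\<close>.
  These are superlevel sets of a shifted cosine, and the cutoffs of that cosine are admissible test
  functions; the measures of arcs determine the distribution function.\<close>

lemma circle_prob_eqI:
  assumes \<mu>: "circle_prob \<mu>" and \<nu>: "circle_prob \<nu>"
    and eq: "\<And>\<phi>. periodic_continuous \<phi> \<Longrightarrow> (\<integral>x. \<phi> x \<partial>\<mu>) = (\<integral>x. \<phi> x \<partial>\<nu>)"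
  shows "\<mu> = \<nu>"
proof -
  have arc: "emeasure \<mu> ({..a} \<inter> {0..<1}) = emeasure \<nu> ({..a} \<inter> {0..<1})" for a
  proof -
    consider "a < 0" | "a \<ge> 1" | "0 \<le> a" "a < 1" by linarith
    then show ?thesis
    proof cases
      case 1
      then have "{..a} \<inter> {0..<1} = {}" by auto
      then show ?thesis by simp
    next
      case 2
      then have "{..a} \<inter> {0..<1} = {0..<1}" by auto
      then show ?thesis
        using prob_space.emeasure_space_1[of \<mu>] prob_space.emeasure_space_1[of \<nu>] \<mu> \<nu>
        by (simp add: circle_prob_space[symmetric] circle_prob_def) (metis \<mu> \<nu> circle_prob_space)
    next
      case 3
      let ?q = "\<lambda>x. cos (2 * pi * (x - a / 2)) - cos (pi * a)"
      have pc: "periodic_continuous ?q" by (rule periodic_continuous_cos)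
      have set: "{x \<in> {0..<1}. ?q x \<ge> 0} = {..a} \<inter> {0..<1}"
      proof (intro Set.set_eqI iffI)
        fix x assume "x \<in> {x \<in> {0..<1}. ?q x \<ge> 0}"
        then show "x \<in> {..a} \<inter> {0..<1}" using arc_cos[OF 3, of x] by simp
      next
        fix x assume "x \<in> {..a} \<inter> {0..<1}"
        then show "x \<in> {x \<in> {0..<1}. ?q x \<ge> 0}" using arc_cos[OF 3, of x] by simp
      qed
      have "(\<lambda>n. \<integral>x. cutoff ?q n x \<partial>\<mu>) \<longlonglongrightarrow> measure \<mu> ({..a} \<inter> {0..<1})"
        using cutoff_integral_tendsto[OF \<mu> pc] unfolding set .
      moreover have "(\<lambda>n. \<integral>x. cutoff ?q n x \<partial>\<mu>) \<longlonglongrightarrow> measure \<nu> ({..a} \<inter> {0..<1})"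
        using cutoff_integral_tendsto[OF \<nu> pc] unfolding set eq[OF periodic_continuous_cutoff[OF pc]] .
      ultimately have "measure \<mu> ({..a} \<inter> {0..<1}) = measure \<nu> ({..a} \<inter> {0..<1})"
        by (rule LIMSEQ_unique)
      then show ?thesis
        using \<mu> \<nu> by (simp add: finite_measure.emeasure_eq_measure prob_space.finite_measure circle_prob_def)
    qed
  qed
  let ?D = "\<lambda>\<mu>. distr \<mu> borel (\<lambda>x::real. x)"
  have "?D \<mu> = ?D \<nu>"
  proof (rule cdf_unique[OF circle_prob_distr(1)[OF \<mu>] circle_prob_distr(1)[OF \<nu>]])
    show "cdf (?D \<mu>) = cdf (?D \<nu>)"
      unfolding cdf_def measure_def
      using circle_prob_distr(2)[OF \<mu>] circle_prob_distr(2)[OF \<nu>] arc by simp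
  qed
  show ?thesis
  proof (rule measure_eqI)
    show "sets \<mu> = sets \<nu>" using \<mu> \<nu> by (simp add: circle_prob_def)
    fix A assume "A \<in> sets \<mu>"
    then have A: "A \<in> sets borel" "A \<subseteq> {0..<1}" using \<mu> by (simp_all add: circle_prob_def sets_circle_iff)
    then have "A \<inter> {0..<1} = A" by auto
    then show "emeasure \<mu> A = emeasure \<nu> A"
      using circle_prob_distr(2)[OF \<mu> A(1)] circle_prob_distr(2)[OF \<nu> A(1)] \<open>?D \<mu> = ?D \<nu>\<close> by simp
  qed
qed

text \<open>Tightness is automatic, all mass lying in \<open>[0, 1)\<close>. The weak limit on the
  line may charge the point 1; its image under \<open>frac\<close> moves that mass to 0, which
  periodic functions do not notice.\<close>

lemma circle_prob_convergent_subsequence: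
  assumes M: "\<And>j. circle_prob (M j)"
  obtains s \<mu> where "strict_mono (s :: nat \<Rightarrow> nat)" "circle_prob \<mu>" "weak_limit_circle (\<lambda>j. M (s j)) \<mu>"
proof -
  let ?D = "\<lambda>\<mu>. distr \<mu> borel (\<lambda>x::real. x)"
  have "tight (\<lambda>j. ?D (M j))"
    unfolding tight_def
  proof (intro conjI allI impI)
    show "real_distribution (?D (M n))" for n by (rule circle_prob_distr(1)[OF M])
    fix \<epsilon> :: real assume e: "\<epsilon> > 0"
    have "measure (?D (M n)) {-1<..1} > 1 - \<epsilon>" for n
    proof -
      have "{-1<..1} \<inter> {0..<1} = space (M n)" using circle_prob_space[OF M] by auto
      then have "emeasure (?D (M n)) {-1<..1} = 1"
        using circle_prob_distr(2)[OF M[of n], of "{-1<..1}"] prob_space.emeasure_space_1[of "M n"] M[of n]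
        by (simp add: circle_prob_def)
      then show ?thesis using e by (simp add: measure_def)
    qed
    then show "\<exists>a b. a < b \<and> (\<forall>n. measure (?D (M n)) {a<..b} > 1 - \<epsilon>)"
      by (intro exI[of _ "-1"] exI[of _ 1]) simp
  qed
  from tight_imp_convergent_subsubsequence[OF this strict_mono_id]
  obtain s L where s: "strict_mono s" "real_distribution L" "weak_conv_m ((\<lambda>j. ?D (M j)) \<circ> id \<circ> s) L"
    by blast
  interpret L: real_distribution L by (rule s(2))
  define \<mu> where "\<mu> = distr L circle frac"
  have "frac \<in> borel_measurable L" unfolding frac_def[abs_def] by measurable
  then have frac_m: "frac \<in> measurable L circle"
    unfolding circle_def using frac_ge_0 frac_lt_1 by (intro measurable_restrict_space2) auto
  have \<mu>: "circle_prob \<mu>"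
    using L.prob_space_distr[OF frac_m] by (simp add: circle_prob_def \<mu>_def)
  have "weak_limit_circle (\<lambda>j. M (s j)) \<mu>"
    unfolding weak_limit_circle_iff
  proof (intro allI impI)
    fix \<phi> :: "real \<Rightarrow> real" assume pc: "periodic_continuous \<phi>"
    obtain B where B: "B > 0" "\<And>x. \<bar>\<phi> x\<bar> \<le> B" by (rule periodic_continuous_bounded[OF pc]) (rule that)
    have m: "\<phi> \<in> borel_measurable borel" by (rule periodic_continuous_measurable[OF pc])
    have "(\<lambda>n. \<integral>x. \<phi> x \<partial>((\<lambda>j. ?D (M j)) \<circ> id \<circ> s) n) \<longlonglongrightarrow> (\<integral>x. \<phi> x \<partial>L)"
    proof (rule weak_conv_imp_integral_bdd_continuous_conv[OF _ s(2,3)])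
      show "real_distribution (((\<lambda>j. ?D (M j)) \<circ> id \<circ> s) n)" for n
        using circle_prob_distr(1)[OF M] by simp
      show "isCont \<phi> x" for x using pc by (simp add: periodic_continuous_def continuous_on_eq_continuous_at)
      show "norm (\<phi> x) \<le> B" for x using B by simp
    qed
    moreover have "(\<integral>x. \<phi> x \<partial>\<mu>) = (\<integral>x. \<phi> x \<partial>L)"
    proof -
      have "\<phi> \<in> borel_measurable circle" unfolding circle_def by (rule measurable_restrict_space1[OF m])
      then show ?thesis unfolding \<mu>_def by (simp add: integral_distr[OF frac_m] periodic_continuous_frac[OF pc])
    qed
    ultimately show "(\<lambda>j. \<integral>x. \<phi> x \<partial>M (s j)) \<longlonglongrightarrow> (\<integral>x. \<phi> x \<partial>\<mu>)"
      using circle_prob_distr(3)[OF M m] by simp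
  qed
  with s(1) \<mu> show thesis by (rule that)
qed

text \<open>A periodic peak: \<open>cos (2 * pi * (y - x)) - 1\<close> is nonnegative only where
  \<open>y - x\<close> is an integer, so the bumps decrease to the indicator of the point
  \<open>x\<close> of the circle.\<close>

definition bump :: "real \<Rightarrow> nat \<Rightarrow> real \<Rightarrow> real" where
  "bump x = cutoff (\<lambda>y. cos (2 * pi * (y - x)) - 1)"

lemma periodic_continuous_bump: "periodic_continuous (bump x n)"
  unfolding bump_def by (intro periodic_continuous_cutoff periodic_continuous_cos)

lemma bump_bounds: "0 \<le> bump x n y" "bump x n y \<le> 1"
  unfolding bump_def by (rule cutoff_bounds)+

lemma bump_self: "bump x n x = 1"
  by (simp add: bump_def cutoff_def)

lemma bump_frac: "bump (frac x) n y = bump x n y"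
proof -
  have "bump (frac x) n y = bump 0 n (y - frac x)" by (simp add: bump_def cutoff_def)
  also have "\<dots> = bump 0 n ((y - x) + of_int \<lfloor>x\<rfloor>)" by (simp add: frac_def algebra_simps)
  also have "\<dots> = bump 0 n (y - x)"
    using periodic_continuous_bump[of 0 n] by (intro periodic_add_int) (simp add: periodic_continuous_def)
  also have "\<dots> = bump x n y" by (simp add: bump_def cutoff_def)
  finally show ?thesis .
qed

lemma bump_integral_tendsto:
  assumes "circle_prob \<mu>" "0 \<le> x" "x < 1"
  shows "(\<lambda>n. \<integral>y. bump x n y \<partial>\<mu>) \<longlonglongrightarrow> measure \<mu> {x}"
proof -
  have "y = x" if "0 \<le> y" "y < 1" "cos (2 * pi * (y - x)) = 1" for y
  proof -
    from that(3) obtain i :: int where "2 * pi * (y - x) = of_int i * 2 * pi"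
      by (auto simp: cos_one_2pi_int)
    then have i: "y - x = of_int i" by simp
    then have "\<bar>of_int i :: real\<bar> < 1" using that assms by linarith
    then have "i = 0" by linarith
    then show ?thesis using i by simp
  qed
  then have "{y \<in> {0..<1}. cos (2 * pi * (y - x)) - 1 \<ge> 0} = {x}"
    using assms by (auto simp: antisym)
  then show ?thesis
    using cutoff_integral_tendsto[OF assms(1) periodic_continuous_cos[of x 1]] unfolding bump_def by simp
qed

text \<open>The index \<open>n\<close> depends on \<open>\<eta>\<close> only and not on the centre:
  at distance at least \<open>\<eta>\<close> from the integers the cosine stays below 1 by a fixed
  amount.\<close>

lemma bump_support:
  assumes "\<eta> > 0"
  obtains n where "\<And>x y. bump x n y \<noteq> 0 \<Longrightarrow> \<exists>i::int. \<bar>y - x - of_int i\<bar> < \<eta>"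
proof -
  \<comment> \<open>The distance to the nearest integer is at most 1/2, and up to there the cosine
    is monotone in it.\<close>
  define \<eta>' where "\<eta>' = min \<eta> (1/2)"
  have e: "0 < \<eta>'" "\<eta>' \<le> 1/2" "\<eta>' \<le> \<eta>" using assms by (auto simp: \<eta>'_def)
  have "cos (2 * pi * \<eta>') < cos 0" using e by (intro cos_monotone_0_pi) (auto simp: field_simps)
  then have c: "0 < 1 - cos (2 * pi * \<eta>')" by simp
  obtain n where n: "1 / (1 - cos (2 * pi * \<eta>')) < real n" using reals_Archimedean2 by blast
  have "\<exists>i::int. \<bar>y - x - of_int i\<bar> < \<eta>" if b: "bump x n y \<noteq> 0" for x y
  proof (rule ccontr)
    assume neg: "\<not> ?thesis"
    define t where "t = \<bar>y - x - of_int (round (y - x))\<bar>"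
    have "\<not> t < \<eta>" using neg unfolding t_def by blast
    then have t: "\<eta>' \<le> t" using e(3) by simp
    have t': "t \<le> 1/2" using of_int_round_abs_le[of "y - x"] by (simp add: t_def abs_minus_commute)
    have p: "cos (2 * pi * (s + 1)) = cos (2 * pi * s)" for s
      using cos_periodic[of "2 * pi * s"] by (simp add: distrib_left)
    have "cos (2 * pi * (y - x)) = cos (2 * pi * (y - x - of_int (round (y - x))))"
      using periodic_add_int[of "\<lambda>s. cos (2 * pi * s)", OF p, of "y - x - of_int (round (y - x))" "round (y - x)"]
      by simp
    also have "\<dots> = cos (2 * pi * t)" unfolding t_def by (cases "y - x - of_int (round (y - x)) \<ge> 0")
        (simp_all only: abs_of_nonneg abs_of_neg not_le mult_minus_right cos_minus)
    also have "\<dots> \<le> cos (2 * pi * \<eta>')" using e t t' by (intro cos_monotone_0_pi_le) (auto simp: field_simps)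
    finally have "1 - cos (2 * pi * \<eta>') \<le> 1 - cos (2 * pi * (y - x))" by simp
    moreover have "1 < real n * (1 - cos (2 * pi * \<eta>'))" using n c by (simp add: field_simps)
    ultimately have "1 < real n * (1 - cos (2 * pi * (y - x)))"
      by (meson less_le_trans mult_left_mono of_nat_0_le_iff)
    then show False using b by (simp add: bump_def cutoff_def)
  qed
  then show thesis by (rule that)
qed

section \<open>Digit products and block sums\<close>

lemma digit_prod_0: "digit_prod k A 0 = Finite_Cartesian_Product.mat 1"
  by (simp add: digit_prod.simps)

text \<open>The case \<open>n = i = 0\<close> is excluded because a leading zero is no digit: there
  the product is the identity and not \<open>A 0\<close>.\<close>

lemma digit_prod_step:
  assumes "k \<ge> 2" "i < k" "n > 0 \<or> i > 0"
  shows "digit_prod k A (n * k + i) = digit_prod k A n ** A i"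
  using assms by (subst digit_prod.simps) auto

lemma digit_prod_single: "k \<ge> 2 \<Longrightarrow> 0 < i \<Longrightarrow> i < k \<Longrightarrow> digit_prod k A i = A i"
  using digit_prod_step[of k i 0 A] by (simp add: digit_prod_0)

lemma sum_blocks:
  fixes g :: "nat \<Rightarrow> 'a::comm_monoid_add"
  assumes "a \<le> b"
  shows "sum g {a * K..<b * K} = (\<Sum>q=a..<b. sum g {q * K..<Suc q * K})"
  using assms
proof (induction b rule: dec_induct)
  case (step n)
  have "sum g {a * K..<Suc n * K} = sum g {a * K..<n * K} + sum g {n * K..<Suc n * K}"
    using step by (intro sum.atLeastLessThan_concat[symmetric] mult_le_mono) auto
  then show ?case using step by simp
qed simp

lemma sum_block_shift:
  fixes g :: "nat \<Rightarrow> 'a::comm_monoid_add"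
  shows "sum g {q * K..<Suc q * K} = (\<Sum>i<K. g (q * K + i))"
  using sum.shift_bounds_nat_ivl[of g 0 "q * K" K] by (simp add: atLeast0LessThan add.commute)

text \<open>The block consists of the numbers whose expansion is that of \<open>n\<close> followed
  by \<open>m\<close> arbitrary digits. Summing over a free digit replaces its matrix by the sum of
  all; \<open>n > 0\<close> keeps zeros among these digits from being leading ones.\<close>

lemma digit_prod_block_sum:
  assumes "k \<ge> 2" "n > 0"
  shows "(\<Sum>a=n * k ^ m..<Suc n * k ^ m. digit_prod k A a *v x) =
    digit_prod k A n *v (matrix_power (matrix_sum k A) m *v x)"
proof (induction m arbitrary: x)
  case 0
  then show ?case by (simp add: matrix_power_0)
next
  case (Suc m)
  let ?S = "matrix_sum k A"
  have pos: "q > 0" if "q \<in> {n * k ^ m..<Suc n * k ^ m}" for q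
  proof -
    have "0 < n * k ^ m" using assms by simp
    then show ?thesis using that by (meson atLeastLessThan_iff less_le_trans)
  qed
  have "(\<Sum>a=n * k ^ Suc m..<Suc n * k ^ Suc m. digit_prod k A a *v x) =
      (\<Sum>a=n * k ^ m * k..<Suc n * k ^ m * k. digit_prod k A a *v x)"
    by (simp add: ac_simps)
  also have "\<dots> = (\<Sum>q=n * k ^ m..<Suc n * k ^ m. \<Sum>i<k. digit_prod k A (q * k + i) *v x)"
    by (subst sum_blocks) (simp_all only: sum_block_shift mult_le_mono1 le_SucI order_refl)
  also have "\<dots> = (\<Sum>q=n * k ^ m..<Suc n * k ^ m. \<Sum>i<k. digit_prod k A q *v (A i *v x))"
  proof (intro sum.cong refl)
    fix q i assume "q \<in> {n * k ^ m..<Suc n * k ^ m}" "i \<in> {..<k}"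
    then show "digit_prod k A (q * k + i) *v x = digit_prod k A q *v (A i *v x)"
      using assms pos by (simp add: digit_prod_step matrix_vector_mul_assoc)
  qed
  also have "\<dots> = (\<Sum>q=n * k ^ m..<Suc n * k ^ m. digit_prod k A q *v (?S *v x))"
    unfolding matrix_sum_apply
    by (intro sum.cong refl linear_sum[unfolded o_def, symmetric] matrix_vector_mul_linear)
  also have "\<dots> = digit_prod k A n *v (matrix_power ?S m *v (?S *v x))" by (rule Suc)
  also have "matrix_power ?S m *v (?S *v x) = matrix_power ?S (Suc m) *v x"
    unfolding matrix_power_apply by (simp add: funpow_swap1)
  finally show ?case .
qed

section \<open>The row space of a representation\<close>

lemma subspace_rep_space: "subspace (rep_space k u A)"
  by (simp add: rep_space_def subspace_span)

lemma digit_row_mem: "n > 0 \<Longrightarrow> u v* digit_prod k A n \<in> rep_space k u A"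
  unfolding rep_space_def by (rule span_base) (auto simp: Suc_le_eq)

lemma rep_space_invariant:
  assumes "k \<ge> 2" "i < k" "x \<in> rep_space k u A"
  shows "x v* A i \<in> rep_space k u A"
  using assms(3) unfolding rep_space_def
proof (induction rule: span_induct_alt)
  case base
  then show ?case by (simp add: span_zero vector_matrix_mult_0)
next
  case (step c r y)
  then obtain n where n: "n \<ge> 1" "r = u v* digit_prod k A n" by blast
  have "r v* A i = u v* digit_prod k A (n * k + i)"
    using n assms by (simp add: vector_matrix_mul_assoc digit_prod_step)
  moreover have "1 \<le> n * k + i" using n(1) assms(1) by (simp add: Suc_le_eq)
  ultimately have "r v* A i \<in> {u v* digit_prod k A n |n. 1 \<le> n}" by blast
  moreover have "(c *\<^sub>R r + y) v* A i = c *\<^sub>R (r v* A i) + y v* A i"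
    by (simp add: vector_matrix_mult_def Finite_Cartesian_Product.vec_eq_iff sum.distrib
        sum_distrib_left algebra_simps)
  ultimately show ?case using step(2) by (auto intro: span_add span_scale span_base)
qed

text \<open>The outer projection is absorbed by \<open>x\<close> and the inner one by
  \<open>x v* A i\<close>, which is again in the row space. Rows therefore do not notice the
  compression.\<close>

lemma inner_tilde:
  assumes "k \<ge> 2" "i < k" "x \<in> rep_space k u A"
  shows "x \<bullet> (tilde k u A i *v y) = x \<bullet> (A i *v y)"
proof -
  have "x \<bullet> (tilde k u A i *v y) = x \<bullet> (A i *v (proj (rep_space k u A) *v y))"
    unfolding tilde_def compress_apply by (rule inner_proj_right[OF subspace_rep_space assms(3)])
  also have "\<dots> = (x v* A i) \<bullet> (proj (rep_space k u A) *v y)" by (simp add: dot_lmul_matrix)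
  also have "\<dots> = (x v* A i) \<bullet> y"
    by (rule inner_proj_right[OF subspace_rep_space rep_space_invariant[OF assms]])
  finally show ?thesis by (simp add: dot_lmul_matrix)
qed

lemma tilde_sum_apply: "tilde_sum k u A *v x = (\<Sum>i<k. tilde k u A i *v x)"
  unfolding tilde_sum_def tilde_def compress_apply matrix_sum_apply
  by (rule linear_sum[unfolded o_def]) (rule matrix_vector_mul_linear)

lemma inner_tilde_sum:
  assumes "k \<ge> 2" "x \<in> rep_space k u A"
  shows "x \<bullet> (tilde_sum k u A *v y) = x \<bullet> (matrix_sum k A *v y)"
  unfolding tilde_sum_apply matrix_sum_apply inner_sum_right
  using assms by (intro sum.cong refl inner_tilde) auto

lemma inner_matrix_sum_mem:
  assumes "k \<ge> 2" "x \<in> rep_space k u A"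
  shows "x v* matrix_sum k A \<in> rep_space k u A"
proof -
  have "(x v* matrix_sum k A) \<bullet> y = (\<Sum>i<k. x v* A i) \<bullet> y" for y
    by (simp add: dot_lmul_matrix matrix_sum_apply inner_sum_left inner_sum_right)
  then have "\<forall>y. (x v* matrix_sum k A) \<bullet> y = (\<Sum>i<k. x v* A i) \<bullet> y" by (rule allI)
  then have eq: "x v* matrix_sum k A = (\<Sum>i<k. x v* A i)" by (rule vector_eq_rdot[THEN iffD1])
  show ?thesis unfolding eq
    by (intro subspace_sum[OF subspace_rep_space] rep_space_invariant[OF assms(1) _ assms(2)]) simp
qed

lemma inner_tilde_sum_power:
  assumes "k \<ge> 2" "x \<in> rep_space k u A"
  shows "x \<bullet> (matrix_power (tilde_sum k u A) m *v y) = x \<bullet> (matrix_power (matrix_sum k A) m *v y)"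
  using assms(2)
proof (induction m arbitrary: x)
  case (Suc m)
  note mem = inner_matrix_sum_mem[OF assms(1) Suc.prems]
  have "x \<bullet> (matrix_power (tilde_sum k u A) (Suc m) *v y) = x \<bullet> (tilde_sum k u A *v (matrix_power (tilde_sum k u A) m *v y))"
    by (simp add: matrix_power_Suc matrix_vector_mul_assoc)
  also have "\<dots> = (x v* matrix_sum k A) \<bullet> (matrix_power (tilde_sum k u A) m *v y)"
    unfolding inner_tilde_sum[OF assms(1) Suc.prems] by (simp add: dot_lmul_matrix)
  also have "\<dots> = x \<bullet> (matrix_sum k A *v (matrix_power (matrix_sum k A) m *v y))"
    unfolding Suc.IH[OF mem] by (simp add: dot_lmul_matrix)
  also have "\<dots> = x \<bullet> (matrix_power (matrix_sum k A) (Suc m) *v y)"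
    by (simp add: matrix_power_Suc matrix_vector_mul_assoc)
  finally show ?case .
qed (simp add: matrix_power_0)

section \<open>Level measures\<close>

text \<open>The point \<open>m / (k ^ N * (k - 1))\<close> in terms of the number
  \<open>a = k ^ N + m\<close> itself, so that prefixes of expansions can be compared across
  levels.\<close>

definition level_point :: "nat \<Rightarrow> nat \<Rightarrow> nat \<Rightarrow> real" where
  "level_point k N a = (real a / real k ^ N - 1) / (real k - 1)"

lemma level_point_bounds:
  assumes "k \<ge> 2" "k ^ N \<le> a" "a < k ^ Suc N"
  shows "0 \<le> level_point k N a" "level_point k N a + 1 / (real k ^ N * (real k - 1)) \<le> 1"
proof -
  have K: "real k ^ N > 0" "real k - 1 > 0" using assms by simp_all
  have "real k ^ N \<le> real a" using assms(2) by (metis of_nat_le_iff of_nat_power)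
  then show "0 \<le> level_point k N a" using K by (simp add: level_point_def)
  have "real a + 1 \<le> real k * real k ^ N"
    using assms(3) by (metis Suc_leI of_nat_Suc of_nat_le_iff of_nat_mult of_nat_power add.commute power_Suc)
  moreover have "level_point k N a + 1 / (real k ^ N * (real k - 1)) = ((real a + 1) / real k ^ N - 1) / (real k - 1)"
    using K by (simp add: level_point_def field_simps)
  ultimately show "level_point k N a + 1 / (real k ^ N * (real k - 1)) \<le> 1"
    using K by (simp add: divide_le_eq field_simps)
qed

text \<open>Appending \<open>m\<close> digits to \<open>n\<close> moves its point to the right by
  less than one interval length of level \<open>L\<close>: numbers with a common prefix lie in the
  interval of that prefix.\<close>

lemma level_point_block:
  assumes "k \<ge> 2" "a \<in> {n * k ^ m..<Suc n * k ^ m}"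
  shows "level_point k L n \<le> level_point k (L + m) a"
    "level_point k (L + m) a < level_point k L n + 1 / (real k ^ L * (real k - 1))"
proof -
  have K: "real k ^ N > 0" for N using assms by simp
  have K': "real k - 1 > 0" using assms by simp
  have 1: "real n * real k ^ m \<le> real a" "real a < (real n + 1) * real k ^ m"
  proof -
    have "real (n * k ^ m) \<le> real a" "real a < real (Suc n * k ^ m)"
      using assms(2) by (simp_all only: of_nat_le_iff of_nat_less_iff atLeastLessThan_iff)
    then show "real n * real k ^ m \<le> real a" "real a < (real n + 1) * real k ^ m"
      by (simp_all add: algebra_simps)
  qed
  have e: "real a / real k ^ (L + m) = (real a / real k ^ m) / real k ^ L"
    by (simp add: power_add field_simps)
  have 2: "real n \<le> real a / real k ^ m" "real a / real k ^ m < real n + 1"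
    using 1 K[of m] by (simp_all add: field_simps)
  show "level_point k L n \<le> level_point k (L + m) a"
    unfolding level_point_def e using 2 K[of L] K' by (intro divide_right_mono diff_right_mono) auto
  have "level_point k (L + m) a < ((real n + 1) / real k ^ L - 1) / (real k - 1)"
    unfolding level_point_def e using 2 K[of L] K' by (intro divide_strict_right_mono diff_strict_right_mono) auto
  also have "\<dots> = level_point k L n + 1 / (real k ^ L * (real k - 1))"
    using K[of L] K' by (simp add: level_point_def field_simps)
  finally show "level_point k (L + m) a < level_point k L n + 1 / (real k ^ L * (real k - 1))" .
qed

lemma
  assumes k: "k \<ge> 2" and nonneg: "\<And>n. f n \<ge> 0" and pos: "level_sum k f N > 0"
  shows circle_prob_level_measure: "circle_prob (level_measure k f N)"
    and integral_level_measure: "\<phi> \<in> borel_measurable borel \<Longrightarrow>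
      (\<integral>x. \<phi> x \<partial>level_measure k f N) =
      (\<Sum>a=k ^ N..<k ^ Suc N. f a * \<phi> (level_point k N a)) / level_sum k f N"
proof -
  let ?I = "{0..<k ^ (N + 1) - k ^ N}" and ?w = "\<lambda>m. f (k ^ N + m) / level_sum k f N"
  let ?g = "\<lambda>m. real m / (real k ^ N * (real k - 1))"
  let ?P = "point_measure ?I (\<lambda>m. ennreal (?w m))"
  have w: "0 \<le> ?w m" for m using nonneg pos by simp
  have le: "k ^ N \<le> k ^ Suc N" using k by simp
  have gp: "?g m = level_point k N (k ^ N + m)" for m
    using k by (simp add: level_point_def field_simps)
  have shift: "(\<Sum>m\<in>?I. g (k ^ N + m)) = (\<Sum>a=k ^ N..<k ^ Suc N. g a)" for g :: "nat \<Rightarrow> real"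
    using sum.shift_bounds_nat_ivl[of g 0 "k ^ N" "k ^ (N + 1) - k ^ N"] le by (simp add: add.commute)
  have "?g m \<in> {0..<1}" if "m \<in> ?I" for m
  proof -
    have "k ^ N \<le> k ^ N + m" "k ^ N + m < k ^ Suc N" using that by auto
    note b = level_point_bounds[OF k this]
    have "0 < 1 / (real k ^ N * (real k - 1))" using k by simp
    with b show ?thesis unfolding gp atLeastLessThan_iff by linarith
  qed
  then have g: "?g \<in> measurable ?P circle" by (simp add: space_circle)
  have "emeasure ?P (space ?P) = (\<Sum>m\<in>?I. ennreal (?w m))"
    by (simp add: space_point_measure emeasure_point_measure_finite)
  also have "\<dots> = ennreal (\<Sum>m\<in>?I. ?w m)" using w by (intro sum_ennreal) auto
  also have "(\<Sum>m\<in>?I. ?w m) = 1"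
    using shift[of "\<lambda>a. f a / level_sum k f N"] pos
    by (simp add: level_sum_def flip: sum_divide_distrib)
  finally have "prob_space ?P" by (intro prob_spaceI) simp
  then have "prob_space (level_measure k f N)"
    unfolding level_measure_def using g by (rule prob_space.prob_space_distr)
  then show "circle_prob (level_measure k f N)" by (simp add: circle_prob_def level_measure_def)
  assume \<phi>: "\<phi> \<in> borel_measurable borel"
  then have "\<phi> \<in> borel_measurable circle" unfolding circle_def by (rule measurable_restrict_space1)
  then have "(\<integral>x. \<phi> x \<partial>level_measure k f N) = (\<integral>m. \<phi> (?g m) \<partial>?P)"
    unfolding level_measure_def by (rule integral_distr[OF g])
  also have "\<dots> = (\<Sum>m\<in>?I. ?w m *\<^sub>R \<phi> (?g m))"
    using w by (intro lebesgue_integral_point_measure_finite) auto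
  also have "\<dots> = (\<Sum>m\<in>?I. f (k ^ N + m) * \<phi> (level_point k N (k ^ N + m)) / level_sum k f N)"
    unfolding gp by simp
  also have "\<dots> = (\<Sum>a=k ^ N..<k ^ Suc N. f a * \<phi> (level_point k N a)) / level_sum k f N"
    unfolding sum_divide_distrib by (rule shift[of "\<lambda>a. f a * \<phi> (level_point k N a) / level_sum k f N"])
  finally show "(\<integral>x. \<phi> x \<partial>level_measure k f N) =
      (\<Sum>a=k ^ N..<k ^ Suc N. f a * \<phi> (level_point k N a)) / level_sum k f N" .
qed

section \<open>Ghost measures of a nondegenerate representation\<close>

locale ghost_setup = jordan_compression "tilde_sum k u A" b q z m "rep_space k u A"
  for k :: nat and u :: "real^'d" and A :: "nat \<Rightarrow> real^'d^'d" and b q z m +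
  fixes f :: "nat \<Rightarrow> real" and v :: "real^'d"
  assumes k2: "k \<ge> 2"
    and nonneg: "\<And>n. f n \<ge> 0"
    and f_eq: "\<And>n. f n = u \<bullet> (digit_prod k A n *v v)"
    and nondegenerate: "\<And>h. h \<in> rep_group k u A \<Longrightarrow>
      u \<bullet> (((matrix_sum k A - A 0) ** rep_rotation k u A h ** limit_matrix k u A) *v v) > 0"
begin

abbreviation "M \<equiv> tilde_sum k u A"
abbreviation "\<rho> \<equiv> spec_rad M"

definition row where "row n = u v* digit_prod k A n"
text \<open>The functional for the total mass of a level: a leading digit is nonzero, hence the sum
  of the matrices without \<open>A 0\<close>.\<close>

definition lead where "lead = u v* (matrix_sum k A - A 0)"
definition state where "state N = norm_coeff N *\<^sub>R (matrix_power M N *v v)"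
definition limit_state where "limit_state h = (rep_rotation k u A h ** limit_matrix k u A) *v v"
text \<open>For \<open>n\<close> with \<open>L + 1\<close> digits, the share of level
  \<open>N\<close> carried by the numbers beginning with these digits.\<close>

definition mass where
  "mass L n N = (\<Sum>a=n * k ^ (N - L)..<Suc n * k ^ (N - L). f a) / level_sum k f N"
text \<open>The numbers with \<open>L + 1\<close> digits cut the circle into
  \<open>k ^ L * (k - 1)\<close> intervals of this length.\<close>

definition mesh where "mesh L = 1 / (real k ^ L * (real k - 1))"

lemma limit_matrix_eq: "limit_matrix k u A = peripheral_limit"
  unfolding limit_matrix_def Let_def peripheral_limit_def norm_coeff_def rep_rotation_def ..

lemma state_tendsto:
  assumes "filterlim n at_top sequentially" "(\<lambda>j. phase_power M (n j)) \<longlonglongrightarrow> h"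
  shows "(\<lambda>j. state (n j)) \<longlonglongrightarrow> limit_state h"
proof -
  have "(\<lambda>j. (norm_coeff (n j) *\<^sub>R matrix_power M (n j)) *v v) \<longlonglongrightarrow>
      (rotation (rep_space k u A) M h ** peripheral_limit) *v v"
    by (rule tendsto_matrix_vector_mult[OF normalized_power_tendsto[OF assms]])
  then show ?thesis
    by (simp only: state_def limit_state_def limit_matrix_eq rep_rotation_def scaleR_matrix_vector_assoc)
qed

lemma lead_pos:
  assumes "h \<in> rep_group k u A"
  shows "lead \<bullet> limit_state h > 0"
  using nondegenerate[OF assms]
  by (simp add: lead_def limit_state_def dot_lmul_matrix matrix_vector_mul_assoc matrix_mul_assoc)

lemma row_inner: "row n \<bullet> y = u \<bullet> (digit_prod k A n *v y)"
  by (simp add: row_def dot_lmul_matrix)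

lemma row_mem: "n > 0 \<Longrightarrow> row n \<in> rep_space k u A"
  unfolding row_def by (rule digit_row_mem)

lemma row_step:
  assumes "n > 0" "i < k"
  shows "row n \<bullet> (tilde k u A i *v y) = row (n * k + i) \<bullet> y"
  unfolding inner_tilde[OF k2 assms(2) row_mem[OF assms(1)]]
  using assms by (simp add: row_inner digit_prod_step[OF k2] matrix_vector_mul_assoc)

lemma block_eq:
  assumes "n > 0"
  shows "(\<Sum>a=n * k ^ j..<Suc n * k ^ j. f a) = row n \<bullet> (matrix_power M j *v v)"
proof -
  have "(\<Sum>a=n * k ^ j..<Suc n * k ^ j. f a) =
      u \<bullet> (\<Sum>a=n * k ^ j..<Suc n * k ^ j. digit_prod k A a *v v)"
    unfolding f_eq inner_sum_right ..
  also have "\<dots> = row n \<bullet> (matrix_power (matrix_sum k A) j *v v)"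
    unfolding digit_prod_block_sum[OF k2 assms] row_inner ..
  finally show ?thesis by (simp only: inner_tilde_sum_power[OF k2 row_mem[OF assms]])
qed

lemma lead_inner: "lead \<bullet> y = (\<Sum>n=1..<k. row n \<bullet> y)"
proof -
  have "(\<Sum>n=1..<k. row n \<bullet> y) = (\<Sum>n=1..<k. u \<bullet> (A n *v y))"
    by (intro sum.cong refl) (simp add: row_inner digit_prod_single[OF k2])
  also have "\<dots> = u \<bullet> ((\<Sum>n<k. A n *v y) - A 0 *v y)"
  proof -
    have "(\<Sum>n<k. A n *v y) = A 0 *v y + (\<Sum>n=1..<k. A n *v y)"
      using k2 by (simp add: lessThan_atLeast0 sum.atLeast_Suc_lessThan)
    then show ?thesis by (simp add: inner_sum_right)
  qed
  also have "\<dots> = lead \<bullet> y"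
    by (simp add: lead_def dot_lmul_matrix matrix_sum_apply matrix_vector_mult_diff_rdistrib)
  finally show ?thesis ..
qed

lemma level_sum_blocks:
  fixes g :: "nat \<Rightarrow> real"
  assumes "L \<le> N"
  shows "(\<Sum>a=k ^ N..<k ^ Suc N. g a) =
    (\<Sum>n=k ^ L..<k ^ Suc L. \<Sum>a=n * k ^ (N - L)..<Suc n * k ^ (N - L). g a)"
proof -
  have e: "k ^ L * k ^ (N - L) = k ^ N" "k ^ Suc L * k ^ (N - L) = k ^ Suc N"
    using assms by (simp_all flip: power_add add: Suc_diff_le)
  have "k ^ L \<le> k ^ Suc L" using k2 by simp
  from sum_blocks[OF this, of g "k ^ (N - L)"] show ?thesis unfolding e .
qed

lemma level_sum_eq: "level_sum k f N = lead \<bullet> (matrix_power M N *v v)"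
proof -
  have "level_sum k f N = (\<Sum>n=1..<k. \<Sum>a=n * k ^ N..<Suc n * k ^ N. f a)"
    using level_sum_blocks[of 0 N f] by (simp add: level_sum_def)
  also have "\<dots> = (\<Sum>n=1..<k. row n \<bullet> (matrix_power M N *v v))"
    by (intro sum.cong refl block_eq) simp
  finally show ?thesis by (simp only: lead_inner)
qed

section \<open>Uniform bounds by passing to subsequences of levels\<close>

lemma state_subsequence:
  assumes "filterlim n at_top sequentially"
  obtains s h where "strict_mono (s :: nat \<Rightarrow> nat)" "h \<in> rep_group k u A"
    "(\<lambda>j. phase_power M (n (s j))) \<longlonglongrightarrow> h" "(\<lambda>j. state (n (s j))) \<longlonglongrightarrow> limit_state h"
proof -
  obtain s h where s: "strict_mono (s :: nat \<Rightarrow> nat)" "(\<lambda>j. phase_power M (n (s j))) \<longlonglongrightarrow> h"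
    "h \<in> phase_group M" by (rule phase_power_subsequence[OF spec_rad_pos]) (rule that)
  have "filterlim (\<lambda>j. n (s j)) at_top sequentially"
    by (rule filterlim_compose[OF assms filterlim_subseq[OF s(1)]])
  then show thesis using state_tendsto[OF _ s(2)] by (intro that[OF s(1,3,2)])
qed

text \<open>If for no \<open>i\<close> the \<open>i\<close>-th bound holds eventually, one sequence
  of levels tending to infinity violates them all, the \<open>i\<close>-th bound at its
  \<open>i\<close>-th term.\<close>

lemma frequently_sequence:
  assumes "\<And>i::nat. \<not> (\<forall>\<^sub>F N in sequentially. P i N)"
  obtains n :: "nat \<Rightarrow> nat" where "filterlim n at_top sequentially" "\<And>i. \<not> P i (n i)"
proof -
  have "\<forall>i. \<exists>N\<ge>i. \<not> P i N" using assms unfolding eventually_sequentially by metis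
  then obtain n where n: "\<And>i. n i \<ge> i" "\<And>i. \<not> P i (n i)" by metis
  have "filterlim n at_top sequentially"
    by (rule filterlim_at_top_mono[OF filterlim_ident]) (simp add: n(1))
  then show thesis using n(2) by (rule that)
qed

text \<open>Nondegeneracy gives positivity separately for each \<open>h\<close>. Without a uniform
  bound, some sequence of levels would have total mass tending to 0, and a cluster point of its
  states would be a limit state on which \<open>lead\<close> is at most 0.\<close>

lemma lead_lower:
  obtains \<delta> where "\<delta> > 0" "\<forall>\<^sub>F N in sequentially. \<delta> \<le> lead \<bullet> state N"
proof (rule ccontr)
  assume neg: "\<not> thesis"
  have "\<not> (\<forall>\<^sub>F N in sequentially. inverse (real (Suc i)) \<le> lead \<bullet> state N)" for i
  proof
    assume "\<forall>\<^sub>F N in sequentially. inverse (real (Suc i)) \<le> lead \<bullet> state N"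
    then have thesis by (intro that[of "inverse (real (Suc i))"]) simp_all
    then show False using neg by simp
  qed
  from frequently_sequence[of "\<lambda>i N. inverse (real (Suc i)) \<le> lead \<bullet> state N", OF this]
  obtain n where n: "filterlim n at_top sequentially" "\<And>i. \<not> inverse (real (Suc i)) \<le> lead \<bullet> state (n i)"
    by blast
  obtain s h where s: "strict_mono (s :: nat \<Rightarrow> nat)" "h \<in> rep_group k u A"
    "(\<lambda>j. phase_power M (n (s j))) \<longlonglongrightarrow> h" "(\<lambda>j. state (n (s j))) \<longlonglongrightarrow> limit_state h"
    by (rule state_subsequence[OF n(1)]) (rule that)
  have "(\<lambda>j. lead \<bullet> state (n (s j))) \<longlonglongrightarrow> lead \<bullet> limit_state h"
    by (intro tendsto_inner tendsto_const s(4))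
  moreover have "(\<lambda>j. inverse (real (Suc (s j)))) \<longlonglongrightarrow> 0"
    by (rule filterlim_compose[OF LIMSEQ_inverse_real_of_nat filterlim_subseq[OF s(1)]])
  moreover have "\<exists>N. \<forall>j\<ge>N. lead \<bullet> state (n (s j)) \<le> inverse (real (Suc (s j)))"
    using n(2) by (intro exI[of _ 0] allI impI less_imp_le) (simp add: not_le)
  ultimately have "lead \<bullet> limit_state h \<le> 0" by (rule LIMSEQ_le)
  then show False using lead_pos[OF s(2)] by simp
qed

lemma state_upper:
  obtains C where "C > 0" "\<forall>\<^sub>F N in sequentially. norm (state N) \<le> C"
proof (rule ccontr)
  assume neg: "\<not> thesis"
  have "\<not> (\<forall>\<^sub>F N in sequentially. norm (state N) \<le> real (Suc i))" for i
  proof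
    assume "\<forall>\<^sub>F N in sequentially. norm (state N) \<le> real (Suc i)"
    then have thesis by (intro that[of "real (Suc i)"]) simp_all
    then show False using neg by simp
  qed
  from frequently_sequence[of "\<lambda>i N. norm (state N) \<le> real (Suc i)", OF this]
  obtain n where n: "filterlim n at_top sequentially" "\<And>i. \<not> norm (state (n i)) \<le> real (Suc i)"
    by blast
  obtain s h where s: "strict_mono (s :: nat \<Rightarrow> nat)" "h \<in> rep_group k u A"
    "(\<lambda>j. phase_power M (n (s j))) \<longlonglongrightarrow> h" "(\<lambda>j. state (n (s j))) \<longlonglongrightarrow> limit_state h"
    by (rule state_subsequence[OF n(1)]) (rule that)
  have "convergent (\<lambda>j. state (n (s j)))" using s(4) by (rule convergentI)
  then have "Bseq (\<lambda>j. state (n (s j)))" by (rule convergent_imp_Bseq)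
  then obtain K where K: "\<And>j. norm (state (n (s j))) \<le> K" by (auto simp: Bseq_def)
  obtain i where "K < real i" using reals_Archimedean2 by blast
  also have "real i \<le> real (Suc (s i))" using strict_mono_imp_increasing[OF s(1), of i] by simp
  also have "\<dots> < norm (state (n (s i)))" using n(2)[of "s i"] by simp
  finally show False using K[of i] by simp
qed

lemma limit_state_norm_bounded:
  obtains C where "C > 0" "\<And>h. h \<in> rep_group k u A \<Longrightarrow> norm (limit_state h) \<le> C"
proof -
  obtain C where C: "C > 0" "\<forall>\<^sub>F N in sequentially. norm (state N) \<le> C"
    by (rule state_upper) (rule that)
  have "norm (limit_state h) \<le> C" if h: "h \<in> rep_group k u A" for h
  proof -
    obtain n where n: "filterlim n at_top sequentially" "(\<lambda>j. phase_power M (n j)) \<longlonglongrightarrow> h"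
      by (rule phase_group_approach[OF spec_rad_pos h]) (rule that)
    show ?thesis
      by (rule Lim_norm_ubound[OF _ state_tendsto[OF n] eventually_compose_filterlim[OF C(2) n(1)]]) simp
  qed
  with C(1) show thesis by (rule that)
qed

lemma limit_lead_lower:
  obtains \<delta> where "\<delta> > 0" "\<And>h. h \<in> rep_group k u A \<Longrightarrow> \<delta> \<le> lead \<bullet> limit_state h"
proof -
  obtain \<delta> where d: "\<delta> > 0" "\<forall>\<^sub>F N in sequentially. \<delta> \<le> lead \<bullet> state N"
    by (rule lead_lower) (rule that)
  have "\<delta> \<le> lead \<bullet> limit_state h" if h: "h \<in> rep_group k u A" for h
  proof -
    obtain n where n: "filterlim n at_top sequentially" "(\<lambda>j. phase_power M (n j)) \<longlonglongrightarrow> h"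
      by (rule phase_group_approach[OF spec_rad_pos h]) (rule that)
    have "(\<lambda>j. lead \<bullet> state (n j)) \<longlonglongrightarrow> lead \<bullet> limit_state h"
      by (intro tendsto_inner tendsto_const state_tendsto n)
    then show ?thesis
      by (rule tendsto_lowerbound[OF _ eventually_compose_filterlim[OF d(2) n(1)]]) simp
  qed
  with d(1) show thesis by (rule that)
qed

lemma level_sum_pos: "\<forall>\<^sub>F N in sequentially. level_sum k f N > 0"
proof -
  obtain \<delta> where d: "\<delta> > 0" "\<forall>\<^sub>F N in sequentially. \<delta> \<le> lead \<bullet> state N"
    by (rule lead_lower) (rule that)
  from d(2) eventually_gt_at_top[of 0] show ?thesis
  proof eventually_elim
    case (elim N)
    then have "0 < norm_coeff N * level_sum k f N" using d(1) by (simp add: state_def level_sum_eq)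
    then show ?case using norm_coeff_pos[OF elim(2)] by (simp add: zero_less_mult_iff)
  qed
qed

lemma row_state_nonneg: "n > 0 \<Longrightarrow> j > 0 \<Longrightarrow> 0 \<le> row n \<bullet> state j"
  using norm_coeff_pos[of j] sum_nonneg[of "{n * k ^ j..<Suc n * k ^ j}" f] nonneg
  by (simp add: state_def block_eq[symmetric] del: mult_Suc)

text \<open>Numerator and denominator live on levels \<open>j\<close> and \<open>j + L\<close>; the
  quotient of their normalisations is the middle factor, which tends to
  \<open>1 / \<rho> ^ L\<close>.\<close>

lemma mass_eq:
  assumes "n > 0" "j > 0"
  shows "mass L n (L + j) =
    (row n \<bullet> state j) * (norm_coeff (j + L) / norm_coeff j) / (lead \<bullet> state (j + L))"
proof -
  have c: "norm_coeff j > 0" "norm_coeff (j + L) > 0" using norm_coeff_pos assms(2) by simp_all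
  have "mass L n (L + j) = (row n \<bullet> (matrix_power M j *v v)) / (lead \<bullet> (matrix_power M (j + L) *v v))"
    unfolding mass_def by (simp add: block_eq[OF assms(1)] level_sum_eq add.commute del: mult_Suc)
  then show ?thesis using c by (simp add: state_def)
qed

text \<open>The phase seen \<open>L\<close> levels earlier. It appears because a prefix with
  \<open>L + 1\<close> digits acts on the state of level \<open>N - L\<close>, while the total mass
  is read off at level \<open>N\<close>.\<close>

definition shift_phase where
  "shift_phase L h = (\<lambda>\<gamma>. if \<gamma> \<in> phases M then h \<gamma> / \<gamma> ^ L else 1)"

lemma shift_phase_tendsto:
  assumes n: "filterlim n at_top sequentially" and h: "(\<lambda>j. phase_power M (n j)) \<longlonglongrightarrow> h"
  shows "filterlim (\<lambda>j. n j - L) at_top sequentially"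
    "(\<lambda>j. phase_power M (n j - L)) \<longlonglongrightarrow> shift_phase L h"
proof -
  show "filterlim (\<lambda>j. n j - L) at_top sequentially"
    by (rule filterlim_compose[OF filterlim_minus_const_nat_at_top n])
  show "(\<lambda>j. phase_power M (n j - L)) \<longlonglongrightarrow> shift_phase L h"
    unfolding phase_power_tendsto_iff
  proof (intro conjI ballI allI impI)
    fix \<gamma> assume g: "\<gamma> \<in> phases M"
    then have nz: "\<gamma> \<noteq> 0" by (auto simp: phases_def)
    have "(\<lambda>j. \<gamma> ^ n j / \<gamma> ^ L) \<longlonglongrightarrow> h \<gamma> / \<gamma> ^ L"
      using h g nz by (intro tendsto_divide tendsto_const) (simp_all add: phase_power_tendsto_iff)
    moreover have "\<forall>\<^sub>F j in sequentially. \<gamma> ^ n j / \<gamma> ^ L = \<gamma> ^ (n j - L)"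
      using eventually_compose_filterlim[OF eventually_ge_at_top[of L] n]
      by eventually_elim (simp add: power_diff nz)
    ultimately have "(\<lambda>j. \<gamma> ^ (n j - L)) \<longlonglongrightarrow> h \<gamma> / \<gamma> ^ L" by (rule Lim_transform_eventually)
    then show "(\<lambda>j. \<gamma> ^ (n j - L)) \<longlonglongrightarrow> shift_phase L h \<gamma>" using g by (simp add: shift_phase_def)
  qed (simp add: shift_phase_def)
qed

lemma mass_tendsto:
  assumes n: "filterlim n at_top sequentially" and h: "(\<lambda>j. phase_power M (n j)) \<longlonglongrightarrow> h" and "a > 0"
  shows "(\<lambda>j. mass L a (n j)) \<longlonglongrightarrow>
    (row a \<bullet> limit_state (shift_phase L h)) * (1 / \<rho> ^ L) / (lead \<bullet> limit_state h)"
proof -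
  note sh = shift_phase_tendsto[OF n h, of L]
  have pos: "lead \<bullet> limit_state h \<noteq> 0" using lead_pos[OF phase_power_limit_mem[OF h]] by simp
  have "(\<lambda>j. (row a \<bullet> state (n j - L)) * (norm_coeff (n j - L + L) / norm_coeff (n j - L)) /
      (lead \<bullet> state (n j))) \<longlonglongrightarrow>
    (row a \<bullet> limit_state (shift_phase L h)) * (1 / \<rho> ^ L) / (lead \<bullet> limit_state h)"
    by (intro tendsto_divide tendsto_mult tendsto_inner tendsto_const state_tendsto sh n h pos
        filterlim_compose[OF norm_coeff_ratio sh(1)])
  moreover have "\<forall>\<^sub>F j in sequentially.
      (row a \<bullet> state (n j - L)) * (norm_coeff (n j - L + L) / norm_coeff (n j - L)) / (lead \<bullet> state (n j)) =
      mass L a (n j)"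
    using eventually_compose_filterlim[OF eventually_gt_at_top[of L] n]
  proof eventually_elim
    case (elim j)
    then show ?case using mass_eq[of a "n j - L" L] assms(3) by simp
  qed
  ultimately show ?thesis by (rule Lim_transform_eventually)
qed

section \<open>Riemann sums over the intervals of one level\<close>

lemma mesh_pos: "mesh L > 0"
  using k2 by (simp add: mesh_def)

lemma mesh_le_1: "mesh L \<le> 1"
proof -
  have "1 * 1 \<le> real k ^ L * (real k - 1)" using k2 by (intro mult_mono one_le_power) auto
  then show ?thesis by (simp add: mesh_def)
qed

lemma mesh_tendsto: "mesh \<longlonglongrightarrow> 0"
proof -
  have "(\<lambda>L. (1 / real k) ^ L * (1 / (real k - 1))) \<longlonglongrightarrow> 0"
    using k2 by (intro tendsto_mult_left_zero LIMSEQ_realpow_zero) auto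
  then show ?thesis by (simp add: mesh_def[abs_def] power_divide)
qed

lemma integral_mass:
  assumes "level_sum k f N > 0" "periodic_continuous \<phi>" "L \<le> N"
  shows "(\<integral>x. \<phi> x \<partial>level_measure k f N) = (\<Sum>n=k ^ L..<k ^ Suc L.
    (\<Sum>a=n * k ^ (N - L)..<Suc n * k ^ (N - L). f a * \<phi> (level_point k N a)) / level_sum k f N)"
  unfolding integral_level_measure[OF k2 nonneg assms(1) periodic_continuous_measurable[OF assms(2)]]
    level_sum_blocks[OF assms(3)] sum_divide_distrib[symmetric] ..

lemma level_index_pos: "n \<in> {k ^ L..<k ^ Suc L} \<Longrightarrow> n > 0"
proof -
  assume "n \<in> {k ^ L..<k ^ Suc L}"
  moreover have "0 < k ^ L" using k2 by simp
  ultimately show "n > 0" by (meson atLeastLessThan_iff less_le_trans)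
qed

lemma block_point:
  assumes "L \<le> N" "n \<in> {k ^ L..<k ^ Suc L}" "a \<in> {n * k ^ (N - L)..<Suc n * k ^ (N - L)}"
  shows "level_point k L n \<le> level_point k N a" "level_point k N a < level_point k L n + mesh L"
    "0 \<le> level_point k L n" "level_point k L n + mesh L \<le> 1"
proof -
  show "level_point k L n \<le> level_point k N a" "level_point k N a < level_point k L n + mesh L"
    using level_point_block[OF k2 assms(3), of L] assms(1) by (simp_all add: mesh_def)
  show "0 \<le> level_point k L n" "level_point k L n + mesh L \<le> 1"
    using level_point_bounds[OF k2, of L n] assms(2) by (simp_all add: mesh_def)
qed

lemma mass_sum: 
  assumes "level_sum k f N > 0" "L \<le> N"
  shows "(\<Sum>n=k ^ L..<k ^ Suc L. mass L n N) = 1"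
  using assms level_sum_blocks[OF assms(2), of f]
  by (simp add: mass_def level_sum_def del: mult_Suc power_Suc flip: sum_divide_distrib)

text \<open>The test function is replaced on each interval by its value at the left end; as the
  masses sum to 1, the error is at most \<open>\<epsilon>\<close>, uniformly in \<open>N\<close>.
  What remains is a finite sum of masses, each with a known limit.\<close>

lemma integral_mass_approx:
  assumes N: "level_sum k f N > 0" "L \<le> N" and pc: "periodic_continuous \<phi>"
    and eps: "\<And>x y. x \<in> {0..1} \<Longrightarrow> y \<in> {0..1} \<Longrightarrow> \<bar>x - y\<bar> \<le> mesh L \<Longrightarrow> \<bar>\<phi> x - \<phi> y\<bar> \<le> \<epsilon>"
  shows "\<bar>(\<integral>x. \<phi> x \<partial>level_measure k f N) -
    (\<Sum>n=k ^ L..<k ^ Suc L. \<phi> (level_point k L n) * mass L n N)\<bar> \<le> \<epsilon>"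
proof -
  let ?B = "\<lambda>n. {n * k ^ (N - L)..<Suc n * k ^ (N - L)}"
  have "\<bar>(\<integral>x. \<phi> x \<partial>level_measure k f N) -
      (\<Sum>n=k ^ L..<k ^ Suc L. \<phi> (level_point k L n) * mass L n N)\<bar> =
    \<bar>\<Sum>n=k ^ L..<k ^ Suc L. (\<Sum>a\<in>?B n. f a * \<phi> (level_point k N a)) / level_sum k f N -
      \<phi> (level_point k L n) * mass L n N\<bar>"
    unfolding integral_mass[OF N(1) pc N(2)] sum_subtractf ..
  also have "\<dots> \<le> (\<Sum>n=k ^ L..<k ^ Suc L. \<epsilon> * mass L n N)"
  proof (intro order_trans[OF sum_abs] sum_mono)
    fix n assume n: "n \<in> {k ^ L..<k ^ Suc L}"
    have "(\<Sum>a\<in>?B n. f a * \<phi> (level_point k N a)) / level_sum k f N - \<phi> (level_point k L n) * mass L n N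
      = (\<Sum>a\<in>?B n. f a * (\<phi> (level_point k N a) - \<phi> (level_point k L n))) / level_sum k f N"
      unfolding mass_def right_diff_distrib sum_subtractf diff_divide_distrib
      by (simp only: sum_distrib_right[symmetric] mult.commute[of "\<phi> _"] times_divide_eq_left)
    also have "\<bar>\<dots>\<bar> \<le> (\<Sum>a\<in>?B n. f a * \<epsilon>) / level_sum k f N"
      unfolding abs_divide abs_of_pos[OF N(1)]
    proof (intro divide_right_mono order_trans[OF sum_abs] sum_mono)
      fix a assume a: "a \<in> ?B n"
      note p = block_point[OF N(2) n a]
      have "\<bar>\<phi> (level_point k N a) - \<phi> (level_point k L n)\<bar> \<le> \<epsilon>"
        using p mesh_pos[of L] by (intro eps) auto
      then show "\<bar>f a * (\<phi> (level_point k N a) - \<phi> (level_point k L n))\<bar> \<le> f a * \<epsilon>"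
        using nonneg[of a] by (simp add: abs_mult mult_left_mono)
    qed (use N in simp)
    also have "\<dots> = \<epsilon> * mass L n N"
      unfolding mass_def sum_distrib_right[symmetric] by simp
    finally show "\<bar>(\<Sum>a\<in>?B n. f a * \<phi> (level_point k N a)) / level_sum k f N -
      \<phi> (level_point k L n) * mass L n N\<bar> \<le> \<epsilon> * mass L n N" .
  qed
  also have "\<dots> = \<epsilon>" using mass_sum[OF N] by (simp del: power_Suc flip: sum_distrib_left)
  finally show ?thesis .
qed

lemma periodic_continuous_mesh:
  assumes "periodic_continuous \<phi>" "\<epsilon> > 0"
  obtains L where "\<And>x y. x \<in> {0..1} \<Longrightarrow> y \<in> {0..1} \<Longrightarrow> \<bar>x - y\<bar> \<le> mesh L \<Longrightarrow> \<bar>\<phi> x - \<phi> y\<bar> \<le> \<epsilon>"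
proof -
  have "continuous_on {0..1} \<phi>"
    using assms continuous_on_subset[of UNIV \<phi> "{0..1}"] by (simp add: periodic_continuous_def)
  then have "uniformly_continuous_on {0..1} \<phi>"
    by (rule compact_uniformly_continuous[OF _ compact_Icc])
  then obtain d where d: "d > 0" "\<forall>x\<in>{0..1}. \<forall>y\<in>{0..1}. dist y x < d \<longrightarrow> dist (\<phi> y) (\<phi> x) < \<epsilon>"
    unfolding uniformly_continuous_on_def using assms(2) by meson
  have "\<forall>\<^sub>F L in sequentially. mesh L < d" by (rule order_tendstoD(2)[OF mesh_tendsto d(1)])
  then obtain L where L: "mesh L < d" by (meson eventually_sequentially order_refl)
  show thesis
  proof (rule that[of L])
    fix x y :: real assume "x \<in> {0..1}" "y \<in> {0..1}" "\<bar>x - y\<bar> \<le> mesh L"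
    then show "\<bar>\<phi> x - \<phi> y\<bar> \<le> \<epsilon>" using d(2)[rule_format, of y x] L by (simp add: dist_real_def)
  qed
qed

text \<open>For fixed \<open>L\<close> the masses converge to limits depending on \<open>h\<close>
  alone, so the Riemann sums along both sequences have the same limit. This yields the independence
  of the sequence that the definition of \<open>ghost_measure\<close> presupposes.\<close>

lemma integrals_merge:
  assumes n: "filterlim n at_top sequentially" "(\<lambda>j. phase_power M (n j)) \<longlonglongrightarrow> h"
    and n': "filterlim n' at_top sequentially" "(\<lambda>j. phase_power M (n' j)) \<longlonglongrightarrow> h"
    and pc: "periodic_continuous \<phi>"
  shows "(\<lambda>j. (\<integral>x. \<phi> x \<partial>level_measure k f (n j)) - (\<integral>x. \<phi> x \<partial>level_measure k f (n' j))) \<longlonglongrightarrow> 0"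
proof (rule LIMSEQ_I)
  fix \<epsilon> :: real assume e: "\<epsilon> > 0"
  \<comment> \<open>A quarter for each of the two approximations by Riemann sums and for the
    difference of the sums leaves a strict inequality.\<close>
  obtain L where L: "\<And>x y. x \<in> {0..1} \<Longrightarrow> y \<in> {0..1} \<Longrightarrow> \<bar>x - y\<bar> \<le> mesh L \<Longrightarrow> \<bar>\<phi> x - \<phi> y\<bar> \<le> \<epsilon> / 4"
    using e by (rule_tac periodic_continuous_mesh[OF pc, of "\<epsilon> / 4"]) (simp, rule that)
  let ?S = "\<lambda>N. \<Sum>a=k ^ L..<k ^ Suc L. \<phi> (level_point k L a) * mass L a N"
  let ?l = "\<Sum>a=k ^ L..<k ^ Suc L. \<phi> (level_point k L a) *
    ((row a \<bullet> limit_state (shift_phase L h)) * (1 / \<rho> ^ L) / (lead \<bullet> limit_state h))"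
  have S: "(\<lambda>j. ?S (n j)) \<longlonglongrightarrow> ?l" if "filterlim n at_top sequentially" "(\<lambda>j. phase_power M (n j)) \<longlonglongrightarrow> h" for n
    by (intro tendsto_sum tendsto_mult tendsto_const mass_tendsto that level_index_pos)
  have "(\<lambda>j. ?S (n j) - ?S (n' j)) \<longlonglongrightarrow> ?l - ?l"
    by (intro tendsto_diff S n n')
  then have "(\<lambda>j. ?S (n j) - ?S (n' j)) \<longlonglongrightarrow> 0" by simp
  from tendstoD[OF this, of "\<epsilon> / 4"] have "\<forall>\<^sub>F j in sequentially. \<bar>?S (n j) - ?S (n' j)\<bar> < \<epsilon> / 4"
    using e by (simp add: dist_real_def)
  moreover have ap: "\<forall>\<^sub>F N in sequentially. \<bar>(\<integral>x. \<phi> x \<partial>level_measure k f N) - ?S N\<bar> \<le> \<epsilon> / 4"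
    using level_sum_pos eventually_ge_at_top[of L]
    by eventually_elim (rule integral_mass_approx[OF _ _ pc L])
  ultimately have "\<forall>\<^sub>F j in sequentially.
      norm ((\<integral>x. \<phi> x \<partial>level_measure k f (n j)) - (\<integral>x. \<phi> x \<partial>level_measure k f (n' j)) - 0) < \<epsilon>"
    using eventually_compose_filterlim[OF ap n(1)] eventually_compose_filterlim[OF ap n'(1)]
  proof eventually_elim
    case (elim j)
    then show ?case using e unfolding real_norm_def by linarith
  qed
  then show "\<exists>no. \<forall>j\<ge>no.
      norm ((\<integral>x. \<phi> x \<partial>level_measure k f (n j)) - (\<integral>x. \<phi> x \<partial>level_measure k f (n' j)) - 0) < \<epsilon>"
    by (simp only: eventually_sequentially)
qed

section \<open>Existence and uniqueness of ghost measures\<close>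

definition ghost_limit where
  "ghost_limit h \<mu> \<longleftrightarrow> circle_prob \<mu> \<and> (\<forall>n :: nat \<Rightarrow> nat. filterlim n at_top sequentially \<and>
    (\<lambda>j. phase_power M (n j)) \<longlonglongrightarrow> h \<longrightarrow> weak_limit_circle (\<lambda>j. level_measure k f (n j)) \<mu>)"

lemma ghost_measure_eq: "ghost_measure k f u A h = (THE \<mu>. ghost_limit h \<mu>)"
  by (simp add: ghost_measure_def ghost_limit_def circle_prob_def conj_assoc)

text \<open>Weak compactness yields a limit along a subsequence of one approach to \<open>h\<close>;
  merging of integrals carries it over to every other sequence of levels with limiting phase
  \<open>h\<close>.\<close>

lemma ghost_limit_exists:
  assumes "h \<in> rep_group k u A"
  shows "\<exists>\<mu>. ghost_limit h \<mu>"
proof -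
  obtain n where n: "filterlim n at_top sequentially" "(\<lambda>j. phase_power M (n j)) \<longlonglongrightarrow> h"
    by (rule phase_group_approach[OF spec_rad_pos assms]) (rule that)
  \<comment> \<open>The shift by \<open>J\<close> skips the levels at which the total mass may
    vanish, where the level measure need not be a probability measure.\<close>
  from eventually_compose_filterlim[OF level_sum_pos n(1)]
  obtain J where J: "\<And>j. j \<ge> J \<Longrightarrow> level_sum k f (n j) > 0" unfolding eventually_sequentially by meson
  have "circle_prob (level_measure k f (n (j + J)))" for j
    by (rule circle_prob_level_measure[OF k2 nonneg]) (simp add: J)
  from circle_prob_convergent_subsequence[of "\<lambda>j. level_measure k f (n (j + J))", OF this]
  obtain s \<mu> where s: "strict_mono (s :: nat \<Rightarrow> nat)" "circle_prob \<mu>"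
    "weak_limit_circle (\<lambda>j. level_measure k f (n (s j + J))) \<mu>" by metis
  define n' where "n' j = n (s j + J)" for j
  have "filterlim (\<lambda>j. s j + J) at_top sequentially"
    by (rule filterlim_at_top_mono[OF filterlim_subseq[OF s(1)]]) simp
  then have n': "filterlim n' at_top sequentially" "(\<lambda>j. phase_power M (n' j)) \<longlonglongrightarrow> h"
    unfolding n'_def by (rule filterlim_compose[OF n(1)], rule filterlim_compose[OF n(2)])
  have "ghost_limit h \<mu>"
    unfolding ghost_limit_def weak_limit_circle_iff
  proof (intro conjI allI impI s(2))
    fix l :: "nat \<Rightarrow> nat" and \<phi> :: "real \<Rightarrow> real"
    assume l: "filterlim l at_top sequentially \<and> (\<lambda>j. phase_power M (l j)) \<longlonglongrightarrow> h"
      and pc: "periodic_continuous \<phi>"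
    have "(\<lambda>j. \<integral>x. \<phi> x \<partial>level_measure k f (n' j)) \<longlonglongrightarrow> (\<integral>x. \<phi> x \<partial>\<mu>)"
      using s(3) pc unfolding weak_limit_circle_iff n'_def by blast
    from tendsto_add[OF integrals_merge[OF conjunct1[OF l] conjunct2[OF l] n' pc] this]
    show "(\<lambda>j. \<integral>x. \<phi> x \<partial>level_measure k f (l j)) \<longlonglongrightarrow> (\<integral>x. \<phi> x \<partial>\<mu>)" by simp
  qed
  then show ?thesis by blast
qed

lemma ghost_limit_unique:
  assumes "h \<in> rep_group k u A" "ghost_limit h \<mu>" "ghost_limit h \<nu>"
  shows "\<mu> = \<nu>"
proof -
  obtain n where n: "filterlim n at_top sequentially" "(\<lambda>j. phase_power M (n j)) \<longlonglongrightarrow> h"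
    by (rule phase_group_approach[OF spec_rad_pos assms(1)]) (rule that)
  have w: "weak_limit_circle (\<lambda>j. level_measure k f (n j)) \<mu>" "weak_limit_circle (\<lambda>j. level_measure k f (n j)) \<nu>"
    using assms(2,3) n unfolding ghost_limit_def by blast+
  show ?thesis
  proof (rule circle_prob_eqI)
    show "circle_prob \<mu>" "circle_prob \<nu>" using assms(2,3) by (simp_all add: ghost_limit_def)
    fix \<phi> :: "real \<Rightarrow> real" assume pc: "periodic_continuous \<phi>"
    show "(\<integral>x. \<phi> x \<partial>\<mu>) = (\<integral>x. \<phi> x \<partial>\<nu>)"
      by (rule LIMSEQ_unique[OF w(1)[unfolded weak_limit_circle_iff, rule_format, OF pc]
            w(2)[unfolded weak_limit_circle_iff, rule_format, OF pc]])
  qed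
qed

lemma ghost_measure_limit:
  assumes "h \<in> rep_group k u A"
  shows "ghost_limit h (ghost_measure k f u A h)"
proof -
  obtain \<mu> where "ghost_limit h \<mu>" using ghost_limit_exists[OF assms] by blast
  then show ?thesis unfolding ghost_measure_eq
    by (rule theI) (rule ghost_limit_unique[OF assms _ \<open>ghost_limit h \<mu>\<close>])
qed

lemma circle_prob_ghost: "h \<in> rep_group k u A \<Longrightarrow> circle_prob (ghost_measure k f u A h)"
  using ghost_measure_limit by (simp add: ghost_limit_def)

lemma ghost_integral_tendsto:
  assumes "h \<in> rep_group k u A" "filterlim n at_top sequentially" "(\<lambda>j. phase_power M (n j)) \<longlonglongrightarrow> h"
    "periodic_continuous \<phi>"
  shows "(\<lambda>j. \<integral>x. \<phi> x \<partial>level_measure k f (n j)) \<longlonglongrightarrow> (\<integral>x. \<phi> x \<partial>ghost_measure k f u A h)"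
  using ghost_measure_limit[OF assms(1)] assms(2-4) unfolding ghost_limit_def weak_limit_circle_iff by blast

end

section \<open>Atoms and decay\<close>

lemma card_near:
  "finite {n::nat. \<bar>real n - r\<bar> < 2}" "card {n::nat. \<bar>real n - r\<bar> < 2} \<le> 4"
proof -
  have sub: "{n::nat. \<bar>real n - r\<bar> < 2} \<subseteq> nat ` {\<lfloor>r\<rfloor> - 1..\<lfloor>r\<rfloor> + 2}"
  proof
    fix n :: nat assume "n \<in> {n. \<bar>real n - r\<bar> < 2}"
    then have "\<bar>real n - r\<bar> < 2" by simp
    then have "int n \<in> {\<lfloor>r\<rfloor> - 1..\<lfloor>r\<rfloor> + 2}" unfolding atLeastAtMost_iff by linarith
    then have "nat (int n) \<in> nat ` {\<lfloor>r\<rfloor> - 1..\<lfloor>r\<rfloor> + 2}" by (rule imageI)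
    then show "n \<in> nat ` {\<lfloor>r\<rfloor> - 1..\<lfloor>r\<rfloor> + 2}" by simp
  qed
  have fin: "finite (nat ` {\<lfloor>r\<rfloor> - 1..\<lfloor>r\<rfloor> + 2})" by simp
  show "finite {n::nat. \<bar>real n - r\<bar> < 2}" by (rule finite_subset[OF sub fin])
  have "card {n::nat. \<bar>real n - r\<bar> < 2} \<le> card (nat ` {\<lfloor>r\<rfloor> - 1..\<lfloor>r\<rfloor> + 2})"
    by (rule card_mono[OF fin sub])
  also have "\<dots> \<le> card {\<lfloor>r\<rfloor> - 1..\<lfloor>r\<rfloor> + 2}" by (rule card_image_le) simp
  finally show "card {n::nat. \<bar>real n - r\<bar> < 2} \<le> 4" by simp
qed

context ghost_setup
begin

text \<open>One-sided because rows are nonnegative on limit states; \<open>n\<close> and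
  \<open>h\<close> are quantified inside the eventual statement, so the decay is uniform in
  both.\<close>

definition decay where
  "decay \<longleftrightarrow> (\<forall>\<epsilon>>0. \<forall>\<^sub>F L in sequentially.
    \<forall>n\<in>{k ^ L..<k ^ Suc L}. \<forall>h\<in>rep_group k u A. row n \<bullet> limit_state h \<le> \<epsilon> * \<rho> ^ L)"

lemma level_point_mesh: "level_point k L n = (real n - real k ^ L) * mesh L"
  using k2 by (simp add: level_point_def mesh_def field_simps)

text \<open>A bump no wider than the mesh on either side meets a bounded number of intervals,
  whatever \<open>L\<close> is: at most four around each of the three relevant integer translates of
  \<open>x\<close>, hence 12. \<open>T\<close> does not depend on \<open>N\<close>, so a limit in
  \<open>N\<close> can be taken.\<close>

lemma bump_integral_le:
  assumes x: "0 \<le> x" "x < 1"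
    and K: "\<And>y. bump x K y \<noteq> 0 \<Longrightarrow> \<exists>i::int. \<bar>y - x - of_int i\<bar> < mesh L"
  obtains T where "T \<subseteq> {k ^ L..<k ^ Suc L}" "card T \<le> 12"
    "\<And>N. level_sum k f N > 0 \<Longrightarrow> L \<le> N \<Longrightarrow>
      (\<integral>y. bump x K y \<partial>level_measure k f N) \<le> (\<Sum>n\<in>T. mass L n N)"
proof -
  \<comment> \<open>The real index whose point of level \<open>L\<close> is \<open>x + i\<close>,
    obtained by inverting \<open>level_point_mesh\<close>.\<close>
  define c where "c i = real k ^ L + (x + i) / mesh L" for i :: real
  define U where "U = (\<Union>i\<in>{-1,0,1}. {n::nat. \<bar>real n - c i\<bar> < 2})"
  define T where "T = {k ^ L..<k ^ Suc L} \<inter> U"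
  have fin: "finite U" unfolding U_def using card_near(1) by simp
  have "card U \<le> (\<Sum>i\<in>{-1,0,1::real}. card {n::nat. \<bar>real n - c i\<bar> < 2})"
    unfolding U_def by (rule card_UN_le) simp
  also have "\<dots> \<le> (\<Sum>i\<in>{-1,0,1::real}. 4)" by (intro sum_mono card_near(2))
  also have "\<dots> = 12" by simp
  finally have "card U \<le> 12" .
  moreover have "card T \<le> card U" unfolding T_def by (rule card_mono[OF fin]) blast
  ultimately have card: "card T \<le> 12" by simp
  have bound: "(\<integral>y. bump x K y \<partial>level_measure k f N) \<le> (\<Sum>n\<in>T. mass L n N)"
    if N: "level_sum k f N > 0" "L \<le> N" for N
  proof -
    let ?B = "\<lambda>n. {n * k ^ (N - L)..<Suc n * k ^ (N - L)}"
    let ?g = "\<lambda>n. (\<Sum>a\<in>?B n. f a * bump x K (level_point k N a)) / level_sum k f N"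
    have "(\<integral>y. bump x K y \<partial>level_measure k f N) = (\<Sum>n=k ^ L..<k ^ Suc L. ?g n)"
      by (rule integral_mass[OF N(1) periodic_continuous_bump N(2)])
    also have "\<dots> = (\<Sum>n\<in>T. ?g n)"
    proof (rule sum.mono_neutral_right)
      show "T \<subseteq> {k ^ L..<k ^ Suc L}" unfolding T_def by blast
      show "\<forall>n\<in>{k ^ L..<k ^ Suc L} - T. ?g n = 0"
      proof
        fix n assume n: "n \<in> {k ^ L..<k ^ Suc L} - T"
        have "bump x K (level_point k N a) = 0" if a: "a \<in> ?B n" for a
        proof (rule ccontr)
          assume "bump x K (level_point k N a) \<noteq> 0"
          then obtain i :: int where i: "\<bar>level_point k N a - x - of_int i\<bar> < mesh L" using K by blast
          have nL: "n \<in> {k ^ L..<k ^ Suc L}" using n by (rule DiffD1)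
          note p = block_point[OF N(2) nL a]
          have "\<bar>of_int i :: real\<bar> < 2" using i p x mesh_pos[of L] mesh_le_1[of L] by linarith
          then have "i = -1 \<or> i = 0 \<or> i = 1" by linarith
          then have i1: "of_int i \<in> {-1, 0, 1 :: real}" by auto
          \<comment> \<open>One mesh length comes from the support of the bump, another from the
            place of \<open>a\<close> within the interval of \<open>n\<close>.\<close>
          have "\<bar>level_point k L n - x - of_int i\<bar> < 2 * mesh L" using i p by linarith
          moreover have "(real n - c (of_int i)) * mesh L = level_point k L n - x - of_int i"
            unfolding level_point_mesh c_def left_diff_distrib distrib_right using mesh_pos[of L] by simp
          ultimately have "\<bar>(real n - c (of_int i)) * mesh L\<bar> < 2 * mesh L" by (simp only:)
          then have "\<bar>real n - c (of_int i)\<bar> < 2" using mesh_pos[of L] by (simp add: abs_mult)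
          then have "n \<in> U" unfolding U_def using i1 by blast
          with nL have "n \<in> T" unfolding T_def by (rule IntI)
          then show False using n by (simp only: Diff_iff simp_thms)
        qed
        then show "?g n = 0" by (simp del: mult_Suc)
      qed
    qed simp
    also have "\<dots> \<le> (\<Sum>n\<in>T. mass L n N)"
      unfolding mass_def
    proof (intro sum_mono divide_right_mono)
      fix n a show "f a * bump x K (level_point k N a) \<le> f a"
        using nonneg[of a] bump_bounds(2)[of x K "level_point k N a"] by (simp add: mult_left_le)
    qed (use N in simp)
    finally show ?thesis .
  qed
  show thesis by (rule that[OF _ card bound]) (auto simp: T_def)
qed

text \<open>An atom at \<open>x\<close> is at most the integral of a bump there, which is at most
  the limiting mass of 12 intervals; decay makes that smaller than the atom.\<close>

lemma decay_imp_atomless: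
  assumes decay and h: "h \<in> rep_group k u A"
  shows "atomless (ghost_measure k f u A h)"
proof -
  let ?\<mu> = "ghost_measure k f u A h"
  note cp = circle_prob_ghost[OF h]
  interpret \<mu>: prob_space ?\<mu> using cp by (simp add: circle_prob_def)
  obtain \<delta> where d: "\<delta> > 0" "\<And>h. h \<in> rep_group k u A \<Longrightarrow> \<delta> \<le> lead \<bullet> limit_state h"
    by (rule limit_lead_lower) (rule that)
  obtain l where l: "filterlim l at_top sequentially" "(\<lambda>j. phase_power M (l j)) \<longlonglongrightarrow> h"
    by (rule phase_group_approach[OF spec_rad_pos h]) (rule that)
  have "measure ?\<mu> {x} = 0" if x: "0 \<le> x" "x < 1" for x
  proof (rule ccontr)
    assume ne: "measure ?\<mu> {x} \<noteq> 0"
    define e where "e = measure ?\<mu> {x} / 2"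
    have e: "e > 0" using ne by (simp add: e_def zero_less_measure_iff)
    \<comment> \<open>Here \<open>\<delta>\<close> compensates the division by the total mass and 12
      the number of intervals, so all of them together stay below half of the atom.\<close>
    have "e * \<delta> / 12 > 0" using e d by simp
    then have "\<forall>\<^sub>F L in sequentially. \<forall>n\<in>{k ^ L..<k ^ Suc L}. \<forall>h\<in>rep_group k u A.
        row n \<bullet> limit_state h \<le> e * \<delta> / 12 * \<rho> ^ L"
      by (rule assms(1)[unfolded decay_def, THEN spec, THEN mp])
    then obtain L where L: "\<forall>n\<in>{k ^ L..<k ^ Suc L}. \<forall>h\<in>rep_group k u A.
        row n \<bullet> limit_state h \<le> e * \<delta> / 12 * \<rho> ^ L"
      by (rule exE[OF eventually_happens'[OF sequentially_bot]])
    obtain K where K: "\<And>x y. bump x K y \<noteq> 0 \<Longrightarrow> \<exists>i::int. \<bar>y - x - of_int i\<bar> < mesh L"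
      by (rule bump_support[OF mesh_pos[of L]]) (rule that)
    obtain T where T: "T \<subseteq> {k ^ L..<k ^ Suc L}" "card T \<le> 12"
      "\<And>N. level_sum k f N > 0 \<Longrightarrow> L \<le> N \<Longrightarrow>
        (\<integral>y. bump x K y \<partial>level_measure k f N) \<le> (\<Sum>n\<in>T. mass L n N)"
      by (rule bump_integral_le[OF x K]) (assumption, rule that)
    let ?h = "shift_phase L h"
    have sh: "?h \<in> rep_group k u A"
      by (rule phase_power_limit_mem[OF shift_phase_tendsto(2)[OF l]])
    have "{x} \<in> sets ?\<mu>" using cp x by (simp add: circle_prob_def sets_circle_iff)
    then have "measure ?\<mu> {x} = (\<integral>y. indicator {x} y \<partial>?\<mu>)" by simp
    also have "\<dots> \<le> (\<integral>y. bump x K y \<partial>?\<mu>)"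
    proof (rule integral_mono)
      show "integrable ?\<mu> (indicator {x} :: real \<Rightarrow> real)"
        using \<open>{x} \<in> sets ?\<mu>\<close> by (simp add: \<mu>.emeasure_eq_measure)
      show "integrable ?\<mu> (bump x K)" by (rule periodic_continuous_integrable[OF cp periodic_continuous_bump])
      show "indicator {x} y \<le> bump x K y" for y
        using bump_bounds(1)[of x K y] bump_self[of x K] by (cases "y = x") simp_all
    qed
    also have "\<dots> \<le> (\<Sum>n\<in>T. (row n \<bullet> limit_state ?h) * (1 / \<rho> ^ L) / (lead \<bullet> limit_state h))"
    proof (rule tendsto_le[OF _ _ ghost_integral_tendsto[OF h l periodic_continuous_bump]])
      show "(\<lambda>j. \<Sum>n\<in>T. mass L n (l j)) \<longlonglongrightarrow>
          (\<Sum>n\<in>T. (row n \<bullet> limit_state ?h) * (1 / \<rho> ^ L) / (lead \<bullet> limit_state h))"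
        by (intro tendsto_sum mass_tendsto l level_index_pos[OF subsetD[OF T(1)]])
      show "\<forall>\<^sub>F j in sequentially. (\<integral>y. bump x K y \<partial>level_measure k f (l j)) \<le> (\<Sum>n\<in>T. mass L n (l j))"
        using eventually_compose_filterlim[OF level_sum_pos l(1)]
          eventually_compose_filterlim[OF eventually_ge_at_top[of L] l(1)]
        by eventually_elim (rule T(3))
    qed simp
    also have "\<dots> \<le> (\<Sum>n\<in>T. e / 12)"
    proof (rule sum_mono)
      fix n assume "n \<in> T"
      then have "row n \<bullet> limit_state ?h \<le> e * \<delta> / 12 * \<rho> ^ L" using L T(1) sh by blast
      then have "(row n \<bullet> limit_state ?h) * (1 / \<rho> ^ L) \<le> (e * \<delta> / 12 * \<rho> ^ L) * (1 / \<rho> ^ L)"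
        using spec_rad_pos by (intro mult_right_mono) simp_all
      also have "\<dots> = e / 12 * \<delta>" using spec_rad_pos by simp
      also have "\<dots> \<le> e / 12 * (lead \<bullet> limit_state h)" using d(2)[OF h] e by (intro mult_left_mono) simp_all
      finally show "(row n \<bullet> limit_state ?h) * (1 / \<rho> ^ L) / (lead \<bullet> limit_state h) \<le> e / 12"
        unfolding pos_divide_le_eq[OF lead_pos[OF h]] .
    qed
    also have "\<dots> = real (card T) * (e / 12)" by simp
    also have "\<dots> \<le> 12 * (e / 12)" using T(2) e by (intro mult_right_mono) simp_all
    finally show False using e by (simp add: e_def)
  qed
  then show ?thesis
    unfolding atomless_def circle_prob_space[OF cp] by (simp add: \<mu>.emeasure_eq_measure)
qed

text \<open>Failure of \<open>decay\<close> concerns limit states. It is turned into a heavy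
  interval of an actual level measure, with a threshold independent of \<open>L\<close>,
  \<open>n\<close> and \<open>h\<close>, because the total mass
  \<open>lead \<bullet> state N\<close> is eventually bounded above.\<close>

lemma heavy_block:
  assumes "\<epsilon> > 0"
  obtains e where "e > 0" "\<And>L n h. n > 0 \<Longrightarrow> h \<in> rep_group k u A \<Longrightarrow> row n \<bullet> limit_state h > \<epsilon> * \<rho> ^ L \<Longrightarrow>
    \<exists>N\<ge>L. level_sum k f N > 0 \<and> mass L n N \<ge> e"
proof -
  obtain C where C: "C > 0" "\<forall>\<^sub>F N in sequentially. norm (state N) \<le> C"
    by (rule state_upper) (rule that)
  obtain \<delta> where d: "\<delta> > 0" "\<forall>\<^sub>F N in sequentially. \<delta> \<le> lead \<bullet> state N"
    by (rule lead_lower) (rule that)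
  define C' where "C' = norm lead * C + 1"
  have C': "C' > 0" using C(1) by (simp add: C'_def add_nonneg_pos)
  have "\<exists>N\<ge>L. level_sum k f N > 0 \<and> mass L n N \<ge> \<epsilon> / C'"
    if n: "n > 0" and h: "h \<in> rep_group k u A" and gt: "row n \<bullet> limit_state h > \<epsilon> * \<rho> ^ L" for L n h
  proof -
    obtain l where l: "filterlim l at_top sequentially" "(\<lambda>j. phase_power M (l j)) \<longlonglongrightarrow> h"
      by (rule phase_group_approach[OF spec_rad_pos h]) (rule that)
    have lL: "filterlim (\<lambda>j. l j + L) at_top sequentially"
      by (rule filterlim_at_top_mono[OF l(1)]) simp
    have "(\<lambda>j. (row n \<bullet> state (l j)) * (norm_coeff (l j + L) / norm_coeff (l j))) \<longlonglongrightarrow>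
        (row n \<bullet> limit_state h) * (1 / \<rho> ^ L)"
      by (intro tendsto_mult tendsto_inner tendsto_const state_tendsto l
          filterlim_compose[OF norm_coeff_ratio l(1)])
    moreover have "\<epsilon> < (row n \<bullet> limit_state h) * (1 / \<rho> ^ L)"
      using gt spec_rad_pos by (simp add: pos_less_divide_eq)
    ultimately have "\<forall>\<^sub>F j in sequentially. \<epsilon> < (row n \<bullet> state (l j)) * (norm_coeff (l j + L) / norm_coeff (l j))"
      by (rule order_tendstoD(1))
    then have "\<forall>\<^sub>F j in sequentially. level_sum k f (L + l j) > 0 \<and> mass L n (L + l j) \<ge> \<epsilon> / C'"
      using eventually_compose_filterlim[OF level_sum_pos lL] eventually_compose_filterlim[OF C(2) lL]
        eventually_compose_filterlim[OF d(2) lL] eventually_compose_filterlim[OF eventually_gt_at_top[of 0] l(1)]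
    proof eventually_elim
      case (elim j)
      have "lead \<bullet> state (l j + L) \<le> norm lead * norm (state (l j + L))" by (rule norm_cauchy_schwarz)
      also have "\<dots> \<le> norm lead * C" using elim by (intro mult_left_mono) simp_all
      finally have up: "lead \<bullet> state (l j + L) \<le> C'" by (simp add: C'_def)
      have "\<epsilon> / C' \<le> mass L n (L + l j)"
        unfolding mass_eq[OF n elim(5)] using up elim d(1) assms by (intro frac_le) simp_all
      then show ?case using elim(2) by (simp add: add.commute)
    qed
    then obtain j where "level_sum k f (L + l j) > 0 \<and> mass L n (L + l j) \<ge> \<epsilon> / C'"
      by (rule exE[OF eventually_happens'[OF sequentially_bot]])
    then show ?thesis by (intro exI[of _ "L + l j"]) simp
  qed
  then show thesis using C' assms by (intro that[of "\<epsilon> / C'"]) simp_all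
qed

lemma bump_integral_ge:
  assumes N: "level_sum k f N > 0" "L \<le> N" and n: "n \<in> {k ^ L..<k ^ Suc L}"
    and half: "\<And>y. \<bar>y - level_point k L n\<bar> \<le> mesh L \<Longrightarrow> bump x K y \<ge> 1 / 2"
  shows "mass L n N / 2 \<le> (\<integral>y. bump x K y \<partial>level_measure k f N)"
proof -
  let ?B = "\<lambda>n. {n * k ^ (N - L)..<Suc n * k ^ (N - L)}"
  let ?g = "\<lambda>n. (\<Sum>a\<in>?B n. f a * bump x K (level_point k N a)) / level_sum k f N"
  have "mass L n N / 2 = (\<Sum>a\<in>?B n. f a * (1 / 2)) / level_sum k f N"
    unfolding mass_def sum_distrib_right[symmetric] by simp
  also have "\<dots> \<le> ?g n"
  proof (intro divide_right_mono sum_mono mult_left_mono nonneg)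
    fix a assume "a \<in> ?B n"
    from block_point[OF N(2) n this] show "1 / 2 \<le> bump x K (level_point k N a)"
      by (intro half) linarith
  qed (use N in simp)
  also have "\<dots> \<le> (\<Sum>n=k ^ L..<k ^ Suc L. ?g n)"
    using n N(1) nonneg bump_bounds(1)
    by (intro member_le_sum divide_nonneg_pos sum_nonneg mult_nonneg_nonneg) simp_all
  also have "\<dots> = (\<integral>y. bump x K y \<partial>level_measure k f N)"
    by (rule integral_mass[OF N(1) periodic_continuous_bump N(2), symmetric])
  finally show ?thesis .
qed

text \<open>Without decay there are intervals of length tending to 0 whose masses stay above
  \<open>e'\<close>. Along a subsequence their positions converge to a point and the phases of their
  levels to some \<open>h\<close>; the ghost measure of this \<open>h\<close> has an atom at that
  point.\<close>

lemma atomless_imp_decay: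
  assumes atomless: "\<And>h. h \<in> rep_group k u A \<Longrightarrow> atomless (ghost_measure k f u A h)"
  shows decay
proof (rule ccontr)
  assume "\<not> decay"
  then obtain \<epsilon> where e: "\<epsilon> > 0" "\<not> (\<forall>\<^sub>F L in sequentially.
    \<forall>n\<in>{k ^ L..<k ^ Suc L}. \<forall>h\<in>rep_group k u A. row n \<bullet> limit_state h \<le> \<epsilon> * \<rho> ^ L)"
    unfolding decay_def by blast
  obtain L where L: "filterlim L at_top sequentially" "\<And>i::nat. \<not> (\<forall>n\<in>{k ^ L i..<k ^ Suc (L i)}.
      \<forall>h\<in>rep_group k u A. row n \<bullet> limit_state h \<le> \<epsilon> * \<rho> ^ L i)"
    by (rule frequently_sequence[OF e(2)]) (rule that)
  obtain e' where e': "e' > 0" "\<And>L n h. n > 0 \<Longrightarrow> h \<in> rep_group k u A \<Longrightarrow> row n \<bullet> limit_state h > \<epsilon> * \<rho> ^ L \<Longrightarrow>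
    \<exists>N\<ge>L. level_sum k f N > 0 \<and> mass L n N \<ge> e'"
    by (rule heavy_block[OF e(1)]) (rule that)
  have "\<forall>i. \<exists>p. fst p \<in> {k ^ L i..<k ^ Suc (L i)} \<and> L i \<le> snd p \<and>
      level_sum k f (snd p) > 0 \<and> mass (L i) (fst p) (snd p) \<ge> e'"
  proof
    fix i
    obtain n h where n: "n \<in> {k ^ L i..<k ^ Suc (L i)}" and h: "h \<in> rep_group k u A"
      "row n \<bullet> limit_state h > \<epsilon> * \<rho> ^ L i" using L(2)[of i] by (meson not_le)
    obtain N where "N \<ge> L i" "level_sum k f N > 0" "mass (L i) n N \<ge> e'"
      using e'(2)[OF level_index_pos[OF n] h] by blast
    then show "\<exists>p. fst p \<in> {k ^ L i..<k ^ Suc (L i)} \<and> L i \<le> snd p \<and>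
      level_sum k f (snd p) > 0 \<and> mass (L i) (fst p) (snd p) \<ge> e'"
      using n by (intro exI[of _ "(n, N)"]) simp
  qed
  from choice[OF this] obtain p where "\<forall>i. fst (p i) \<in> {k ^ L i..<k ^ Suc (L i)} \<and> L i \<le> snd (p i) \<and>
      level_sum k f (snd (p i)) > 0 \<and> mass (L i) (fst (p i)) (snd (p i)) \<ge> e'" ..
  then obtain a N where aN: "\<And>i. a i \<in> {k ^ L i..<k ^ Suc (L i)}" "\<And>i. L i \<le> N i"
      "\<And>i. level_sum k f (N i) > 0" "\<And>i. mass (L i) (a i) (N i) \<ge> e'"
    by (intro that[of "\<lambda>i. fst (p i)" "\<lambda>i. snd (p i)"]) simp_all
  have Nlim: "filterlim N at_top sequentially"
    by (rule filterlim_at_top_mono[OF L(1)]) (simp add: aN(2))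
  obtain s h where s: "strict_mono (s :: nat \<Rightarrow> nat)" "h \<in> rep_group k u A"
    "(\<lambda>j. phase_power M (N (s j))) \<longlonglongrightarrow> h" "(\<lambda>j. state (N (s j))) \<longlonglongrightarrow> limit_state h"
    by (rule state_subsequence[OF Nlim]) (rule that)
  define \<theta> where "\<theta> i = level_point k (L i) (a i)" for i
  have "\<theta> i \<in> {0..1}" for i
  proof -
    have "0 \<le> \<theta> i" "\<theta> i + mesh (L i) \<le> 1"
      using level_point_bounds[OF k2, of "L i" "a i"] aN(1)[of i] by (simp_all add: \<theta>_def mesh_def)
    then show ?thesis using mesh_pos[of "L i"] unfolding atLeastAtMost_iff by linarith
  qed
  then have "\<forall>j. \<theta> (s j) \<in> {0..1}" by blast
  from compact_Icc[of "0::real" 1, unfolded compact_def, THEN spec[of _ "\<lambda>j. \<theta> (s j)"], THEN mp, OF this]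
  obtain x t where t: "strict_mono (t :: nat \<Rightarrow> nat)" "((\<lambda>j. \<theta> (s j)) \<circ> t) \<longlonglongrightarrow> x" by blast
  define r where "r = s \<circ> t"
  have r: "strict_mono r" unfolding r_def by (rule strict_mono_o[OF s(1) t(1)])
  have \<theta>r: "(\<lambda>j. \<theta> (r j)) \<longlonglongrightarrow> x" using t(2) by (simp add: r_def o_def)
  have Nr: "filterlim (\<lambda>j. N (r j)) at_top sequentially"
    by (rule filterlim_compose[OF Nlim filterlim_subseq[OF r]])
  have hr: "(\<lambda>j. phase_power M (N (r j))) \<longlonglongrightarrow> h"
    using filterlim_compose[OF s(3) filterlim_subseq[OF t(1)]] by (simp add: r_def)
  have meshr: "(\<lambda>j. mesh (L (r j))) \<longlonglongrightarrow> 0"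
    by (rule filterlim_compose[OF mesh_tendsto filterlim_compose[OF L(1) filterlim_subseq[OF r]]])
  note cp = circle_prob_ghost[OF s(2)]
  \<comment> \<open>The bump is fixed while the intervals shrink towards its centre, so eventually
    it is at least 1/2 on all of them.\<close>
  have ge: "e' / 2 \<le> (\<integral>y. bump x K y \<partial>ghost_measure k f u A h)" for K
  proof -
    have "isCont (bump x K) x"
      using periodic_continuous_bump[of x K] by (simp add: periodic_continuous_def continuous_on_eq_continuous_at)
    from this[unfolded continuous_at_eps_delta, THEN spec[of _ "1 / 2"], THEN mp]
    have "\<exists>d>0. \<forall>y. dist y x < d \<longrightarrow> dist (bump x K y) (bump x K x) < 1 / 2" by simp
    then obtain d where d: "d > 0" "\<And>y. dist y x < d \<Longrightarrow> dist (bump x K y) (bump x K x) < 1 / 2" by blast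
    have d': "d / 2 > 0" using d(1) by simp
    have "\<forall>\<^sub>F j in sequentially. e' / 2 \<le> (\<integral>y. bump x K y \<partial>level_measure k f (N (r j)))"
      using tendstoD[OF \<theta>r d'] order_tendstoD(2)[OF meshr d']
    proof eventually_elim
      case (elim j)
      have "mass (L (r j)) (a (r j)) (N (r j)) / 2 \<le> (\<integral>y. bump x K y \<partial>level_measure k f (N (r j)))"
      proof (rule bump_integral_ge[OF aN(3) aN(2) aN(1)])
        fix y assume "\<bar>y - level_point k (L (r j)) (a (r j))\<bar> \<le> mesh (L (r j))"
        then have "dist y x < d" using elim unfolding dist_real_def \<theta>_def by linarith
        from d(2)[OF this] show "1 / 2 \<le> bump x K y" unfolding bump_self dist_real_def by linarith
      qed
      then show ?case using aN(4)[of "r j"] by linarith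
    qed
    then show ?thesis
      by (rule tendsto_lowerbound[OF ghost_integral_tendsto[OF s(2) Nr hr periodic_continuous_bump]]) simp
  qed
  \<comment> \<open>The limit of the positions may be 1, which on the circle is the point 0; bumps
    do not see the difference.\<close>
  have f01: "0 \<le> frac x" "frac x < 1" by (simp_all add: frac_lt_1)
  have "e' / 2 \<le> measure (ghost_measure k f u A h) {frac x}"
  proof (rule tendsto_lowerbound[OF bump_integral_tendsto[OF cp f01] always_eventually])
    show "\<forall>i. e' / 2 \<le> (\<integral>y. bump (frac x) i y \<partial>ghost_measure k f u A h)"
      unfolding bump_frac by (rule allI) (rule ge)
  qed simp
  moreover have "emeasure (ghost_measure k f u A h) {frac x} = 0"
    using atomless[OF s(2)] f01 unfolding atomless_def circle_prob_space[OF cp] by simp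
  ultimately show False using e'(1) by (simp add: measure_def)
qed

end

section \<open>The reduced subspace\<close>

lemma digit_prod_word:
  assumes "k \<ge> 2"
  shows "\<exists>w. set w \<subseteq> {..<k} \<and> word_prod B w = digit_prod k B n"
proof (induction n rule: less_induct)
  case (less n)
  show ?case
  proof (cases "n = 0")
    case True
    then show ?thesis by (intro exI[of _ "[]"]) (simp add: word_prod_Nil digit_prod_0)
  next
    case False
    then have "n div k < n" using assms by simp
    then obtain w where w: "set w \<subseteq> {..<k}" "word_prod B w = digit_prod k B (n div k)" using less by blast
    have "word_prod B (w @ [n mod k]) = digit_prod k B n"
      using False assms digit_prod.simps[of k B n]
      by (simp add: word_prod_append word_prod_Cons word_prod_Nil w(2))
    then show ?thesis using w(1) assms by (intro exI[of _ "w @ [n mod k]"]) simp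
  qed
qed

lemma word_prod_replicate: "word_prod B (replicate m i) = matrix_power (B i) m"
  by (induction m) (simp_all add: word_prod_Nil word_prod_Cons matrix_power_0 matrix_power_Suc)

text \<open>A word is a run of leading zeros followed by the expansion of a number. This explains
  the form of the generators of \<open>hat_space\<close>: they run over all words, which makes the
  space invariant.\<close>

lemma word_prod_digits:
  assumes "k \<ge> 2" "set w \<subseteq> {..<k}"
  shows "\<exists>m n. word_prod B w = matrix_power (B 0) m ** digit_prod k B n"
  using assms(2)
proof (induction w rule: rev_induct)
  case Nil
  then show ?case by (intro exI[of _ 0]) (simp add: word_prod_Nil matrix_power_0 digit_prod_0)
next
  case (snoc i w)
  then obtain m n where mn: "word_prod B w = matrix_power (B 0) m ** digit_prod k B n" by auto
  have e: "word_prod B (w @ [i]) = matrix_power (B 0) m ** (digit_prod k B n ** B i)"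
    by (simp add: word_prod_append word_prod_Cons word_prod_Nil mn matrix_mul_assoc)
  show ?case
  proof (cases "n = 0 \<and> i = 0")
    \<comment> \<open>The word so far consists of zeros only, and the new letter lengthens this run
      instead of being a digit of a number.\<close>
    case True
    have "word_prod B (w @ [i]) = word_prod B (replicate m 0 @ [0])"
      using True e by (simp add: word_prod_append word_prod_replicate word_prod_Cons word_prod_Nil digit_prod_0)
    also have "\<dots> = matrix_power (B 0) (Suc m) ** digit_prod k B 0"
      by (simp add: digit_prod_0 word_prod_replicate flip: replicate_append_same[of m 0] word_prod_replicate)
    finally show ?thesis by blast
  next
    case False
    then have "digit_prod k B n ** B i = digit_prod k B (n * k + i)"
      using snoc.prems assms(1) by (intro digit_prod_step[symmetric]) auto
    then show ?thesis using e by metis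
  qed
qed

context ghost_setup
begin

abbreviation "B \<equiv> tilde k u A"
abbreviation "W \<equiv> hat_space k u A v"
abbreviation "C \<equiv> hat k u A v"

lemma hat_space_eq:
  "W = span {word_prod B w *v limit_state h | w h. set w \<subseteq> {..<k} \<and> h \<in> rep_group k u A}"
proof -
  have "{(matrix_power (B 0) m ** digit_prod k B n ** rep_rotation k u A h ** limit_matrix k u A) *v v
      | m n h. h \<in> rep_group k u A} =
    {word_prod B w *v limit_state h | w h. set w \<subseteq> {..<k} \<and> h \<in> rep_group k u A}" (is "?X = ?Y")
  proof
    show "?X \<subseteq> ?Y"
    proof
      fix x assume "x \<in> ?X"
      then obtain m n h where x: "h \<in> rep_group k u A"
        "x = (matrix_power (B 0) m ** digit_prod k B n ** rep_rotation k u A h ** limit_matrix k u A) *v v"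
        by blast
      obtain w where w: "set w \<subseteq> {..<k}" "word_prod B w = digit_prod k B n"
        using digit_prod_word[OF k2] by blast
      have "x = word_prod B (replicate m 0 @ w) *v limit_state h"
        unfolding x(2) limit_state_def
        by (simp add: word_prod_append word_prod_replicate w(2) matrix_vector_mul_assoc matrix_mul_assoc)
      moreover have "set (replicate m 0 @ w) \<subseteq> {..<k}" using w(1) k2 by auto
      ultimately show "x \<in> ?Y" using x(1) by blast
    qed
    show "?Y \<subseteq> ?X"
    proof
      fix x assume "x \<in> ?Y"
      then obtain w h where x: "set w \<subseteq> {..<k}" "h \<in> rep_group k u A" "x = word_prod B w *v limit_state h"
        by blast
      obtain m n where "word_prod B w = matrix_power (B 0) m ** digit_prod k B n"
        using word_prod_digits[OF k2 x(1)] by blast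
      then have "x = (matrix_power (B 0) m ** digit_prod k B n ** rep_rotation k u A h ** limit_matrix k u A) *v v"
        unfolding x(3) limit_state_def by (simp add: matrix_vector_mul_assoc matrix_mul_assoc)
      then show "x \<in> ?X" using x(2) by blast
    qed
  qed
  then show ?thesis unfolding hat_space_def by simp
qed

lemma subspace_W: "subspace W"
  unfolding hat_space_eq by (rule subspace_span)

lemma word_limit_mem: "set w \<subseteq> {..<k} \<Longrightarrow> h \<in> rep_group k u A \<Longrightarrow> word_prod B w *v limit_state h \<in> W"
  unfolding hat_space_eq by (rule span_base) blast

lemma limit_state_mem: "h \<in> rep_group k u A \<Longrightarrow> limit_state h \<in> W"
  using word_limit_mem[of "[]" h] by (simp add: word_prod_Nil)

lemma B_invariant:
  assumes "i < k" "x \<in> W"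
  shows "B i *v x \<in> W"
  using assms(2) unfolding hat_space_eq
proof (induction rule: span_induct_alt)
  case base
  then show ?case by (simp add: span_zero matrix_vector_mult_0_right)
next
  case (step c r y)
  then obtain w h where r: "set w \<subseteq> {..<k}" "h \<in> rep_group k u A" "r = word_prod B w *v limit_state h" by blast
  have "B i *v r = word_prod B (i # w) *v limit_state h"
    by (simp add: r(3) word_prod_Cons matrix_vector_mul_assoc)
  then have "B i *v r \<in> {word_prod B w *v limit_state h | w h. set w \<subseteq> {..<k} \<and> h \<in> rep_group k u A}"
    using r assms(1) by (intro CollectI exI[of _ "i # w"] exI[of _ h]) simp
  moreover have "B i *v (c *\<^sub>R r + y) = c *\<^sub>R (B i *v r) + B i *v y"
    by (simp add: matrix_vector_right_distrib matrix_vector_mult_scaleR)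
  ultimately show ?case using step(2) by (simp add: span_add span_scale span_base)
qed

lemma word_invariant: "set w \<subseteq> {..<k} \<Longrightarrow> x \<in> W \<Longrightarrow> word_prod B w *v x \<in> W"
  by (induction w) (simp_all add: word_prod_Nil word_prod_Cons B_invariant flip: matrix_vector_mul_assoc)

lemma limit_state_rep_space:
  assumes "h \<in> rep_group k u A"
  shows "limit_state h \<in> rep_space k u A"
proof -
  obtain l where l: "filterlim l at_top sequentially" "(\<lambda>j. phase_power M (l j)) \<longlonglongrightarrow> h"
    by (rule phase_group_approach[OF spec_rad_pos assms]) (rule that)
  show ?thesis
  proof (rule Lim_in_closed_set[OF closed_subspace[OF subspace_rep_space] _ _ state_tendsto[OF l]])
    show "\<forall>\<^sub>F j in sequentially. state (l j) \<in> rep_space k u A"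
      using eventually_compose_filterlim[OF eventually_gt_at_top[of 0] l(1)]
    proof eventually_elim
      case (elim j)
      then obtain i where "l j = Suc i" using not0_implies_Suc by blast
      then show ?case
        by (simp add: state_def matrix_power_Suc M_mem subspace_scale[OF subspace_rep_space] flip: matrix_vector_mul_assoc)
    qed
  qed simp
qed

lemma W_subset: "W \<subseteq> rep_space k u A"
  unfolding hat_space_eq
proof (rule span_minimal[OF _ subspace_rep_space], rule subsetI)
  fix x assume "x \<in> {word_prod B w *v limit_state h | w h. set w \<subseteq> {..<k} \<and> h \<in> rep_group k u A}"
  then obtain w h where x: "h \<in> rep_group k u A" "x = word_prod B w *v limit_state h" by blast
  show "x \<in> rep_space k u A"
  proof (cases w)
    case Nil
    then show ?thesis using x limit_state_rep_space by (simp add: word_prod_Nil)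
  next
    case (Cons i w')
    then show ?thesis
      by (simp add: x(2) word_prod_Cons tilde_def compress_mem[OF subspace_rep_space] flip: matrix_vector_mul_assoc)
  qed
qed

section \<open>Products of reduced matrices and rows\<close>

lemma C_apply: "C i *v x = proj W *v (B i *v (proj W *v x))"
  by (simp add: hat_def compress_apply)

lemma C_on_W: "i < k \<Longrightarrow> x \<in> W \<Longrightarrow> C i *v x = B i *v x"
  by (simp add: C_apply proj_id[OF subspace_W] B_invariant)

lemma C_proj: "C i *v (proj W *v x) = C i *v x"
  by (simp add: C_apply proj_id[OF subspace_W proj_mem[OF subspace_W]])

lemma word_C_on_W: "set w \<subseteq> {..<k} \<Longrightarrow> x \<in> W \<Longrightarrow> word_prod C w *v x = word_prod B w *v x"
  by (induction w)
    (simp_all add: word_prod_Nil word_prod_Cons C_on_W word_invariant flip: matrix_vector_mul_assoc)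

text \<open>By invariance of \<open>W\<close>, every projection but the rightmost acts as the
  identity. The empty word is the identity matrix and contains no projection at all.\<close>

lemma word_C_apply:
  assumes "set w \<subseteq> {..<k}" "w \<noteq> []"
  shows "word_prod C w *v x = word_prod B w *v (proj W *v x)"
proof -
  obtain w' i where w: "w = w' @ [i]" using assms(2) by (cases w rule: rev_cases) auto
  have "word_prod C w *v x = word_prod C w *v (proj W *v x)"
    unfolding w word_prod_append word_prod_Cons word_prod_Nil
    by (simp add: C_proj flip: matrix_vector_mul_assoc)
  then show ?thesis using word_C_on_W[OF assms(1) proj_mem[OF subspace_W]] by simp
qed

text \<open>\<open>n'\<close> is the number whose expansion is that of \<open>n\<close> followed by
  the letters of \<open>w\<close>; since \<open>n > 0\<close>, zeros in \<open>w\<close> are genuine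
  digits.\<close>

lemma row_word:
  assumes "n > 0" "set w \<subseteq> {..<k}"
  shows "\<exists>n'. n * k ^ length w \<le> n' \<and> n' < Suc n * k ^ length w \<and>
    (\<forall>y. row n \<bullet> (word_prod B w *v y) = row n' \<bullet> y)"
  using assms
proof (induction w arbitrary: n)
  case Nil
  then show ?case by (intro exI[of _ n]) (simp add: word_prod_Nil)
next
  case (Cons i w)
  have i: "i < k" and w: "set w \<subseteq> {..<k}" using Cons.prems by simp_all
  have "n * k + i > 0" using Cons.prems k2 by simp
  from Cons.IH[OF this w] obtain n' where n': "(n * k + i) * k ^ length w \<le> n'"
    "n' < Suc (n * k + i) * k ^ length w" "\<forall>y. row (n * k + i) \<bullet> (word_prod B w *v y) = row n' \<bullet> y"
    by blast
  have "Suc (n * k + i) \<le> Suc n * k" using i by simp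
  then have "Suc (n * k + i) * k ^ length w \<le> Suc n * k * k ^ length w" by (rule mult_le_mono1)
  moreover have "n * k * k ^ length w \<le> (n * k + i) * k ^ length w" by (rule mult_le_mono1) simp
  ultimately have "n * k ^ length (i # w) \<le> n'" "n' < Suc n * k ^ length (i # w)"
    using n'(1,2) by (simp_all only: length_Cons power_Suc mult.assoc[symmetric])
  moreover have "row n \<bullet> (word_prod B (i # w) *v y) = row n' \<bullet> y" for y
    using row_step[OF Cons.prems(1) i, of "word_prod B w *v y"] n'(3)
    by (simp add: word_prod_Cons flip: matrix_vector_mul_assoc)
  ultimately show ?case by blast
qed

lemma row_limit_nonneg:
  assumes "n > 0" "h \<in> rep_group k u A"
  shows "0 \<le> row n \<bullet> limit_state h"
proof -
  obtain l where l: "filterlim l at_top sequentially" "(\<lambda>j. phase_power M (l j)) \<longlonglongrightarrow> h"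
    by (rule phase_group_approach[OF spec_rad_pos assms(2)]) (rule that)
  have "(\<lambda>j. row n \<bullet> state (l j)) \<longlonglongrightarrow> row n \<bullet> limit_state h"
    by (intro tendsto_inner tendsto_const state_tendsto l)
  moreover have "\<forall>\<^sub>F j in sequentially. 0 \<le> row n \<bullet> state (l j)"
    using eventually_compose_filterlim[OF eventually_gt_at_top[of 0] l(1)]
    by eventually_elim (rule row_state_nonneg[OF assms(1)])
  ultimately show ?thesis by (rule tendsto_lowerbound) simp
qed

text \<open>The condition passes to spans in \<open>p\<close> and in \<open>x\<close>, for which
  absolute values are needed, as linear combinations destroy signs. It is uniform in the word but
  not in \<open>p\<close> and \<open>x\<close>.\<close>

definition small where
  "small p x \<longleftrightarrow> (\<forall>\<epsilon>>0. \<forall>\<^sub>F l in sequentially. \<forall>w\<in>words k l. \<bar>p \<bullet> (word_prod B w *v x)\<bar> \<le> \<epsilon> * \<rho> ^ l)"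

text \<open>Phrased with an arbitrary matrix \<open>X\<close>, so that it covers linear combinations
  in the left and in the right argument alike.\<close>

lemma small_add_scale:
  assumes "small p x" "small p' x'"
    and eq: "\<And>X :: real^'d^'d. r \<bullet> (X *v y) = c * (p \<bullet> (X *v x)) + p' \<bullet> (X *v x')"
  shows "small r y"
  unfolding small_def
proof (intro allI impI)
  fix \<epsilon> :: real assume e: "\<epsilon> > 0"
  \<comment> \<open>The summand 1 keeps the denominator positive if \<open>c = 0\<close>.\<close>
  define \<epsilon>1 where "\<epsilon>1 = \<epsilon> / 2 / (\<bar>c\<bar> + 1)"
  have e1: "\<epsilon>1 > 0" "\<bar>c\<bar> * \<epsilon>1 \<le> \<epsilon> / 2"
    using e by (simp_all add: \<epsilon>1_def field_simps add_pos_nonneg)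
  have e2: "\<epsilon> / 2 > 0" using e by simp
  show "\<forall>\<^sub>F l in sequentially. \<forall>w\<in>words k l. \<bar>r \<bullet> (word_prod B w *v y)\<bar> \<le> \<epsilon> * \<rho> ^ l"
    using assms(1)[unfolded small_def, THEN spec, THEN mp, OF e1(1)]
      assms(2)[unfolded small_def, THEN spec, THEN mp, OF e2]
  proof eventually_elim
    case (elim l)
    show ?case
    proof
      fix w assume w: "w \<in> words k l"
      have "\<bar>r \<bullet> (word_prod B w *v y)\<bar> \<le> \<bar>c\<bar> * \<bar>p \<bullet> (word_prod B w *v x)\<bar> + \<bar>p' \<bullet> (word_prod B w *v x')\<bar>"
        unfolding eq abs_mult[symmetric] by (rule abs_triangle_ineq)
      also have "\<dots> \<le> \<bar>c\<bar> * (\<epsilon>1 * \<rho> ^ l) + \<epsilon> / 2 * \<rho> ^ l"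
        by (intro add_mono mult_left_mono bspec[OF elim(1) w] bspec[OF elim(2) w]) simp
      also have "\<dots> = (\<bar>c\<bar> * \<epsilon>1 + \<epsilon> / 2) * \<rho> ^ l" by (simp only: distrib_right mult.assoc)
      also have "\<dots> \<le> (\<epsilon> / 2 + \<epsilon> / 2) * \<rho> ^ l"
        using spec_rad_pos by (intro mult_right_mono add_mono e1(2) order_refl) simp
      also have "\<dots> = \<epsilon> * \<rho> ^ l" by simp
      finally show "\<bar>r \<bullet> (word_prod B w *v y)\<bar> \<le> \<epsilon> * \<rho> ^ l" .
    qed
  qed
qed

lemma small_zero: "small 0 x" "small p 0"
  using spec_rad_pos by (simp_all add: small_def matrix_vector_mult_0_right)

text \<open>The row of \<open>n\<close> times the words \<open>w\<close> and \<open>w'\<close> is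
  the row of a number with \<open>l + s + 1\<close> digits, so decay applies; nonnegativity supplies
  the absolute value.\<close>

lemma small_generator:
  assumes decay "n > 0" "set w' \<subseteq> {..<k}" "h \<in> rep_group k u A"
  shows "small (row n) (word_prod B w' *v limit_state h)"
  unfolding small_def
proof (intro allI impI)
  fix \<epsilon> :: real assume e: "\<epsilon> > 0"
  obtain L0 where L0: "k ^ L0 \<le> n" "n < k ^ (L0 + 1)" using ex_power_ivl1[OF k2, of n] assms(2) by auto
  \<comment> \<open>The digits beyond the first that do not come from \<open>w\<close>. Their number
    is fixed, so the factor \<open>\<rho> ^ s\<close> can be put into
    \<open>\<epsilon>\<close>.\<close>
  define s where "s = L0 + length w'"
  have "\<epsilon> / \<rho> ^ s > 0" using e spec_rad_pos by simp
  from assms(1)[unfolded decay_def, THEN spec, THEN mp, OF this]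
  have "\<forall>\<^sub>F L in sequentially. \<forall>n\<in>{k ^ L..<k ^ Suc L}. \<forall>h\<in>rep_group k u A.
      row n \<bullet> limit_state h \<le> \<epsilon> / \<rho> ^ s * \<rho> ^ L" .
  from eventually_compose_filterlim[OF this filterlim_add_const_nat_at_top[of s]]
  show "\<forall>\<^sub>F l in sequentially. \<forall>w\<in>words k l.
      \<bar>row n \<bullet> (word_prod B w *v (word_prod B w' *v limit_state h))\<bar> \<le> \<epsilon> * \<rho> ^ l"
  proof eventually_elim
    case (elim l)
    show ?case
    proof
      fix w assume w: "w \<in> words k l"
      then have ww: "set (w @ w') \<subseteq> {..<k}" "length (w @ w') = l + length w'" using assms(3) by simp_all
      from row_word[OF assms(2) ww(1)] obtain n' where n': "n * k ^ (l + length w') \<le> n'"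
        "n' < Suc n * k ^ (l + length w')" "\<forall>y. row n \<bullet> (word_prod B (w @ w') *v y) = row n' \<bullet> y"
        unfolding ww(2) by blast
      have "k ^ L0 * k ^ (l + length w') \<le> n'"
        using mult_le_mono1[OF L0(1)] n'(1) by (rule le_trans)
      moreover have "n' < k ^ (L0 + 1) * k ^ (l + length w')"
        using n'(2) mult_le_mono1[of "Suc n" "k ^ (L0 + 1)" "k ^ (l + length w')"] L0(2) by linarith
      moreover have "k ^ L0 * k ^ (l + length w') = k ^ (l + s)" "k ^ (L0 + 1) * k ^ (l + length w') = k ^ Suc (l + s)"
        by (simp_all add: s_def flip: power_add add: ac_simps)
      ultimately have mem: "n' \<in> {k ^ (l + s)..<k ^ Suc (l + s)}" by (simp only: atLeastLessThan_iff)
      have "row n \<bullet> (word_prod B w *v (word_prod B w' *v limit_state h)) = row n' \<bullet> limit_state h"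
        using n'(3) by (simp add: word_prod_append flip: matrix_vector_mul_assoc)
      moreover have "0 \<le> row n' \<bullet> limit_state h"
        by (rule row_limit_nonneg[OF level_index_pos[OF mem] assms(4)])
      moreover have "row n' \<bullet> limit_state h \<le> \<epsilon> / \<rho> ^ s * \<rho> ^ (l + s)"
        using elim mem assms(4) by blast
      moreover have "\<epsilon> / \<rho> ^ s * \<rho> ^ (l + s) = \<epsilon> * \<rho> ^ l" using spec_rad_pos by (simp add: power_add)
      ultimately show "\<bar>row n \<bullet> (word_prod B w *v (word_prod B w' *v limit_state h))\<bar> \<le> \<epsilon> * \<rho> ^ l"
        by simp
    qed
  qed
qed

lemma small_all:
  assumes decay "p \<in> rep_space k u A" "x \<in> W"
  shows "small p x"
proof -
  have 1: "small (row n) x" if n: "n > 0" for n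
    using assms(3) unfolding hat_space_eq
  proof (induction rule: span_induct_alt)
    case base
    show ?case by (rule small_zero)
  next
    case (step c r y)
    then obtain w h where r: "set w \<subseteq> {..<k}" "h \<in> rep_group k u A" "r = word_prod B w *v limit_state h" by blast
    show ?case
    proof (rule small_add_scale[OF _ step(2)])
      show "small (row n) r" unfolding r(3) by (rule small_generator[OF assms(1) n r(1,2)])
      show "row n \<bullet> (X *v (c *\<^sub>R r + y)) = c * (row n \<bullet> (X *v r)) + row n \<bullet> (X *v y)" for X
        by (simp add: matrix_vector_right_distrib matrix_vector_mult_scaleR inner_add_right)
    qed
  qed
  show ?thesis using assms(2) unfolding rep_space_def
  proof (induction rule: span_induct_alt)
    case base
    show ?case by (rule small_zero)
  next
    case (step c r y)
    then obtain n where r: "n > 0" "r = row n" unfolding row_def by (auto simp: Suc_le_eq)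
    show ?case
    proof (rule small_add_scale[OF _ step(2)])
      show "small r x" unfolding r(2) by (rule 1[OF r(1)])
      show "(c *\<^sub>R r + y) \<bullet> (X *v x) = c * (r \<bullet> (X *v x)) + y \<bullet> (X *v x)" for X
        by (simp add: inner_add_left)
    qed
  qed
qed

text \<open>The entries of a reduced product are values of rows in the row space on vectors of
  \<open>W\<close>. There are finitely many pairs \<open>p i\<close>, \<open>x j\<close>, so one
  length \<open>l\<close> makes all entries small for all words at once, and one length is
  enough.\<close>

lemma decay_imp_joint_spectral_radius:
  assumes decay
  shows "joint_spectral_radius k C < \<rho>"
proof -
  \<comment> \<open>The operator norm is at most the number of entries times their bound; the factor
    2 makes the final inequality strict.\<close>
  define \<epsilon> where "\<epsilon> = 1 / (2 * (real CARD('d) * real CARD('d)))"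
  have e: "\<epsilon> > 0" "real CARD('d) * real CARD('d) * \<epsilon> = 1 / 2" by (simp_all add: \<epsilon>_def)
  define V where "V = rep_space k u A"
  define p where "p i = proj V *v axis i 1" for i :: 'd
  define x where "x j = proj W *v axis j 1" for j :: 'd
  have "small (p i) (x j)" for i j
    unfolding p_def x_def V_def
    by (intro small_all[OF assms] proj_mem subspace_W subspace_rep_space)
  then have "\<forall>\<^sub>F l in sequentially. \<forall>w\<in>words k l. \<bar>p i \<bullet> (word_prod B w *v x j)\<bar> \<le> \<epsilon> * \<rho> ^ l" for i j
    using e(1) by (simp only: small_def)
  then have "\<forall>\<^sub>F l in sequentially. \<forall>i j. \<forall>w\<in>words k l. \<bar>p i \<bullet> (word_prod B w *v x j)\<bar> \<le> \<epsilon> * \<rho> ^ l"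
    by (intro eventually_all_finite)
  then have "\<forall>\<^sub>F l in sequentially. l \<ge> 1 \<and> (\<forall>i j. \<forall>w\<in>words k l. \<bar>p i \<bullet> (word_prod B w *v x j)\<bar> \<le> \<epsilon> * \<rho> ^ l)"
    using eventually_ge_at_top[of 1] by eventually_elim (rule conjI)
  then obtain l where l: "l \<ge> 1" "\<forall>i j. \<forall>w\<in>words k l. \<bar>p i \<bullet> (word_prod B w *v x j)\<bar> \<le> \<epsilon> * \<rho> ^ l"
    using eventually_happens'[OF sequentially_bot] by blast
  have k0: "k > 0" using k2 by simp
  have "word_norm k C l < \<rho> ^ l"
  proof -
    obtain w where w: "w \<in> words k l" "word_norm k C l = onorm ((*v) (word_prod C w))"
      by (rule word_norm_attained[OF k0]) (rule that)
    have wk: "set w \<subseteq> {..<k}" "w \<noteq> []" using w(1) l(1) by auto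
    have "onorm ((*v) (word_prod C w)) \<le> real CARD('d) * real CARD('d) * (\<epsilon> * \<rho> ^ l)"
    proof (rule onorm_le_matrix_component)
      fix i j
      have mem: "word_prod B w *v x j \<in> V"
        using word_invariant[OF wk(1) proj_mem[OF subspace_W]] W_subset unfolding x_def V_def by blast
      have "word_prod C w $ i $ j = axis i 1 \<bullet> (word_prod C w *v axis j 1)"
        by (simp add: matrix_vector_mult_basis column_def inner_axis')
      \<comment> \<open>Inserting this projection costs nothing, as the vector already lies in
        \<open>V\<close>, and it moves the unit vector into the row space.\<close>
      also have "\<dots> = axis i 1 \<bullet> (proj V *v (word_prod B w *v x j))"
        using mem by (simp add: word_C_apply[OF wk] x_def V_def proj_id[OF subspace_rep_space])
      also have "\<dots> = p i \<bullet> (word_prod B w *v x j)"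
        unfolding p_def V_def by (rule inner_proj_swap[OF subspace_rep_space])
      finally show "\<bar>word_prod C w $ i $ j\<bar> \<le> \<epsilon> * \<rho> ^ l" using l(2) w(1) by simp
    qed
    also have "\<dots> = (real CARD('d) * real CARD('d) * \<epsilon>) * \<rho> ^ l" by (simp only: mult.assoc)
    also have "\<dots> < \<rho> ^ l" unfolding e(2) using spec_rad_pos by simp
    finally show ?thesis using w(2) by simp
  qed
  then show ?thesis by (rule joint_spectral_radius_lessI[OF k0 spec_rad_pos l(1)])
qed

section \<open>From the joint spectral radius to decay\<close>

lemma row_digits:
  assumes "n \<in> {k ^ L..<k ^ Suc L}"
  shows "\<exists>i w. i < k \<and> w \<in> words k L \<and> (\<forall>y. row n \<bullet> y = row i \<bullet> (word_prod B w *v y))"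
  using assms
proof (induction L arbitrary: n)
  case 0
  then show ?case by (intro exI[of _ n] exI[of _ "[]"]) (simp add: word_prod_Nil)
next
  case (Suc L)
  have k0: "k > 0" using k2 by simp
  have q: "n div k \<in> {k ^ L..<k ^ Suc L}"
    using Suc.prems k0 by (simp add: less_eq_div_iff_mult_less_eq div_less_iff_less_mult mult.commute)
  from Suc.IH[OF this] obtain i w where iw: "i < k" "w \<in> words k L"
    "\<forall>y. row (n div k) \<bullet> y = row i \<bullet> (word_prod B w *v y)" by blast
  have m: "n mod k < k" using k0 by simp
  have "row n \<bullet> y = row i \<bullet> (word_prod B (w @ [n mod k]) *v y)" for y
  proof -
    have "row n \<bullet> y = row (n div k * k + n mod k) \<bullet> y" by simp
    also have "\<dots> = row (n div k) \<bullet> (B (n mod k) *v y)"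
      by (rule row_step[OF level_index_pos[OF q] m, symmetric])
    finally show ?thesis using iw(3)
      by (simp add: word_prod_append word_prod_Cons word_prod_Nil flip: matrix_vector_mul_assoc)
  qed
  then show ?case using iw(1,2) m by (intro exI[of _ i] exI[of _ "w @ [n mod k]"]) simp
qed

lemma joint_spectral_radius_imp_decay:
  assumes "joint_spectral_radius k C < \<rho>"
  shows decay
  unfolding decay_def
proof (intro allI impI)
  fix \<epsilon> :: real assume e: "\<epsilon> > 0"
  have k0: "k > 0" using k2 by simp
  \<comment> \<open>Strictly between the joint spectral radius and \<open>\<rho>\<close>; the
    maximum with 0 guarantees that \<open>c\<close> is positive.\<close>
  define c where "c = (max (joint_spectral_radius k C) 0 + \<rho>) / 2"
  have c: "joint_spectral_radius k C < c" "0 < c" "c < \<rho>"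
    using assms spec_rad_pos by (simp_all add: c_def max_def)
  obtain K where K: "K > 0" "\<And>h. h \<in> rep_group k u A \<Longrightarrow> norm (limit_state h) \<le> K"
    by (rule limit_state_norm_bounded) (rule that)
  define R where "R = (\<Sum>i<k. norm (row i))"
  have R: "R \<ge> 0" unfolding R_def by (rule sum_nonneg) simp
  have "(\<lambda>L. R * K * (c / \<rho>) ^ L) \<longlonglongrightarrow> R * K * 0"
    using c spec_rad_pos by (intro tendsto_mult tendsto_const LIMSEQ_realpow_zero) simp_all
  then have "\<forall>\<^sub>F L in sequentially. R * K * (c / \<rho>) ^ L < \<epsilon>"
    using e by (intro order_tendstoD(2)) simp_all
  then show "\<forall>\<^sub>F L in sequentially. \<forall>n\<in>{k ^ L..<k ^ Suc L}. \<forall>h\<in>rep_group k u A.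
      row n \<bullet> limit_state h \<le> \<epsilon> * \<rho> ^ L"
    using joint_spectral_radius_lessD[OF k0 c(1,2)]
  proof eventually_elim
    case (elim L)
    show ?case
    proof (intro ballI)
      fix n h assume n: "n \<in> {k ^ L..<k ^ Suc L}" and h: "h \<in> rep_group k u A"
      from row_digits[OF n] obtain i w where iw: "i < k" "w \<in> words k L"
        "\<forall>y. row n \<bullet> y = row i \<bullet> (word_prod B w *v y)" by blast
      have "row n \<bullet> limit_state h = row i \<bullet> (word_prod C w *v limit_state h)"
        using iw(3) word_C_on_W[OF _ limit_state_mem[OF h], of w] iw(2) by simp
      also have "\<dots> \<le> norm (row i) * norm (word_prod C w *v limit_state h)" by (rule norm_cauchy_schwarz)
      also have "\<dots> \<le> R * (c ^ L * K)"
      proof (intro mult_mono R)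
        show "norm (row i) \<le> R" unfolding R_def using iw(1) by (intro member_le_sum) simp_all
        have "norm (word_prod C w *v limit_state h) \<le> onorm ((*v) (word_prod C w)) * norm (limit_state h)"
          by (rule onorm) (rule matrix_vector_mul_bounded_linear)
        also have "\<dots> \<le> c ^ L * K"
          using order_trans[OF word_norm_ge[OF iw(2)] elim(2)] K(2)[OF h] c(2)
          by (intro mult_mono) simp_all
        finally show "norm (word_prod C w *v limit_state h) \<le> c ^ L * K" .
      qed simp
      also have "\<dots> = R * K * (c / \<rho>) ^ L * \<rho> ^ L" using spec_rad_pos by (simp add: power_divide)
      also have "\<dots> \<le> \<epsilon> * \<rho> ^ L" using elim(1) spec_rad_pos by (intro mult_right_mono) simp_all
      finally show "row n \<bullet> limit_state h \<le> \<epsilon> * \<rho> ^ L" .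
    qed
  qed
qed

section \<open>Spectral radius of the reduced sum\<close>

lemma sum_C_apply: "matrix_sum k C *v x = proj W *v (M *v (proj W *v x))"
  unfolding matrix_sum_apply C_apply tilde_sum_apply
  by (rule linear_sum[unfolded o_def, symmetric]) (rule matrix_vector_mul_linear)

lemma M_invariant: "x \<in> W \<Longrightarrow> M *v x \<in> W"
  unfolding tilde_sum_apply by (intro subspace_sum[OF subspace_W] B_invariant) simp_all

text \<open>An eigenvector for a nonzero eigenvalue is fixed by the projection onto
  \<open>W\<close>, and on \<open>W\<close> the reduced sum agrees with \<open>M\<close>; thus it is
  an eigenvector of \<open>M\<close>.\<close>

lemma spec_rad_sum_C_le: "spec_rad (matrix_sum k C) \<le> \<rho>"
proof -
  let ?C = "matrix_sum k C"
  have "spec_rad ?C \<in> norm ` spectrum (cmat ?C)" by (rule spectral_radius_mem_max(1)[OF cmat_carrier]) simp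
  then obtain \<zeta> where z: "spec_rad ?C = norm \<zeta>" "eigenvalue (cmat ?C) \<zeta>" by (auto simp: spectrum_def)
  show ?thesis
  proof (cases "\<zeta> = 0")
    case False
    obtain w where w: "w \<noteq> 0" "complex_matrix ?C *v w = \<zeta> *s w" using z(2) by (auto simp: eigenvalue_cmat_iff)
    have PC: "proj W ** ?C = ?C"
      by (simp add: matrix_eq sum_C_apply proj_id[OF subspace_W proj_mem[OF subspace_W]] flip: matrix_vector_mul_assoc)
    have MP: "M ** proj W = ?C"
      by (simp add: matrix_eq sum_C_apply proj_id[OF subspace_W M_invariant[OF proj_mem[OF subspace_W]]]
          flip: matrix_vector_mul_assoc)
    have "\<zeta> *s (complex_matrix (proj W) *v w) = complex_matrix (proj W ** ?C) *v w"
      unfolding complex_matrix_mult by (simp add: w(2) vector_scalar_commute flip: matrix_vector_mul_assoc)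
    then have "\<zeta> *s (complex_matrix (proj W) *v w) = \<zeta> *s w" unfolding PC w(2) .
    then have Pw: "complex_matrix (proj W) *v w = w" using False by (simp add: vector_mul_lcancel)
    have "complex_matrix M *v w = complex_matrix (M ** proj W) *v w"
      unfolding complex_matrix_mult by (simp add: Pw flip: matrix_vector_mul_assoc)
    then have "complex_matrix M *v w = \<zeta> *s w" unfolding MP w(2) .
    then have "eigenvalue (cmat M) \<zeta>" using w(1) by (auto simp: eigenvalue_cmat_iff)
    then show ?thesis unfolding z(1) by (rule spec_rad_eigenvalue_le)
  qed (use z(1) spec_rad_pos in simp)
qed

text \<open>\<open>M\<close> to the power \<open>L\<close> sends the state of level \<open>l\<close>
  to a multiple of the state of level \<open>l + L\<close>, and the multiple tends to
  \<open>\<rho> ^ L\<close>. The uniform lower bound of \<open>lead\<close> on states thus survives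
  in the limit.\<close>

lemma lead_power_limit:
  assumes "h \<in> rep_group k u A" and d: "\<forall>\<^sub>F N in sequentially. \<delta> \<le> lead \<bullet> state N"
  shows "\<delta> * \<rho> ^ L \<le> lead \<bullet> (matrix_power M L *v limit_state h)"
proof -
  obtain l where l: "filterlim l at_top sequentially" "(\<lambda>j. phase_power M (l j)) \<longlonglongrightarrow> h"
    by (rule phase_group_approach[OF spec_rad_pos assms(1)]) (rule that)
  have lL: "filterlim (\<lambda>j. l j + L) at_top sequentially"
    by (rule filterlim_at_top_mono[OF l(1)]) simp
  have "(\<lambda>j. (norm_coeff (l j + L) / norm_coeff (l j)) * (lead \<bullet> (matrix_power M L *v state (l j)))) \<longlonglongrightarrow>
      (1 / \<rho> ^ L) * (lead \<bullet> (matrix_power M L *v limit_state h))"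
    by (intro tendsto_mult tendsto_inner tendsto_const filterlim_compose[OF norm_coeff_ratio l(1)]
        bounded_linear.tendsto[OF matrix_vector_mul_bounded_linear] state_tendsto l)
  moreover have "\<forall>\<^sub>F j in sequentially.
      \<delta> \<le> (norm_coeff (l j + L) / norm_coeff (l j)) * (lead \<bullet> (matrix_power M L *v state (l j)))"
    using eventually_compose_filterlim[OF d lL] eventually_compose_filterlim[OF eventually_gt_at_top[of 0] l(1)]
  proof eventually_elim
    case (elim j)
    have "norm_coeff (l j) > 0" by (rule norm_coeff_pos[OF elim(2)])
    moreover have "matrix_power M L *v state (l j) = norm_coeff (l j) *\<^sub>R (matrix_power M (l j + L) *v v)"
      by (simp add: state_def matrix_vector_mult_scaleR add.commute[of "l j"] flip: matrix_power_add)
    ultimately have "(norm_coeff (l j + L) / norm_coeff (l j)) * (lead \<bullet> (matrix_power M L *v state (l j))) =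
        lead \<bullet> state (l j + L)" by (simp add: state_def)
    then show ?case using elim(1) by simp
  qed
  ultimately have "\<delta> \<le> (1 / \<rho> ^ L) * (lead \<bullet> (matrix_power M L *v limit_state h))"
    by (rule tendsto_lowerbound) simp
  then show ?thesis using spec_rad_pos by (simp add: pos_le_divide_eq)
qed

text \<open>Otherwise the powers of the reduced sum divided by \<open>\<rho> ^ n\<close> would tend
  to 0 on a limit state; there they agree with those of \<open>M\<close>, on which
  \<open>lead\<close> stays above \<open>\<delta>\<close>.\<close>

lemma spec_rad_sum_C_ge: "\<rho> \<le> spec_rad (matrix_sum k C)"
proof (rule ccontr)
  let ?C = "matrix_sum k C"
  assume "\<not> \<rho> \<le> spec_rad ?C"
  then have lt: "spec_rad ?C < \<rho>" by simp
  obtain \<delta> where d: "\<delta> > 0" "\<forall>\<^sub>F N in sequentially. \<delta> \<le> lead \<bullet> state N"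
    by (rule lead_lower) (rule that)
  \<comment> \<open>The neutral element; any element of the group would serve.\<close>
  define h where "h = phase_power M 0"
  have h: "h \<in> rep_group k u A"
    unfolding h_def phase_group_def by (intro closure_subset[THEN subsetD] rangeI)
  have power: "matrix_power ?C n *v x = matrix_power M n *v x \<and> matrix_power M n *v x \<in> W" if x: "x \<in> W" for n x
  proof (induction n)
    case (Suc n)
    then show ?case
      by (simp add: matrix_power_Suc sum_C_apply proj_id[OF subspace_W] M_invariant flip: matrix_vector_mul_assoc)
  qed (simp add: matrix_power_0 x)
  have "(\<lambda>n. lead \<bullet> ((1 / \<rho> ^ n) *\<^sub>R (matrix_power ?C n *v limit_state h))) \<longlonglongrightarrow> lead \<bullet> 0"
    by (intro tendsto_inner tendsto_const normalized_power_tendsto_0 lt spec_rad_pos)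
  then have "(\<lambda>n. lead \<bullet> ((1 / \<rho> ^ n) *\<^sub>R (matrix_power ?C n *v limit_state h))) \<longlonglongrightarrow> 0" by simp
  moreover have "\<delta> \<le> lead \<bullet> ((1 / \<rho> ^ n) *\<^sub>R (matrix_power ?C n *v limit_state h))" for n
    using lead_power_limit[OF h d(2), of n] power[OF limit_state_mem[OF h], of n] spec_rad_pos
    by (simp add: pos_le_divide_eq)
  ultimately have "\<delta> \<le> 0" by (intro LIMSEQ_le_const) blast+
  then show False using d(1) by simp
qed

end

theorem theorem3:
  fixes k :: nat and f :: "nat \<Rightarrow> real"
    and u v :: "real^'d" and A :: "nat \<Rightarrow> real^'d^'d"
  assumes "k \<ge> 2"
    and "\<And>n. f n \<ge> 0"
    and "regular k f"
    and "minimal_representation k f u A v"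
    and "nondegenerate_representation k u A v"
  shows "joint_spectral_radius k (hat k u A v) < spec_rad (matrix_sum k (hat k u A v)) \<longleftrightarrow>
         (\<forall>h \<in> rep_group k u A. atomless (ghost_measure k f u A h))"
proof -
  obtain b q z m where jb: "jordan_basis (tilde_sum k u A) b q z m"
    using jordan_basis_exists[of "tilde_sum k u A"] by blast
  interpret ghost_setup k u A b q z m f v
  proof (intro ghost_setup.intro jordan_compression.intro jb jordan_compression_axioms.intro
      ghost_setup_axioms.intro)
    show "subspace (rep_space k u A)" by (rule subspace_rep_space)
    show "tilde_sum k u A *v x \<in> rep_space k u A" for x
      unfolding tilde_sum_def by (rule compress_mem[OF subspace_rep_space])
    show "tilde_sum k u A *v x = 0" if "x \<in> (rep_space k u A)\<^sup>\<bottom>" for x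
      unfolding tilde_sum_def by (rule compress_null[OF subspace_rep_space that])
    show "spec_rad (tilde_sum k u A) > 0"
      using assms(5) unfolding nondegenerate_representation_def by (rule conjunct1)
    show "2 \<le> k" "0 \<le> f n" for n using assms(1,2) by simp_all
    show "f n = u \<bullet> (digit_prod k A n *v v)" for n
      using assms(4) by (simp add: minimal_representation_def linear_representation_def)
    show "0 < u \<bullet> (((matrix_sum k A - A 0) ** rep_rotation k u A h ** limit_matrix k u A) *v v)"
      if "h \<in> rep_group k u A" for h
      using assms(5) that unfolding nondegenerate_representation_def by blast
  qed
  have "spec_rad (matrix_sum k (hat k u A v)) = spec_rad (tilde_sum k u A)"
    by (rule antisym[OF spec_rad_sum_C_le spec_rad_sum_C_ge])
  moreover have "joint_spectral_radius k (hat k u A v) < spec_rad (tilde_sum k u A) \<longleftrightarrow> decay"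
    using decay_imp_joint_spectral_radius joint_spectral_radius_imp_decay by blast
  moreover have "decay \<longleftrightarrow> (\<forall>h \<in> rep_group k u A. atomless (ghost_measure k f u A h))"
    using decay_imp_atomless atomless_imp_decay by blast
  ultimately show ?thesis by simp
qed

end
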